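(* Let $W=\coprod_{s\in S}W^s$ be an $S$-graded vector space, and let $\Gamma$ be a set of homogeneous parafermion field operators on $W$ any two of which satisfy the generalized weak commutativity. Then the subspace $\langle\Gamma\rangle$ of $F(W)$ linearly spanned by the elements $$a^{(1)}(z)_{n_1}\cdots a^{(r)}(z)_{n_r}I(z)$$ for $r\in\mathbb{N}$, $a^{(i)}(z)\in\Gamma$, $n_1,\dots,n_r\in\mathbb{C}$ (iterated products, $I(z)=\mathrm{id}_W$), equipped with the vertex operator map $Y$ given by $Y(a(z),z_0)b(z)=\sum_{n\in\mathbb{C}}(a(z)_nb(z))z_0^{-n-1}$, is a generalized vertex algebra (associated with $G,c(\cdot,\cdot),(\cdot,\cdot)$, with vacuum vector $I(z)$), and $W$ is a natural $\langle\Gamma\rangle$-module, with $Y_W(a(z),z_1)=a(z_1)$ for $a(z)\in\langle\Gamma\rangle$.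
   Context: Conventions. Vector spaces are over $\mathbb{C}$; $\mathbb{N}=\{0,1,2,\dots\}$; $z,z_0,z_1,z_2$ are commuting formal variables. For a vector space $U$, $U\{z\}$ is the space of formal series $\sum_{n\in\mathbb{C}}u(n)z^n$, $u(n)\in U$; $U[[z,z^{-1}]]$, $U((z))$, $U[[z]]$ are as usual. $\mathrm{Res}_z$ takes the coefficient of $z^{-1}$. For $\alpha\in\mathbb{C}$, $(z_1\pm z_2)^\alpha=\sum_{i\ge0}\binom{\alpha}{i}(\pm1)^iz_1^{\alpha-i}z_2^i$ (nonnegative powers of the second variable), $\left(\frac{z_1\pm z_2}{z_0}\right)^\alpha=z_0^{-\alpha}(z_1\pm z_2)^\alpha$, $\delta(z)=\sum_{n\in\mathbb{Z}}z^n$, and $\delta\left(\frac{z_2-z_1}{-z_0}\right)=\sum_{n\in\mathbb Z}(-1)^nz_0^{-n}(z_2-z_1)^n$. Setting. $G$ is an abelian group; $(\cdot,\cdot)$ is a symmetric $\mathbb{Z}$-bilinear $\mathbb{C}/2\mathbb{Z}$-valued form on $G$; $c(\cdot,\cdot)$ is a $\mathbb{C}^\times$-valued alternating $\mathbb{Z}$-bilinear form on $G$; $S$ is a $G$-set (action written $g+s$) with a $\mathbb{C}/2\mathbb{Z}$-valued function $(\cdot,\cdot)$ on $G\times S$ such that $(g_1+g_2,g_3+s)=(g_1,g_3)+(g_2,g_3)+(g_1,s)+(g_2,s)$. Fixed representatives in $\mathbb{C}$ of $(g,h)$, $(g,s)$ are used in exponents; the notions below do not depend on the choice. $F(W)$.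 A series $a(z)\in(\mathrm{End}\,W)\{z\}$ satisfies the lower truncation condition if for every $w\in W$ there are finitely many $\alpha_1,\dots,\alpha_r\in\mathbb{C}$ with $a(z)w\in\sum_i z^{\alpha_i}W[[z]]$. For $g\in G$, $F(W)^g$ is the space of $a(z)\in(\mathrm{End}\,W)\{z\}$ satisfying the lower truncation condition and $z^{(g,s)}a(z)W^s\subset W^{g+s}[[z,z^{-1}]]$ for all $s\in S$. $F(W)=\coprod_{g\in G}F(W)^g$ (direct sum). The variable $z$ is a dummy variable. Generalized weak commutativity. $a(z)\in F(W)^g$, $b(z)\in F(W)^h$ satisfy it if for some $k\in\mathbb{N}$, $(z_1-z_2)^{k+(g,h)}a(z_1)b(z_2)=(-1)^kc(g,h)(z_2-z_1)^{k+(g,h)}b(z_2)a(z_1)$. A homogeneous parafermion field operator on $W$ is an element of some $F(W)^g$ that satisfies the generalized weak commutativity with itself. Products. If $a(z)\in F(W)^g$, $b(z)\in F(W)^h$ satisfy the generalized weak commutativity, then for $n\in\mathbb{C}$, $w\in W^s$, $(a(z)_nb(z))w=\mathrm{Res}_{z_0}\mathrm{Res}_{z_1}z_0^n\left(\frac{z+z_0}{z_1}\right)^{-(g,s)}X$, where $X=z_0^{-1}\left(\frac{z_1-z}{z_0}\right)^{(g,h)}\delta\left(\frac{z_1-z}{z_0}\right)a(z_1)b(z)w-c(g,h)z_0^{-1}\left(\frac{z-z_1}{z_0}\right)^{(g,h)}\delta\left(\frac{z-z_1}{-z_0}\right)b(z)a(z_1)w$. The product lies in $F(W)^{g+h}$;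 products are extended by linearity. Generalized vertex algebra (associated with $G,c,(\cdot,\cdot)$): a $G$-graded space $V=\coprod_gV^g$ with a linear map $Y:V\to(\mathrm{End}\,V)\{z\}$, $Y(u,z)=\sum_{n\in\mathbb{C}}u_nz^{-n-1}$, and $\mathbf{1}\in V^0$ such that for $u\in V^g$, $v\in V^h$, $l\in\mathbb{C}$: $u_lV^{h}\subset V^{g+h}$; $u_lv=0$ if $\mathrm{Re}\,l$ is sufficiently large; $Y(\mathbf{1},z)=1$; $Y(v,z)\mathbf{1}\in V[[z]]$ with constant term $v$; $Y(u,z)|_{V^h}$ involves only $z^{-n-1}$ with $n\equiv(g,h)$ mod $\mathbb{Z}$; and the generalized Jacobi identity $$z_0^{-1}\left(\tfrac{z_1-z_2}{z_0}\right)^{(g,h)}\delta\left(\tfrac{z_1-z_2}{z_0}\right)Y(u,z_1)Y(v,z_2)-c(g,h)z_0^{-1}\left(\tfrac{z_2-z_1}{z_0}\right)^{(g,h)}\delta\left(\tfrac{z_2-z_1}{-z_0}\right)Y(v,z_2)Y(u,z_1)=z_2^{-1}\delta\left(\tfrac{z_1-z_0}{z_2}\right)Y(Y(u,z_0)v,z_2)\left(\tfrac{z_1-z_0}{z_2}\right)^{-g},$$ where $\left(\frac{z_1-z_0}{z_2}\right)^{-g}$ acts on $V^{g'}$ as $\left(\frac{z_1-z_0}{z_2}\right)^{-(g,g')}$. A module is an $S$-graded space $W$ with linear $Y_W:V\to(\mathrm{End}\,W)\{z\}$, $Y_W(u,z)=\sum u_nz^{-n-1}$, such that for $u\in V^g$: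 $u_lW^s\subset W^{g+s}$; $u_lw=0$ for $\mathrm{Re}\,l$ large; $Y_W(\mathbf{1},z)=1$; $Y_W(u,z)|_{W^s}$ involves only $z^{-n-1}$ with $n\equiv(g,s)$ mod $\mathbb{Z}$; and the generalized Jacobi identity holds on $W$ (outer operators $Y_W$, inner $Y(u,z_0)v$ in $V$, $\left(\frac{z_1-z_0}{z_2}\right)^{-g}$ acting on $W^s$ as $\left(\frac{z_1-z_0}{z_2}\right)^{-(g,s)}$). *)

theory Defs
  imports Complex_Main "HOL-Library.Function_Algebras" "HOL-Library.Product_Plus"
    "HOL-Library.Groups_Big_Fun"
begin

text \<open>
  Formal series. An element of \<open>U{z}\<close> is its coefficient function \<open>complex \<Rightarrow> 'u\<close>
  (\<open>f p\<close> is the coefficient of \<open>z^p\<close>), and an element of \<open>(End W){z}\<close> is a function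
  \<open>a :: complex \<Rightarrow> 'w \<Rightarrow> 'w\<close> with linear values. A series in the three variables
  \<open>z0, z1, z2\<close> is a function on the triples of exponents. Each sum written with
  \<open>Sum_any\<close> below is a formal sum which, in the situations where the notion is used, has
  only finitely many nonzero terms (\<open>Sum_any\<close> would return \<open>0\<close> otherwise).
\<close>

type_synonym exps = "complex \<times> complex \<times> complex"

text \<open>A variable is given by the exponents of its powers: \<open>z0 \<alpha>\<close> stands for \<open>z0^\<alpha>\<close>.\<close>

definition z0 :: "complex \<Rightarrow> exps" where "z0 \<alpha> = (\<alpha>, 0, 0)"
definition z1 :: "complex \<Rightarrow> exps" where "z1 \<alpha> = (0, \<alpha>, 0)"
definition z2 :: "complex \<Rightarrow> exps" where "z2 \<alpha> = (0, 0, \<alpha>)"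

definition monomial :: "exps \<Rightarrow> exps \<Rightarrow> complex" where
  "monomial d = (\<lambda>e. if e = d then 1 else 0)"

text \<open>Product of a scalar series with a vector-valued (or scalar, for \<open>sc = (*)\<close>) series.\<close>

definition ser_mult :: "(complex \<Rightarrow> 'u \<Rightarrow> 'u) \<Rightarrow> (exps \<Rightarrow> complex) \<Rightarrow> (exps \<Rightarrow> 'u) \<Rightarrow> exps \<Rightarrow> 'u::comm_monoid_add"
  where "ser_mult sc A B = (\<lambda>e. Sum_any (\<lambda>d. sc (A d) (B (e - d))))"

text \<open>
  \<open>bin_pow x \<epsilon> y \<alpha>\<close> is \<open>(x + \<epsilon> y)^\<alpha>\<close>, expanded in nonnegative powers of \<open>y\<close>;
  \<open>quot_pow x \<epsilon> y z \<alpha>\<close> is \<open>((x + \<epsilon> y)/z)^\<alpha> = z^(-\<alpha>) (x + \<epsilon> y)^\<alpha>\<close>; and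
  \<open>quot_delta x \<epsilon> y \<sigma> z\<close> is \<open>\<delta>((x + \<epsilon> y)/(\<sigma> z))\<close>, for signs \<open>\<epsilon>\<close>, \<open>\<sigma>\<close>.
\<close>

definition bin_pow :: "(complex \<Rightarrow> exps) \<Rightarrow> complex \<Rightarrow> (complex \<Rightarrow> exps) \<Rightarrow> complex \<Rightarrow> exps \<Rightarrow> complex"
  where "bin_pow x \<epsilon> y \<alpha> =
    (\<lambda>e. Sum_any (\<lambda>i::nat. (\<alpha> gchoose i) * \<epsilon> ^ i * monomial (x (\<alpha> - of_nat i) + y (of_nat i)) e))"

definition quot_pow ::
    "(complex \<Rightarrow> exps) \<Rightarrow> complex \<Rightarrow> (complex \<Rightarrow> exps) \<Rightarrow> (complex \<Rightarrow> exps) \<Rightarrow> complex \<Rightarrow> exps \<Rightarrow> complex"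
  where "quot_pow x \<epsilon> y z \<alpha> = ser_mult (*) (monomial (z (- \<alpha>))) (bin_pow x \<epsilon> y \<alpha>)"

definition quot_delta ::
    "(complex \<Rightarrow> exps) \<Rightarrow> complex \<Rightarrow> (complex \<Rightarrow> exps) \<Rightarrow> complex \<Rightarrow> (complex \<Rightarrow> exps) \<Rightarrow> exps \<Rightarrow> complex"
  where "quot_delta x \<epsilon> y \<sigma> z =
    (\<lambda>e. Sum_any (\<lambda>n::int. \<sigma> powi (- n) * quot_pow x \<epsilon> y z (of_int n) e))"

text \<open>\<open>a(z1) b(z2) w\<close> and \<open>b(z2) a(z1) w\<close> as series in \<open>z0, z1, z2\<close>.\<close>

definition comp12 :: "(complex \<Rightarrow> 'w \<Rightarrow> 'w) \<Rightarrow> (complex \<Rightarrow> 'w \<Rightarrow> 'w) \<Rightarrow> 'w \<Rightarrow> exps \<Rightarrow> 'w::zero"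
  where "comp12 a b w = (\<lambda>(p0, p1, p2). if p0 = 0 then a p1 (b p2 w) else 0)"

definition comp21 :: "(complex \<Rightarrow> 'w \<Rightarrow> 'w) \<Rightarrow> (complex \<Rightarrow> 'w \<Rightarrow> 'w) \<Rightarrow> 'w \<Rightarrow> exps \<Rightarrow> 'w::zero"
  where "comp21 b a w = (\<lambda>(p0, p1, p2). if p0 = 0 then b p2 (a p1 w) else 0)"

text \<open>
  The left-hand side of the generalized Jacobi identity, applied to \<open>w\<close>:
  \<open>z0^(-1) ((z1-z2)/z0)^\<gamma> \<delta>((z1-z2)/z0) a(z1) b(z2) w
     - \<kappa> z0^(-1) ((z2-z1)/z0)^\<gamma> \<delta>((z2-z1)/(-z0)) b(z2) a(z1) w\<close>.
\<close>

definition jacobi_lhs :: "(complex \<Rightarrow> 'w \<Rightarrow> 'w) \<Rightarrow> complex \<Rightarrow> complex \<Rightarrow>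
    (complex \<Rightarrow> 'w \<Rightarrow> 'w) \<Rightarrow> (complex \<Rightarrow> 'w \<Rightarrow> 'w) \<Rightarrow> 'w \<Rightarrow> exps \<Rightarrow> 'w::ab_group_add"
  where "jacobi_lhs sc \<gamma> \<kappa> a b w = (\<lambda>e.
      ser_mult sc
        (ser_mult (*) (monomial (z0 (-1)))
          (ser_mult (*) (quot_pow z1 (-1) z2 z0 \<gamma>) (quot_delta z1 (-1) z2 1 z0)))
        (comp12 a b w) e
    - sc \<kappa> (ser_mult sc
        (ser_mult (*) (monomial (z0 (-1)))
          (ser_mult (*) (quot_pow z2 (-1) z1 z0 \<gamma>) (quot_delta z2 (-1) z1 (-1) z0)))
        (comp21 b a w) e))"

text \<open>
  The right-hand side applied to a vector \<open>w\<close> on which \<open>((z1-z0)/z2)^(-g)\<close> acts as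
  \<open>((z1-z0)/z2)^(-\<sigma>)\<close>: \<open>z2^(-1) \<delta>((z1-z0)/z2) ((z1-z0)/z2)^(-\<sigma>) Y\<^sub>W(Y(u,z0)v,z2) w\<close>.
\<close>

definition jacobi_rhs :: "(complex \<Rightarrow> 'w \<Rightarrow> 'w) \<Rightarrow> complex \<Rightarrow> ('v \<Rightarrow> complex \<Rightarrow> 'w \<Rightarrow> 'w) \<Rightarrow>
    ('v \<Rightarrow> complex \<Rightarrow> 'v \<Rightarrow> 'v) \<Rightarrow> 'v \<Rightarrow> 'v \<Rightarrow> 'w \<Rightarrow> exps \<Rightarrow> 'w::ab_group_add"
  where "jacobi_rhs sc \<sigma> YW Y u v w =
      ser_mult sc
        (ser_mult (*) (monomial (z2 (-1)))
          (ser_mult (*) (quot_delta z1 (-1) z0 1 z2) (quot_pow z1 (-1) z0 z2 (- \<sigma>))))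
        (\<lambda>(p0, p1, p2). if p1 = 0 then YW (Y u p0 v) p2 w else 0)"

text \<open>The component \<open>u\<^sub>n\<close> of a vertex operator \<open>\<Sum>n. u\<^sub>n z^(-n-1)\<close>.\<close>

definition mode :: "(complex \<Rightarrow> 'a) \<Rightarrow> complex \<Rightarrow> 'a" where
  "mode a n = a (- n - 1)"


section \<open>The grading data\<close>

definition cong2 :: "complex \<Rightarrow> complex \<Rightarrow> bool" where
  "cong2 x y \<longleftrightarrow> (\<exists>m::int. x - y = 2 * of_int m)"

text \<open>
  \<open>\<complex>/2\<int>\<close>-valued functions are given by (arbitrary) representatives in \<open>\<complex>\<close>, so their
  identities hold modulo \<open>2\<int>\<close>.
\<close>

locale group_data =
  fixes form :: "'g::ab_group_add \<Rightarrow> 'g \<Rightarrow> complex"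
    and c :: "'g \<Rightarrow> 'g \<Rightarrow> complex"
  assumes form_sym: "cong2 (form g h) (form h g)"
    and form_add_left: "cong2 (form (g + g') h) (form g h + form g' h)"
    and form_add_right: "cong2 (form g (h + h')) (form g h + form g h')"
    and c_nonzero: "c g h \<noteq> 0"
    and c_add_left: "c (g + g') h = c g h * c g' h"
    and c_add_right: "c g (h + h') = c g h * c g h'"
    and c_alternating: "c g g = 1"

locale gset_data = group_data form c
  for form :: "'g::ab_group_add \<Rightarrow> 'g \<Rightarrow> complex" and c +
  fixes act :: "'g \<Rightarrow> 's \<Rightarrow> 's"
    and formS :: "'g \<Rightarrow> 's \<Rightarrow> complex"
  assumes act_zero: "act 0 s = s"
    and act_add: "act (g + h) s = act g (act h s)"
    and formS_add: "cong2 (formS (g1 + g2) (act g3 s))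
      (form g1 g3 + form g2 g3 + formS g1 s + formS g2 s)"

text \<open>\<open>f\<close> lists the homogeneous components of \<open>x\<close> with respect to the subspaces \<open>W s\<close>.\<close>

definition decomposes :: "('s \<Rightarrow> 'w set) \<Rightarrow> ('s \<Rightarrow> 'w) \<Rightarrow> 'w::comm_monoid_add \<Rightarrow> bool" where
  "decomposes W f x \<longleftrightarrow> (\<forall>s. f s \<in> W s) \<and> finite {s. f s \<noteq> 0} \<and> x = Sum_any f"

text \<open>The subspace \<open>C\<close> of the ambient space is the internal direct sum of the \<open>W s\<close>.\<close>

locale graded_subspace = vector_space sc
  for sc :: "complex \<Rightarrow> 'w::ab_group_add \<Rightarrow> 'w" +
  fixes C :: "'w set" and W :: "'s \<Rightarrow> 'w set"
  assumes carrier_subspace: "module.subspace sc C"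
    and component_subspace: "module.subspace sc (W s)"
    and component_subset: "W s \<subseteq> C"
    and direct_sum: "x \<in> C \<Longrightarrow> \<exists>!f. decomposes W f x"

definition linear_map_on :: "(complex \<Rightarrow> 'v \<Rightarrow> 'v) \<Rightarrow> 'v::ab_group_add set \<Rightarrow>
    (complex \<Rightarrow> 'w \<Rightarrow> 'w) \<Rightarrow> ('v \<Rightarrow> 'w::ab_group_add) \<Rightarrow> bool"
  where "linear_map_on sc1 V sc2 f \<longleftrightarrow>
    (\<forall>x\<in>V. \<forall>y\<in>V. f (x + y) = f x + f y) \<and> (\<forall>k. \<forall>x\<in>V. f (sc1 k x) = sc2 k (f x))"


section \<open>Generalized vertex algebras and their modules\<close>

text \<open>
  The space is the subspace \<open>V\<close> of an ambient vector space; \<open>Vg g\<close> is the component of degree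
  \<open>g\<close>, and \<open>Y u p\<close> is the coefficient of \<open>z^p\<close> in \<open>Y(u,z)\<close>, relevant on \<open>V\<close> only.
\<close>

locale generalized_vertex_algebra =
  group_data form c + graded_subspace sc V Vg
  for form :: "'g::ab_group_add \<Rightarrow> 'g \<Rightarrow> complex" and c
    and sc :: "complex \<Rightarrow> 'v::ab_group_add \<Rightarrow> 'v" and V and Vg :: "'g \<Rightarrow> 'v set" +
  fixes Y :: "'v \<Rightarrow> complex \<Rightarrow> 'v \<Rightarrow> 'v"
    and vac :: 'v
  assumes Y_closed: "u \<in> V \<Longrightarrow> v \<in> V \<Longrightarrow> Y u p v \<in> V"
    and Y_endo: "u \<in> V \<Longrightarrow> linear_map_on sc V sc (Y u p)"
    and Y_linear: "v \<in> V \<Longrightarrow> linear_map_on sc V sc (\<lambda>u. Y u p v)"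
    and vac_degree: "vac \<in> Vg 0"
    and Y_degree: "u \<in> Vg g \<Longrightarrow> v \<in> Vg h \<Longrightarrow> mode (Y u) l v \<in> Vg (g + h)"
    and Y_truncation: "u \<in> Vg g \<Longrightarrow> v \<in> Vg h \<Longrightarrow> \<exists>N. \<forall>l. Re l > N \<longrightarrow> mode (Y u) l v = 0"
    and Y_vac: "v \<in> V \<Longrightarrow> Y vac p v = (if p = 0 then v else 0)"
    and creation: "v \<in> V \<Longrightarrow> Y v p vac \<noteq> 0 \<Longrightarrow> p \<in> \<nat>"
    and creation_const: "v \<in> V \<Longrightarrow> Y v 0 vac = v"
    and Y_exponents: "u \<in> Vg g \<Longrightarrow> v \<in> Vg h \<Longrightarrow> mode (Y u) n v \<noteq> 0 \<Longrightarrow> n - form g h \<in> \<int>"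
    and jacobi: "u \<in> Vg g \<Longrightarrow> v \<in> Vg h \<Longrightarrow> w \<in> Vg g' \<Longrightarrow>
      jacobi_lhs sc (form g h) (c g h) (Y u) (Y v) w = jacobi_rhs sc (form g g') Y Y u v w"

locale generalized_vertex_algebra_module =
  generalized_vertex_algebra form c scV V Vg Y vac + gset_data form c act formS +
  W: graded_subspace scW UNIV W
  for form :: "'g::ab_group_add \<Rightarrow> 'g \<Rightarrow> complex" and c
    and scV :: "complex \<Rightarrow> 'v::ab_group_add \<Rightarrow> 'v" and V and Vg :: "'g \<Rightarrow> 'v set" and Y and vac
    and act :: "'g \<Rightarrow> 's \<Rightarrow> 's" and formS
    and scW :: "complex \<Rightarrow> 'w::ab_group_add \<Rightarrow> 'w" and W :: "'s \<Rightarrow> 'w set" +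
  fixes YW :: "'v \<Rightarrow> complex \<Rightarrow> 'w \<Rightarrow> 'w"
  assumes YW_endo: "u \<in> V \<Longrightarrow> Vector_Spaces.linear scW scW (YW u p)"
    and YW_linear: "linear_map_on scV V scW (\<lambda>u. YW u p w)"
    and YW_degree: "u \<in> Vg g \<Longrightarrow> w \<in> W s \<Longrightarrow> mode (YW u) l w \<in> W (act g s)"
    and YW_truncation: "u \<in> Vg g \<Longrightarrow> \<exists>N. \<forall>l. Re l > N \<longrightarrow> mode (YW u) l w = 0"
    and YW_vac: "YW vac p w = (if p = 0 then w else 0)"
    and YW_exponents: "u \<in> Vg g \<Longrightarrow> w \<in> W s \<Longrightarrow> mode (YW u) n w \<noteq> 0 \<Longrightarrow> n - formS g s \<in> \<int>"
    and YW_jacobi: "u \<in> Vg g \<Longrightarrow> v \<in> Vg h \<Longrightarrow> w \<in> W s \<Longrightarrow>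
      jacobi_lhs scW (form g h) (c g h) (YW u) (YW v) w = jacobi_rhs scW (formS g s) YW Y u v w"


section \<open>The space F(W) and its products\<close>

text \<open>
  The support condition says that \<open>a(z) w\<close> lies in a finite sum of spaces \<open>z^\<alpha> W[[z]]\<close>.
\<close>

definition lower_truncated :: "(complex \<Rightarrow> 'w \<Rightarrow> 'w::zero) \<Rightarrow> bool" where
  "lower_truncated a \<longleftrightarrow>
    (\<forall>w. \<exists>A. finite A \<and> (\<forall>p. a p w \<noteq> 0 \<longrightarrow> (\<exists>\<alpha>\<in>A. \<exists>m::nat. p = \<alpha> + of_nat m)))"

text \<open>\<open>F(W)^g\<close>.\<close>

definition field_comp :: "('g \<Rightarrow> 's \<Rightarrow> 's) \<Rightarrow> ('g \<Rightarrow> 's \<Rightarrow> complex) \<Rightarrow>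
    (complex \<Rightarrow> 'w \<Rightarrow> 'w) \<Rightarrow> ('s \<Rightarrow> 'w set) \<Rightarrow> 'g \<Rightarrow> (complex \<Rightarrow> 'w \<Rightarrow> 'w::ab_group_add) set"
  where "field_comp act formS sc W g = {a.
    (\<forall>p. Vector_Spaces.linear sc sc (a p)) \<and> lower_truncated a \<and>
    (\<forall>s. \<forall>w\<in>W s. \<forall>p. a p w \<in> W (act g s) \<and> (a p w \<noteq> 0 \<longrightarrow> formS g s + p \<in> \<int>))}"

text \<open>
  \<open>F(W)\<close> is the external direct sum of the \<open>F(W)^g\<close> (as subspaces of \<open>(End W){z}\<close> these need
  not be independent): its elements are the finitely supported families of components.
\<close>

type_synonym ('g, 'w) field_family = "'g \<Rightarrow> complex \<Rightarrow> 'w \<Rightarrow> 'w"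

definition field_space :: "('g \<Rightarrow> 's \<Rightarrow> 's) \<Rightarrow> ('g \<Rightarrow> 's \<Rightarrow> complex) \<Rightarrow>
    (complex \<Rightarrow> 'w \<Rightarrow> 'w) \<Rightarrow> ('s \<Rightarrow> 'w set) \<Rightarrow> ('g, 'w::ab_group_add) field_family set"
  where "field_space act formS sc W =
    {A. (\<forall>g. A g \<in> field_comp act formS sc W g) \<and> finite {g. A g \<noteq> 0}}"

definition field_scale :: "(complex \<Rightarrow> 'w \<Rightarrow> 'w) \<Rightarrow> complex \<Rightarrow> ('g, 'w) field_family \<Rightarrow> ('g, 'w) field_family"
  where "field_scale sc k A = (\<lambda>g p w. sc k (A g p w))"

text \<open>The inclusion of \<open>F(W)^g\<close> into \<open>F(W)\<close>.\<close>

definition homog :: "'g \<Rightarrow> (complex \<Rightarrow> 'w \<Rightarrow> 'w) \<Rightarrow> ('g, 'w::ab_group_add) field_family" where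
  "homog g a = (\<lambda>h. if h = g then a else 0)"

definition id_field :: "('g::ab_group_add, 'w::ab_group_add) field_family" where
  "id_field = homog 0 (\<lambda>p w. if p = 0 then w else 0)"

definition weakly_commutative :: "('g \<Rightarrow> 'g \<Rightarrow> complex) \<Rightarrow> ('g \<Rightarrow> 'g \<Rightarrow> complex) \<Rightarrow>
    (complex \<Rightarrow> 'w \<Rightarrow> 'w) \<Rightarrow> 'g \<Rightarrow> (complex \<Rightarrow> 'w \<Rightarrow> 'w) \<Rightarrow> 'g \<Rightarrow> (complex \<Rightarrow> 'w \<Rightarrow> 'w::ab_group_add) \<Rightarrow> bool"
  where "weakly_commutative form c sc g a h b \<longleftrightarrow> (\<exists>k::nat. \<forall>w.
    ser_mult sc (bin_pow z1 (-1) z2 (of_nat k + form g h)) (comp12 a b w) =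
    (\<lambda>e. sc ((-1) ^ k * c g h)
      (ser_mult sc (bin_pow z2 (-1) z1 (of_nat k + form g h)) (comp21 b a w) e)))"

definition parafermion_field :: "('g \<Rightarrow> 'g \<Rightarrow> complex) \<Rightarrow> ('g \<Rightarrow> 'g \<Rightarrow> complex) \<Rightarrow>
    ('g \<Rightarrow> 's \<Rightarrow> 's) \<Rightarrow> ('g \<Rightarrow> 's \<Rightarrow> complex) \<Rightarrow>
    (complex \<Rightarrow> 'w \<Rightarrow> 'w) \<Rightarrow> ('s \<Rightarrow> 'w set) \<Rightarrow> 'g \<Rightarrow> (complex \<Rightarrow> 'w \<Rightarrow> 'w::ab_group_add) \<Rightarrow> bool"
  where "parafermion_field form c act formS sc W g a \<longleftrightarrow>
    a \<in> field_comp act formS sc W g \<and> weakly_commutative form c sc g a g a"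

definition component :: "('s \<Rightarrow> 'w set) \<Rightarrow> 's \<Rightarrow> 'w \<Rightarrow> 'w::comm_monoid_add" where
  "component W s w = (THE f. decomposes W f w) s"

text \<open>
  The product \<open>a(z)\<^sub>n b(z)\<close> for \<open>a\<close> of degree \<open>g\<close> and \<open>b\<close> of degree \<open>h\<close>, with \<open>z2\<close> in the
  role of \<open>z\<close>. On \<open>w \<in> W s\<close>, the coefficient of \<open>z^p\<close> in \<open>Res\<^sub>z\<^sub>0 Res\<^sub>z\<^sub>1 f\<close> is that of
  \<open>z0^(-1) z1^(-1) z^p\<close> in \<open>f\<close>. All sums involved are finite when \<open>a\<close> and \<open>b\<close> are weakly
  commutative, which is the case where the product is meaningful.
\<close>

definition field_prod_on :: "(complex \<Rightarrow> 'w \<Rightarrow> 'w) \<Rightarrow> complex \<Rightarrow> complex \<Rightarrow> complex \<Rightarrow>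
    (complex \<Rightarrow> 'w \<Rightarrow> 'w) \<Rightarrow> complex \<Rightarrow> (complex \<Rightarrow> 'w \<Rightarrow> 'w) \<Rightarrow> complex \<Rightarrow> 'w \<Rightarrow> 'w::ab_group_add"
  where "field_prod_on sc \<gamma> \<kappa> \<sigma> a n b p w =
    ser_mult sc (ser_mult (*) (monomial (z0 n)) (quot_pow z2 1 z0 z1 (- \<sigma>)))
      (jacobi_lhs sc \<gamma> \<kappa> a b w) (-1, -1, p)"

definition field_prod :: "('g \<Rightarrow> 'g \<Rightarrow> complex) \<Rightarrow> ('g \<Rightarrow> 'g \<Rightarrow> complex) \<Rightarrow> ('g \<Rightarrow> 's \<Rightarrow> complex) \<Rightarrow>
    (complex \<Rightarrow> 'w \<Rightarrow> 'w) \<Rightarrow> ('s \<Rightarrow> 'w set) \<Rightarrow>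
    'g \<Rightarrow> (complex \<Rightarrow> 'w \<Rightarrow> 'w) \<Rightarrow> complex \<Rightarrow> 'g \<Rightarrow> (complex \<Rightarrow> 'w \<Rightarrow> 'w) \<Rightarrow> complex \<Rightarrow> 'w \<Rightarrow> 'w::ab_group_add"
  where "field_prod form c formS sc W g a n h b = (\<lambda>p w.
    Sum_any (\<lambda>s. field_prod_on sc (form g h) (c g h) (formS g s) a n b p (component W s w)))"

text \<open>The bilinear extension: the degree \<open>k\<close> part collects the products with \<open>g + h = k\<close>.\<close>

definition field_family_prod :: "('g \<Rightarrow> 'g \<Rightarrow> complex) \<Rightarrow> ('g \<Rightarrow> 'g \<Rightarrow> complex) \<Rightarrow> ('g \<Rightarrow> 's \<Rightarrow> complex) \<Rightarrow>
    (complex \<Rightarrow> 'w \<Rightarrow> 'w) \<Rightarrow> ('s \<Rightarrow> 'w set) \<Rightarrow>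
    ('g, 'w) field_family \<Rightarrow> complex \<Rightarrow> ('g, 'w) field_family \<Rightarrow>
    ('g::ab_group_add, 'w::ab_group_add) field_family"
  where "field_family_prod form c formS sc W A n B = (\<lambda>k.
    Sum_any (\<lambda>g. field_prod form c formS sc W g (A g) n (k - g) (B (k - g))))"

text \<open>\<open>\<langle>\<Gamma>\<rangle>\<close>, with iterated products associated to the right.\<close>

definition generated_space :: "('g \<Rightarrow> 'g \<Rightarrow> complex) \<Rightarrow> ('g \<Rightarrow> 'g \<Rightarrow> complex) \<Rightarrow> ('g \<Rightarrow> 's \<Rightarrow> complex) \<Rightarrow>
    (complex \<Rightarrow> 'w \<Rightarrow> 'w) \<Rightarrow> ('s \<Rightarrow> 'w set) \<Rightarrow>
    ('g \<times> (complex \<Rightarrow> 'w \<Rightarrow> 'w)) set \<Rightarrow> ('g::ab_group_add, 'w::ab_group_add) field_family set"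
  where "generated_space form c formS sc W \<Gamma> = module.span (field_scale sc)
    {foldr (\<lambda>((g, a), n) B. field_family_prod form c formS sc W (homog g a) n B) ps id_field
      | ps. \<forall>(x, n) \<in> set ps. x \<in> \<Gamma>}"

definition degree_part :: "('g, 'w::ab_group_add) field_family set \<Rightarrow> 'g \<Rightarrow> ('g, 'w) field_family set" where
  "degree_part V g = {A \<in> V. \<forall>h. h \<noteq> g \<longrightarrow> A h = 0}"

text \<open>\<open>Y(a(z),z0) b(z) = \<Sum>n. (a(z)\<^sub>n b(z)) z0^(-n-1)\<close>: the coefficient of \<open>z0^p\<close> has \<open>n = -p-1\<close>.\<close>

definition field_Y :: "('g \<Rightarrow> 'g \<Rightarrow> complex) \<Rightarrow> ('g \<Rightarrow> 'g \<Rightarrow> complex) \<Rightarrow> ('g \<Rightarrow> 's \<Rightarrow> complex) \<Rightarrow>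
    (complex \<Rightarrow> 'w \<Rightarrow> 'w) \<Rightarrow> ('s \<Rightarrow> 'w set) \<Rightarrow> ('g, 'w) field_family \<Rightarrow> complex \<Rightarrow>
    ('g, 'w) field_family \<Rightarrow> ('g::ab_group_add, 'w::ab_group_add) field_family"
  where "field_Y form c formS sc W A p B = field_family_prod form c formS sc W A (- p - 1) B"

text \<open>The operator series on \<open>W\<close> defined by an element of \<open>F(W)\<close>: the sum of its components.\<close>

definition field_YW :: "('g, 'w) field_family \<Rightarrow> complex \<Rightarrow> 'w \<Rightarrow> 'w::ab_group_add" where
  "field_YW A = Sum_any A"

end

(* A product of fields is a residue of the commutator gap
     X_N = (z1 - z)^{(g,h)+N} a(z1) b(z) - c(g,h) (-1)^N (z - z1)^{(g,h)+N} b(z) a(z1).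
   Coefficientwise, both sides of the Jacobi identity on W obey the same Pascal recurrence in N and in the
   exponent of z1, both vanish for large N by weak commutativity, and on one line of exponents they agree by
   the definition of the product; hence they agree everywhere.  Dong's lemma propagates weak commutativity to
   products, so every two fields generated by Gamma satisfy the Jacobi identity on W.

   Let V be the space of generated fields.  Multiplied by (z + x)^m (z + y)^m' with m, m' large, the product
   Y(a, x) Y(b, y) d(z) w becomes exp(z (d/dx + d/dy)) applied to x^m y^m' a(x) b(y) d(z) w.  Since the
   exponential commutes with powers of x - y, weak commutativity of a and b on W passes to Y(a, x) and Y(b, y)
   on V, which are thus weakly commuting fields on V, and the Jacobi identity applies with V in place of W.
   Its right-hand side contains Y(a)_n Y(b), which is Y(a_n b): both are fields that commute weakly with all
   Y(d), and they agree on the vacuum (Goddard's uniqueness theorem). *)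
theory Submission
  imports Defs "HOL-Computational_Algebra.Formal_Power_Series"
begin

section \<open>Finitely supported sums and binomial series\<close>

text \<open>Exponents are complex, but every coefficient identity lives on cosets of the integers:
  the \<open>z0\<close>-exponent is fixed modulo integers by \<open>form g h\<close>, the
  \<open>z1\<close>-exponent by \<open>formS g s\<close>, and off these cosets both sides of the
  Jacobi identity vanish. The recurrences therefore run over two integers. These take all integer
  values, since passing between representatives, such as \<open>form g h\<close> and
  \<open>form h g\<close>, moves them by an even number, which leaves \<open>(-1) powi N\<close>
  unchanged. Formal sums are \<open>Sum_any\<close>, which returns 0 on infinite support, so each
  exchange of sums rests on a truncation bound that is uniform in the other indices.

  The space of all generated fields is \<open>gen_fields\<close>, where closure under products holds
  by construction. The theorem speaks of \<open>alg\<close>, the span of right-nested products of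
  generators. That \<open>alg\<close> is closed under all products comes last: \<open>Y\<close> of a
  product is a product of operators \<open>Y\<close>, hence a combination of their compositions, and
  these preserve \<open>alg\<close> by induction.\<close>

lemma Sum_any_bounded:
  fixes f :: "nat \<Rightarrow> 'a::comm_monoid_add"
  assumes "\<And>i. i \<ge> B \<Longrightarrow> f i = 0"
  shows "Sum_any f = (\<Sum>i<B. f i)"
  by (rule Sum_any.expand_superset) (use assms in \<open>auto simp: not_less[symmetric]\<close>)

lemma Sum_any_single:
  assumes "\<And>x. x \<noteq> t \<Longrightarrow> f x = 0"
  shows "Sum_any f = f t"
  using Sum_any.expand_superset[of "{t}" f] assms by auto

lemma Sum_any_reindex:
  assumes "inj \<phi>" "\<And>d. d \<notin> range \<phi> \<Longrightarrow> f d = 0"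
  shows "Sum_any f = Sum_any (\<lambda>i. f (\<phi> i))"
proof -
  have "d \<in> \<phi> ` {i. f (\<phi> i) \<noteq> 0}" if "f d \<noteq> 0" for d
    using assms(2)[of d] that by blast
  then have im: "{d. f d \<noteq> 0} = \<phi> ` {i. f (\<phi> i) \<noteq> 0}" by auto
  show ?thesis
    unfolding Sum_any.expand_set im using assms(1)
    by (subst sum.reindex) (auto simp: inj_on_def inj_def)
qed

lemma Sum_any_eq_0:
  assumes "\<And>x. f x = 0" shows "Sum_any f = 0"
  using assms by simp

lemma triangle_sum:
  fixes A :: "nat \<Rightarrow> nat \<Rightarrow> 'a::comm_monoid_add"
  assumes "\<And>i j. i + j \<ge> B \<Longrightarrow> A i j = 0"
  shows "(\<Sum>i<B. \<Sum>j<B. A i j) = (\<Sum>k<B. \<Sum>i\<le>k. A i (k - i))"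
proof -
  have "(\<Sum>i<B. \<Sum>j<B. A i j) = (\<Sum>(i,j)\<in>{..<B}\<times>{..<B}. A i j)"
    by (simp add: sum.cartesian_product)
  also have "\<dots> = (\<Sum>(i,j)\<in>{(i,j). i + j < B}. A i j)"
    by (rule sum.mono_neutral_right) (use assms in \<open>force simp: not_less\<close>)+
  also have "\<dots> = (\<Sum>k<B. \<Sum>i\<le>k. A i (k - i))"
    by (rule sum.triangle_reindex)
  finally show ?thesis .
qed

text \<open>The coefficient of \<open>z\<^sub>1^p z\<^sub>2^q\<close> in \<open>(z\<^sub>1 + \<epsilon> z\<^sub>2)^\<alpha> f(z\<^sub>1, z\<^sub>2)\<close>, where \<open>f p q\<close> is that of \<open>f\<close>; here and below coefficients
  are indexed by the exponents of the variables, so \<open>a p\<close> is the mode \<open>a\<^bsub>-p-1\<^esub>\<close>. The sum is junk unless it is finite,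
  which is what \<open>diag_truncated\<close> guarantees.\<close>

definition binom_mult :: "(complex \<Rightarrow> 'w \<Rightarrow> 'w) \<Rightarrow> complex \<Rightarrow> complex \<Rightarrow>
    (complex \<Rightarrow> complex \<Rightarrow> 'w) \<Rightarrow> complex \<Rightarrow> complex \<Rightarrow> 'w::comm_monoid_add"
  where "binom_mult sc \<epsilon> \<alpha> f p q =
    Sum_any (\<lambda>i::nat. sc ((\<alpha> gchoose i) * \<epsilon> ^ i) (f (p - \<alpha> + of_nat i) (q - of_nat i)))"

definition diag_truncated :: "(complex \<Rightarrow> complex \<Rightarrow> 'w::zero) \<Rightarrow> bool" where
  "diag_truncated f \<longleftrightarrow> (\<forall>p q. \<exists>B::nat. \<forall>i\<ge>B. f (p + of_nat i) (q - of_nat i) = 0)"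

lemma diag_truncatedE:
  assumes "diag_truncated f"
  obtains B :: nat where "\<And>i. i \<ge> B \<Longrightarrow> f (p + of_nat i) (q - of_nat i) = 0"
  using assms unfolding diag_truncated_def by blast

text \<open>Coefficients of \<open>(z\<^sub>1 - z\<^sub>2)^n a(z\<^sub>1) b(z\<^sub>2) w - \<kappa> (z\<^sub>2 - z\<^sub>1)^n b(z\<^sub>2) a(z\<^sub>1) w\<close>.\<close>

definition gap_coeff :: "(complex \<Rightarrow> 'w \<Rightarrow> 'w) \<Rightarrow> complex \<Rightarrow> complex \<Rightarrow> (complex \<Rightarrow> 'w \<Rightarrow> 'w) \<Rightarrow>
    (complex \<Rightarrow> 'w \<Rightarrow> 'w) \<Rightarrow> 'w \<Rightarrow> complex \<Rightarrow> complex \<Rightarrow> 'w::ab_group_add"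
  where "gap_coeff sc \<kappa> n a b w p q =
    binom_mult sc (-1) n (\<lambda>p q. a p (b q w)) p q
    - sc \<kappa> (binom_mult sc (-1) n (\<lambda>q p. b q (a p w)) q p)"

context vector_space
begin

text \<open>When the summand depends on \<open>i + j\<close> only, nesting two binomial series
  amounts to convolving their coefficients; this turns each Vandermonde identity into an identity
  between operations on series. The common bound \<open>B\<close> keeps both \<open>Sum_any\<close>
  finite.\<close>

lemma Sum_any_Cauchy:
  fixes h :: "nat \<Rightarrow> 'b"
  assumes "\<And>k. k \<ge> B \<Longrightarrow> h k = 0"
  shows "Sum_any (\<lambda>i. scale (a i) (Sum_any (\<lambda>j. scale (b j) (h (i + j))))) =
    Sum_any (\<lambda>k. scale (\<Sum>i\<le>k. a i * b (k - i)) (h k))"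
proof -
  have 1: "Sum_any (\<lambda>j. scale (b j) (h (i + j))) = (\<Sum>j<B. scale (b j) (h (i + j)))" for i
    by (rule Sum_any_bounded) (simp add: assms)
  have "Sum_any (\<lambda>i. scale (a i) (Sum_any (\<lambda>j. scale (b j) (h (i + j))))) =
      (\<Sum>i<B. scale (a i) (\<Sum>j<B. scale (b j) (h (i + j))))"
    unfolding 1 by (rule Sum_any_bounded) (simp add: assms)
  also have "\<dots> = (\<Sum>i<B. \<Sum>j<B. scale (a i * b j) (h (i + j)))"
    by (simp add: scale_sum_right)
  also have "\<dots> = (\<Sum>k<B. \<Sum>i\<le>k. scale (a i * b (k - i)) (h (i + (k - i))))"
    by (rule triangle_sum) (simp add: assms)
  also have "\<dots> = (\<Sum>k<B. scale (\<Sum>i\<le>k. a i * b (k - i)) (h k))"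
    by (simp add: scale_sum_left)
  also have "\<dots> = Sum_any (\<lambda>k. scale (\<Sum>i\<le>k. a i * b (k - i)) (h k))"
    by (rule Sum_any_bounded[symmetric]) (simp add: assms)
  finally show ?thesis .
qed

end

lemma gbinomial_Vandermonde_atMost:
  fixes a b :: "'a::field_char_0"
  shows "(\<Sum>i\<le>k. (a gchoose i) * (b gchoose (k - i))) = (a + b gchoose k)"
  using gbinomial_Vandermonde[of a b k] by (simp add: atMost_atLeast0)

lemma gbinomial_Vandermonde_sign:
  fixes a b e :: "'a::field_char_0"
  shows "(\<Sum>i\<le>k. ((a gchoose i) * e ^ i) * ((b gchoose (k - i)) * e ^ (k - i))) = (a + b gchoose k) * e ^ k"
proof -
  have "(\<Sum>i\<le>k. ((a gchoose i) * e ^ i) * ((b gchoose (k - i)) * e ^ (k - i))) =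
      (\<Sum>i\<le>k. (a gchoose i) * (b gchoose (k - i)) * e ^ k)"
    by (rule sum.cong) (auto simp: power_add[symmetric] mult_ac)
  then show ?thesis by (simp add: gbinomial_Vandermonde_atMost sum_distrib_right[symmetric])
qed

section \<open>Multiplication by binomial powers\<close>

locale complex_vector_space = vector_space sc for sc :: "complex \<Rightarrow> 'w::ab_group_add \<Rightarrow> 'w"
begin

abbreviation bm where "bm \<equiv> binom_mult sc"

text \<open>All coefficients of \<open>f\<close> that occur lie on one antidiagonal, so the exponent
  law reduces to the Vandermonde convolution there.\<close>

lemma binom_mult_binom_mult:
  assumes "diag_truncated f"
  shows "bm \<epsilon> \<alpha> (bm \<epsilon> \<beta> f) p q = bm \<epsilon> (\<alpha> + \<beta>) f p q"
proof -
  obtain B where B: "\<And>i. i \<ge> B \<Longrightarrow> f (p - (\<alpha> + \<beta>) + of_nat i) (q - of_nat i) = 0"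
    using diag_truncatedE[OF assms] by metis
  let ?h = "\<lambda>k. f (p - (\<alpha> + \<beta>) + of_nat k) (q - of_nat k)"
  have "bm \<epsilon> \<alpha> (bm \<epsilon> \<beta> f) p q = Sum_any (\<lambda>i. sc ((\<alpha> gchoose i) * \<epsilon> ^ i)
      (Sum_any (\<lambda>j. sc ((\<beta> gchoose j) * \<epsilon> ^ j) (?h (i + j)))))"
    unfolding binom_mult_def by (simp add: algebra_simps)
  also have "\<dots> = Sum_any (\<lambda>k. sc (\<Sum>i\<le>k. ((\<alpha> gchoose i) * \<epsilon> ^ i) * ((\<beta> gchoose (k - i)) * \<epsilon> ^ (k - i))) (?h k))"
    by (rule Sum_any_Cauchy[of B]) (rule B)
  finally show ?thesis unfolding binom_mult_def gbinomial_Vandermonde_sign .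
qed

lemma binom_mult_0: "bm \<epsilon> 0 f p q = f p q"
  unfolding binom_mult_def by (subst Sum_any_single[of 0]) (auto simp: gbinomial_0_left)

text \<open>The opposite power undoes the multiplication. Truncation matters: the product of
  \<open>z\<^sub>1 - z\<^sub>2\<close> with the untruncated delta series is zero.\<close>

lemma binom_mult_eq_0_iff:
  assumes "diag_truncated f" "\<And>p q. bm \<epsilon> \<alpha> f p q = 0"
  shows "f p q = 0"
proof -
  have "f p q = bm \<epsilon> (-\<alpha>) (bm \<epsilon> \<alpha> f) p q"
    using binom_mult_binom_mult[OF assms(1), of \<epsilon> "-\<alpha>" \<alpha>] by (simp add: binom_mult_0)
  also have "\<dots> = 0" unfolding binom_mult_def[of sc _ "-\<alpha>"] assms(2) by simp
  finally show ?thesis .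
qed

lemma binom_mult_Suc:
  assumes "diag_truncated f"
  shows "bm \<epsilon> (\<alpha> + 1) f p q = bm \<epsilon> \<alpha> f (p - 1) q + sc \<epsilon> (bm \<epsilon> \<alpha> f p (q - 1))"
proof -
  have "bm \<epsilon> (\<alpha> + 1) f p q = bm \<epsilon> 1 (bm \<epsilon> \<alpha> f) p q"
    using binom_mult_binom_mult[OF assms, of \<epsilon> 1 \<alpha>] by (simp add: add.commute)
  also have "\<dots> = (\<Sum>i<2. sc ((1 gchoose i) * \<epsilon> ^ i) (bm \<epsilon> \<alpha> f (p - 1 + of_nat i) (q - of_nat i)))"
    unfolding binom_mult_def[of sc _ 1] 
  proof (rule Sum_any_bounded)
    fix i :: nat assume "2 \<le> i"
    then have "(1::complex) gchoose i = 0"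
      using gbinomial_of_nat_symmetric of_nat_gbinomial[of 1 i, where 'a=complex]
      by (simp add: gbinomial_binomial binomial_eq_0)
    then show "sc ((1 gchoose i) * \<epsilon> ^ i) (bm \<epsilon> \<alpha> f (p - 1 + of_nat i) (q - of_nat i)) = 0" by simp
  qed
  finally show ?thesis by (simp add: numeral_2_eq_2)
qed

end

section \<open>Coefficients of the Jacobi identity\<close>

text \<open>The three arguments play the part of the coordinate axes of \<open>exps\<close>, in some
  order. The two terms on the left of the Jacobi identity, its right-hand side and the residue
  factor of the product each use their own order, so the kernels are computed once for an arbitrary
  system.\<close>

definition variable_system :: "(complex \<Rightarrow> exps) \<Rightarrow> (complex \<Rightarrow> exps) \<Rightarrow> (complex \<Rightarrow> exps) \<Rightarrow> bool" where
  "variable_system x y z \<longleftrightarrow> additive x \<and> additive y \<and> additive z \<and>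
    (\<forall>e. \<exists>a b c. e = x a + y b + z c) \<and>
    (\<forall>a b c a' b' c'. x a + y b + z c = x a' + y b' + z c' \<longleftrightarrow> a = a' \<and> b = b' \<and> c = c')"

lemma variable_system_120: "variable_system z1 z2 z0"
  and variable_system_210: "variable_system z2 z1 z0"
  and variable_system_102: "variable_system z1 z0 z2"
  and variable_system_201: "variable_system z2 z0 z1"
  unfolding variable_system_def z0_def z1_def z2_def by (auto simp: additive_def)

lemma ser_mult_monomial:
  assumes "vector_space sc"
  shows "ser_mult sc (monomial m) B e = B (e - m)"
proof -
  interpret vector_space sc by fact
  show ?thesis unfolding ser_mult_def monomial_def
    by (subst Sum_any_single[of m]) auto
qed

lemma vector_space_times: "vector_space ((*) :: complex \<Rightarrow> complex \<Rightarrow> complex)"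
  by unfold_locales (auto simp: algebra_simps)

lemma ser_mult_commute:
  fixes A B :: "exps \<Rightarrow> complex"
  shows "ser_mult (*) A B = ser_mult (*) B A"
proof
  fix e :: exps
  have "bij (\<lambda>d::exps. e - d)"
    by (rule bij_betw_byWitness[of _ "\<lambda>d. e - d"]) auto
  then show "ser_mult (*) A B e = ser_mult (*) B A e"
    unfolding ser_mult_def by (rule Sum_any.reindex_cong) (auto simp: fun_eq_iff mult.commute)
qed

context
  fixes x y z :: "complex \<Rightarrow> exps"
  assumes sys: "variable_system x y z"
begin

lemma var_eq_iff: "x a + y b + z c = x a' + y b' + z c' \<longleftrightarrow> a = a' \<and> b = b' \<and> c = c'"
  using sys unfolding variable_system_def by blast

lemma var_cases: obtains a b c where "e = x a + y b + z c"
  using sys unfolding variable_system_def by blast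

lemma var_add: "x (a + b) = x a + x b" "y (a + b) = y a + y b" "z (a + b) = z a + z b"
  and var_diff: "x (a - b) = x a - x b" "y (a - b) = y a - y b" "z (a - b) = z a - z b"
  and var_minus: "x (- a) = - x a" "y (- a) = - y a" "z (- a) = - z a"
  and var_0: "x 0 = 0" "y 0 = 0" "z 0 = 0"
  using sys additive.add additive.diff additive.minus additive.zero
  unfolding variable_system_def by blast+

lemma bin_pow_coeff:
  "bin_pow x \<epsilon> y \<alpha> (x (\<alpha> - of_nat i) + y (of_nat i)) = (\<alpha> gchoose i) * \<epsilon> ^ i"
  "(\<And>i. e \<noteq> x (\<alpha> - of_nat i) + y (of_nat i)) \<Longrightarrow> bin_pow x \<epsilon> y \<alpha> e = 0"
proof -
  have inj: "x (\<alpha> - of_nat i) + y (of_nat i) = x (\<alpha> - of_nat j) + y (of_nat j) \<longleftrightarrow> i = j" for i j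
    using var_eq_iff[of "\<alpha> - of_nat i" "of_nat i" 0 "\<alpha> - of_nat j" "of_nat j" 0] by auto
  show "bin_pow x \<epsilon> y \<alpha> (x (\<alpha> - of_nat i) + y (of_nat i)) = (\<alpha> gchoose i) * \<epsilon> ^ i"
    unfolding bin_pow_def monomial_def by (subst Sum_any_single[of i]) (auto simp: inj)
  show "(\<And>i. e \<noteq> x (\<alpha> - of_nat i) + y (of_nat i)) \<Longrightarrow> bin_pow x \<epsilon> y \<alpha> e = 0"
    unfolding bin_pow_def monomial_def by simp
qed

lemma bin_pow_mult:
  assumes "vector_space sc"
  shows "ser_mult sc (bin_pow x \<epsilon> y \<alpha>) B e =
    Sum_any (\<lambda>i::nat. sc ((\<alpha> gchoose i) * \<epsilon> ^ i) (B (e - x (\<alpha> - of_nat i) - y (of_nat i))))"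
proof -
  interpret vector_space sc by fact
  let ?\<phi> = "\<lambda>i::nat. x (\<alpha> - of_nat i) + y (of_nat i)"
  have "inj ?\<phi>"
  proof
    fix i j :: nat assume "?\<phi> i = ?\<phi> j"
    then show "i = j"
      using var_eq_iff[of "\<alpha> - of_nat i" "of_nat i" 0 "\<alpha> - of_nat j" "of_nat j" 0] by auto
  qed
  then have "ser_mult sc (bin_pow x \<epsilon> y \<alpha>) B e = Sum_any (\<lambda>i. sc (bin_pow x \<epsilon> y \<alpha> (?\<phi> i)) (B (e - ?\<phi> i)))"
    unfolding ser_mult_def by (rule Sum_any_reindex) (auto simp: bin_pow_coeff(2) image_iff)
  then show ?thesis by (simp add: bin_pow_coeff(1) diff_diff_eq)
qed

lemma quot_pow_eq: "quot_pow x \<epsilon> y z \<alpha> e = bin_pow x \<epsilon> y \<alpha> (e + z \<alpha>)"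
  unfolding quot_pow_def by (simp add: ser_mult_monomial[OF vector_space_times] var_minus)

lemma quot_pow_mult:
  assumes "vector_space sc"
  shows "ser_mult sc (quot_pow x \<epsilon> y z \<alpha>) B e =
    Sum_any (\<lambda>i::nat. sc ((\<alpha> gchoose i) * \<epsilon> ^ i) (B (e - x (\<alpha> - of_nat i) - y (of_nat i) + z \<alpha>)))"
proof -
  have bij: "bij (\<lambda>d::exps. d - z \<alpha>)"
    by (rule bij_betw_byWitness[of _ "\<lambda>d. d + z \<alpha>"]) auto
  have "ser_mult sc (quot_pow x \<epsilon> y z \<alpha>) B e = ser_mult sc (bin_pow x \<epsilon> y \<alpha>) B (e + z \<alpha>)"
    unfolding ser_mult_def quot_pow_eq
    by (rule Sum_any.reindex_cong[OF bij]) (auto simp: fun_eq_iff algebra_simps)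
  then show ?thesis by (simp add: bin_pow_mult[OF assms] algebra_simps)
qed

lemma quot_delta_coeff:
  "quot_delta x \<epsilon> y \<sigma> z (x (of_int N - of_nat i) + y (of_nat i) + z (- of_int N)) =
    \<sigma> powi (- N) * ((of_int N gchoose i) * \<epsilon> ^ i)"
  "(\<And>N i. e \<noteq> x (of_int N - of_nat i) + y (of_nat i) + z (- of_int N)) \<Longrightarrow> quot_delta x \<epsilon> y \<sigma> z e = 0"
proof -
  have *: "bin_pow x \<epsilon> y (of_int M) (x (of_int N - of_nat i) + y (of_nat i) + z (- of_int N) + z (of_int M)) = 0"
    if "M \<noteq> N" for M N i
  proof (rule bin_pow_coeff(2))
    fix j
    show "x (of_int N - of_nat i) + y (of_nat i) + z (- of_int N) + z (of_int M) \<noteq> x (of_int M - of_nat j) + y (of_nat j)"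
      using var_eq_iff[of "of_int N - of_nat i" "of_nat i" "of_int M - of_int N" "of_int M - of_nat j" "of_nat j" 0] that
      by (auto simp: var_diff var_minus var_0 algebra_simps)
  qed
  show "quot_delta x \<epsilon> y \<sigma> z (x (of_int N - of_nat i) + y (of_nat i) + z (- of_int N)) =
    \<sigma> powi (- N) * ((of_int N gchoose i) * \<epsilon> ^ i)"
    unfolding quot_delta_def quot_pow_eq
  proof (subst Sum_any_single[of N])
    show "\<sigma> powi - M * bin_pow x \<epsilon> y (of_int M)
        (x (of_int N - of_nat i) + y (of_nat i) + z (- of_int N) + z (of_int M)) = 0" if "M \<noteq> N" for M
      using *[OF that] by simp
  qed (simp add: var_minus bin_pow_coeff(1))
  assume ne: "\<And>N i. e \<noteq> x (of_int N - of_nat i) + y (of_nat i) + z (- of_int N)"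
  have "bin_pow x \<epsilon> y (of_int N) (e + z (of_int N)) = 0" for N
  proof (rule bin_pow_coeff(2))
    fix i show "e + z (of_int N) \<noteq> x (of_int N - of_nat i) + y (of_nat i)"
      using ne[of N i] by (auto simp: var_minus algebra_simps eq_diff_eq)
  qed
  then show "quot_delta x \<epsilon> y \<sigma> z e = 0" unfolding quot_delta_def quot_pow_eq by simp
qed

abbreviation (input) delta_kernel where
  "delta_kernel \<epsilon> \<sigma> \<gamma> \<equiv> ser_mult (*) (quot_pow x \<epsilon> y z \<gamma>) (quot_delta x \<epsilon> y \<sigma> z)"

text \<open>Multiplying a delta series by the \<open>\<gamma>\<close>-th power of its argument only
  moves the exponents from the integers to the coset of \<open>\<gamma>\<close>. The sign
  \<open>\<sigma>\<close> sits in the delta series alone, so it still carries the integer exponent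
  \<open>- N\<close>.\<close>

lemma delta_kernel_coeff:
  "delta_kernel \<epsilon> \<sigma> \<gamma> (x (\<gamma> + of_int N - of_nat i) + y (of_nat i) + z (- \<gamma> - of_int N)) =
    \<sigma> powi (- N) * ((\<gamma> + of_int N gchoose i) * \<epsilon> ^ i)"
  "(\<And>N i. e \<noteq> x (\<gamma> + of_int N - of_nat i) + y (of_nat i) + z (- \<gamma> - of_int N)) \<Longrightarrow>
    delta_kernel \<epsilon> \<sigma> \<gamma> e = 0"
proof -
  let ?d = "quot_delta x \<epsilon> y \<sigma> z"
  have mult: "delta_kernel \<epsilon> \<sigma> \<gamma> (x a + y b + z c) =
      Sum_any (\<lambda>i. (\<gamma> gchoose i) * \<epsilon> ^ i * ?d (x (a - \<gamma> + of_nat i) + y (b - of_nat i) + z (c + \<gamma>)))" for a b c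
    unfolding quot_pow_mult[OF vector_space_times] by (simp add: var_add var_diff algebra_simps)
  have d0: "?d (x a + y b + z c) = 0" if "\<not> (\<exists>N i. a = of_int N - of_nat i \<and> b = of_nat i \<and> c = - of_int N)" for a b c
  proof (rule quot_delta_coeff(2))
    fix N i show "x a + y b + z c \<noteq> x (of_int N - of_nat i) + y (of_nat i) + z (- of_int N)"
      using that var_eq_iff[of a b c "of_int N - of_nat i" "of_nat i" "- of_int N"] by blast
  qed
  show "delta_kernel \<epsilon> \<sigma> \<gamma> (x (\<gamma> + of_int N - of_nat i) + y (of_nat i) + z (- \<gamma> - of_int N)) =
    \<sigma> powi (- N) * ((\<gamma> + of_int N gchoose i) * \<epsilon> ^ i)"
  proof -
    have "delta_kernel \<epsilon> \<sigma> \<gamma> (x (\<gamma> + of_int N - of_nat i) + y (of_nat i) + z (- \<gamma> - of_int N)) =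
        (\<Sum>j<Suc i. (\<gamma> gchoose j) * \<epsilon> ^ j * ?d (x (of_int N - of_nat i + of_nat j) + y (of_nat i - of_nat j) + z (- of_int N)))"
      unfolding mult
    \<comment> \<open>For \<open>j > i\<close> the exponent of \<open>y\<close> would be the
      negative integer \<open>i - j\<close>, where the delta series has no term.\<close>
    proof (subst Sum_any_bounded[of "Suc i"])
      fix j assume "Suc i \<le> j"
      then have "(of_nat i :: complex) \<noteq> of_nat (k + j)" for k
        unfolding of_nat_eq_iff by simp
      then have "(of_nat i - of_nat j :: complex) \<noteq> of_nat k" for k
        by (simp add: diff_eq_eq)
      then show "(\<gamma> gchoose j) * \<epsilon> ^ j * ?d (x (\<gamma> + of_int N - of_nat i - \<gamma> + of_nat j) + y (of_nat i - of_nat j) + z (- \<gamma> - of_int N + \<gamma>)) = 0"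
        by (subst d0) auto
    qed (simp add: algebra_simps)
    also have "\<dots> = (\<Sum>j\<le>i. (\<gamma> gchoose j) * \<epsilon> ^ j * (\<sigma> powi (- N) * ((of_int N gchoose (i - j)) * \<epsilon> ^ (i - j))))"
    proof (rule sum.cong)
      fix j assume "j \<in> {..i}"
      then have "x (of_int N - of_nat i + of_nat j) + y (of_nat i - of_nat j) + z (- of_int N) =
         x (of_int N - of_nat (i - j)) + y (of_nat (i - j)) + z (- of_int N)"
        by (simp add: of_nat_diff algebra_simps)
      then show "(\<gamma> gchoose j) * \<epsilon> ^ j * ?d (x (of_int N - of_nat i + of_nat j) + y (of_nat i - of_nat j) + z (- of_int N)) =
        (\<gamma> gchoose j) * \<epsilon> ^ j * (\<sigma> powi (- N) * ((of_int N gchoose (i - j)) * \<epsilon> ^ (i - j)))"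
        by (simp only: quot_delta_coeff(1))
    qed auto
    also have "\<dots> = \<sigma> powi (- N) * (\<Sum>j\<le>i. ((\<gamma> gchoose j) * \<epsilon> ^ j) * ((of_int N gchoose (i - j)) * \<epsilon> ^ (i - j)))"
      unfolding sum_distrib_left by (rule sum.cong) (auto simp: mult_ac)
    finally show ?thesis unfolding gbinomial_Vandermonde_sign .
  qed
  assume ne: "\<And>N i. e \<noteq> x (\<gamma> + of_int N - of_nat i) + y (of_nat i) + z (- \<gamma> - of_int N)"
  obtain a b c where e: "e = x a + y b + z c" by (rule var_cases)
  have "?d (x (a - \<gamma> + of_nat i) + y (b - of_nat i) + z (c + \<gamma>)) = 0" for i
  proof (rule d0, safe)
    fix N j assume "a - \<gamma> + of_nat i = of_int N - of_nat j" "b - of_nat i = of_nat j" "c + \<gamma> = - of_int N"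
    then have "a = \<gamma> + of_int N - of_nat (i + j)" "b = of_nat (i + j)" "c = - of_int N - \<gamma>"
      by (auto simp: algebra_simps eq_diff_eq)
    then show False using ne[of N "i + j"] e by (simp add: minus_diff_commute)
  qed
  then show "delta_kernel \<epsilon> \<sigma> \<gamma> e = 0" unfolding e mult by simp
qed

text \<open>Used for the left-hand side: \<open>B\<close> is free of \<open>z\<close>, so the
  \<open>z\<close>-exponent of the product determines \<open>N\<close> and a single binomial power
  remains.\<close>

lemma delta_kernel_mult:
  assumes "vector_space sc" and B: "\<And>a b c. c \<noteq> 0 \<Longrightarrow> B (x a + y b + z c) = 0"
  shows "c = - \<gamma> - of_int N \<Longrightarrow> ser_mult sc (ser_mult (*) (monomial m) (delta_kernel \<epsilon> \<sigma> \<gamma>)) B (m + (x a + y b + z c)) =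
      Sum_any (\<lambda>i::nat. sc (\<sigma> powi (- N) * ((\<gamma> + of_int N gchoose i) * \<epsilon> ^ i))
        (B (x (a - (\<gamma> + of_int N) + of_nat i) + y (b - of_nat i))))"
    and "(\<And>N. c \<noteq> - \<gamma> - of_int N) \<Longrightarrow>
      ser_mult sc (ser_mult (*) (monomial m) (delta_kernel \<epsilon> \<sigma> \<gamma>)) B (m + (x a + y b + z c)) = 0"
proof -
  interpret vector_space sc by fact
  let ?K = "delta_kernel \<epsilon> \<sigma> \<gamma>"
  have eq: "ser_mult sc (ser_mult (*) (monomial m) ?K) B (m + (x a + y b + z c)) =
      Sum_any (\<lambda>d. sc (?K d) (B (x a + y b + z c - d)))" for c
  proof -
    have bij: "bij (\<lambda>d::exps. d + m)"
      by (rule bij_betw_byWitness[of _ "\<lambda>d. d - m"]) auto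
    show ?thesis unfolding ser_mult_def[of sc]
      by (rule Sum_any.reindex_cong[OF bij])
        (auto simp: fun_eq_iff ser_mult_monomial[OF vector_space_times] algebra_simps)
  qed
  {
    assume c: "c = - \<gamma> - of_int N"
    let ?\<phi> = "\<lambda>i::nat. x (\<gamma> + of_int N - of_nat i) + y (of_nat i) + z c"
    have "inj ?\<phi>"
    proof
      fix i j :: nat assume "?\<phi> i = ?\<phi> j"
      then show "i = j" unfolding var_eq_iff by simp
    qed
    then have "ser_mult sc (ser_mult (*) (monomial m) ?K) B (m + (x a + y b + z c)) =
        Sum_any (\<lambda>i. sc (?K (?\<phi> i)) (B (x a + y b + z c - ?\<phi> i)))"
      unfolding eq
    proof (rule Sum_any_reindex)
      fix d assume d: "d \<notin> range ?\<phi>"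
      obtain a' b' c' where d': "d = x a' + y b' + z c'" by (rule var_cases)
      show "sc (?K d) (B (x a + y b + z c - d)) = 0"
      proof (cases "c' = c")
        case False
        have "x a + y b + z c - d = x (a - a') + y (b - b') + z (c - c')"
          unfolding d' by (simp add: var_diff)
        then show ?thesis using B[of "c - c'"] False by simp
      next
        case True
        have "?K d = 0"
        proof (rule delta_kernel_coeff(2))
          fix N' i show "d \<noteq> x (\<gamma> + of_int N' - of_nat i) + y (of_nat i) + z (- \<gamma> - of_int N')"
            using d True c unfolding d' var_eq_iff by (auto simp: image_iff)
        qed
        then show ?thesis by simp
      qed
    qed
    also have "\<dots> = Sum_any (\<lambda>i::nat. sc (\<sigma> powi (- N) * ((\<gamma> + of_int N gchoose i) * \<epsilon> ^ i))
        (B (x (a - (\<gamma> + of_int N) + of_nat i) + y (b - of_nat i))))"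
      unfolding c delta_kernel_coeff(1) by (simp add: var_diff var_add algebra_simps)
    finally show "ser_mult sc (ser_mult (*) (monomial m) ?K) B (m + (x a + y b + z c)) = \<dots>" .
  next
    assume c: "\<And>N. c \<noteq> - \<gamma> - of_int N"
    have "sc (?K d) (B (x a + y b + z c - d)) = 0" for d
    proof -
      obtain a' b' c' where d': "d = x a' + y b' + z c'" by (rule var_cases)
      show ?thesis
      proof (cases "c' = c")
        case False
        have "x a + y b + z c - d = x (a - a') + y (b - b') + z (c - c')"
          unfolding d' by (simp add: var_diff)
        then show ?thesis using B[of "c - c'"] False by simp
      next
        case True
        have "?K d = 0"
          by (rule delta_kernel_coeff(2)) (use c True in \<open>auto simp: d' var_eq_iff\<close>)
        then show ?thesis by simp
      qed
    qed
    then show "ser_mult sc (ser_mult (*) (monomial m) ?K) B (m + (x a + y b + z c)) = 0"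
      unfolding eq by (rule Sum_any_eq_0)
  }
qed

text \<open>Used for the right-hand side: \<open>B\<close> is free of \<open>x\<close>, so the
  \<open>x\<close>-exponent \<open>a\<close> comes from the kernel alone; it fixes
  \<open>N - i\<close> and leaves a sum over \<open>i\<close> with \<open>N = M + i\<close>.\<close>

lemma delta_kernel_mult':
  assumes "vector_space sc" and B: "\<And>a b c. a \<noteq> 0 \<Longrightarrow> B (x a + y b + z c) = 0"
  shows "a = \<gamma> + of_int M \<Longrightarrow> ser_mult sc (ser_mult (*) (monomial m) (delta_kernel \<epsilon> 1 \<gamma>)) B (m + (x a + y b + z c)) =
      Sum_any (\<lambda>i::nat. sc ((a + of_nat i gchoose i) * \<epsilon> ^ i)
        (B (y (b - of_nat i) + z (c + a + of_nat i))))"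
    and "(\<And>M. a \<noteq> \<gamma> + of_int M) \<Longrightarrow>
      ser_mult sc (ser_mult (*) (monomial m) (delta_kernel \<epsilon> 1 \<gamma>)) B (m + (x a + y b + z c)) = 0"
proof -
  interpret vector_space sc by fact
  let ?K = "delta_kernel \<epsilon> 1 \<gamma>"
  have eq: "ser_mult sc (ser_mult (*) (monomial m) ?K) B (m + (x a + y b + z c)) =
      Sum_any (\<lambda>d. sc (?K d) (B (x a + y b + z c - d)))" for a
  proof -
    have bij: "bij (\<lambda>d::exps. d + m)"
      by (rule bij_betw_byWitness[of _ "\<lambda>d. d - m"]) auto
    show ?thesis unfolding ser_mult_def[of sc]
      by (rule Sum_any.reindex_cong[OF bij])
        (auto simp: fun_eq_iff ser_mult_monomial[OF vector_space_times] algebra_simps)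
  qed
  {
    assume a: "a = \<gamma> + of_int M"
    let ?\<phi> = "\<lambda>i::nat. x a + y (of_nat i) + z (- a - of_nat i)"
    have K: "?K (?\<phi> i) = (a + of_nat i gchoose i) * \<epsilon> ^ i" for i
      using delta_kernel_coeff(1)[where \<epsilon> = \<epsilon> and \<sigma> = 1 and \<gamma> = \<gamma> and N = "M + int i" and i = i] by (simp add: a algebra_simps)
    have "inj ?\<phi>"
    proof
      fix i j :: nat assume "?\<phi> i = ?\<phi> j"
      then show "i = j" unfolding var_eq_iff by simp
    qed
    then have "ser_mult sc (ser_mult (*) (monomial m) ?K) B (m + (x a + y b + z c)) =
        Sum_any (\<lambda>i. sc (?K (?\<phi> i)) (B (x a + y b + z c - ?\<phi> i)))"
      unfolding eq
    proof (rule Sum_any_reindex)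
      fix d assume d: "d \<notin> range ?\<phi>"
      obtain a' b' c' where d': "d = x a' + y b' + z c'" by (rule var_cases)
      show "sc (?K d) (B (x a + y b + z c - d)) = 0"
      proof (cases "a' = a")
        case False
        have "x a + y b + z c - d = x (a - a') + y (b - b') + z (c - c')"
          unfolding d' by (simp add: var_diff)
        then show ?thesis using B[of "a - a'"] False by simp
      next
        case True
        have "?K d = 0"
        proof (rule delta_kernel_coeff(2))
          fix N i show "d \<noteq> x (\<gamma> + of_int N - of_nat i) + y (of_nat i) + z (- \<gamma> - of_int N)"
          proof
            assume "d = x (\<gamma> + of_int N - of_nat i) + y (of_nat i) + z (- \<gamma> - of_int N)"
            then have "a = \<gamma> + of_int N - of_nat i" "b' = of_nat i" "c' = - \<gamma> - of_int N"
              unfolding d' var_eq_iff using True by auto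
            then have "d = ?\<phi> i" unfolding d' using True by simp
            then show False using d by blast
          qed
        qed
        then show ?thesis by simp
      qed
    qed
    also have "\<dots> = Sum_any (\<lambda>i::nat. sc ((a + of_nat i gchoose i) * \<epsilon> ^ i)
        (B (y (b - of_nat i) + z (c + a + of_nat i))))"
      unfolding K by (simp add: var_diff var_add var_minus algebra_simps)
    finally show "ser_mult sc (ser_mult (*) (monomial m) ?K) B (m + (x a + y b + z c)) = \<dots>" .
  next
    assume a: "\<And>M. a \<noteq> \<gamma> + of_int M"
    have "sc (?K d) (B (x a + y b + z c - d)) = 0" for d
    proof -
      obtain a' b' c' where d': "d = x a' + y b' + z c'" by (rule var_cases)
      show ?thesis
      proof (cases "a' = a")
        case False
        have "x a + y b + z c - d = x (a - a') + y (b - b') + z (c - c')"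
          unfolding d' by (simp add: var_diff)
        then show ?thesis using B[of "a - a'"] False by simp
      next
        case True
        have "?K d = 0"
        proof (rule delta_kernel_coeff(2))
          fix N i show "d \<noteq> x (\<gamma> + of_int N - of_nat i) + y (of_nat i) + z (- \<gamma> - of_int N)"
            using a[of "N - int i"] True unfolding d' var_eq_iff by (auto simp: algebra_simps)
        qed
        then show ?thesis by simp
      qed
    qed
    then show "ser_mult sc (ser_mult (*) (monomial m) ?K) B (m + (x a + y b + z c)) = 0"
      unfolding eq by (rule Sum_any_eq_0)
  }
qed

end

lemma (in vector_space) scale_Sum_any: "scale k (Sum_any f) = Sum_any (\<lambda>x. scale k (f x))"
proof (cases "k = 0")
  case False
  then have "{x. scale k (f x) \<noteq> 0} = {x. f x \<noteq> 0}" by auto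
  then show ?thesis unfolding Sum_any.expand_set by (simp add: scale_sum_right)
qed simp

lemma minus_one_powi_minus: "(-1 :: 'a::field) powi (- N) = (-1) powi N"
  by (metis inverse_1 inverse_minus_eq power_int_inverse power_int_minus)

section \<open>The two sides of the Jacobi identity and the product, coefficient by
  coefficient\<close>

context complex_vector_space
begin

abbreviation gc where "gc \<equiv> gap_coeff sc"

lemma vs: "vector_space sc" by unfold_locales

text \<open>The power of \<open>z0\<close> selects one term of each delta series. The argument
  \<open>- z0\<close> of the second one contributes the sign \<open>(-1) powi N\<close>, which joins
  \<open>\<kappa>\<close>.\<close>

lemma jacobi_lhs_coeff:
  "jacobi_lhs sc \<gamma> \<kappa> a b w (- 1 - \<gamma> - of_int N, p, q) =
    gc (\<kappa> * (-1) powi N) (\<gamma> + of_int N) a b w p q"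
proof -
  have 1: "(- 1 - \<gamma> - of_int N, p, q) = z0 (-1) + (z1 p + z2 q + z0 (- \<gamma> - of_int N))"
    and 2: "(- 1 - \<gamma> - of_int N, p, q) = z0 (-1) + (z2 q + z1 p + z0 (- \<gamma> - of_int N))"
    by (auto simp: z0_def z1_def z2_def)
  have c1: "c \<noteq> 0 \<Longrightarrow> comp12 a b w (z1 p + z2 q + z0 c) = 0" for p q c
    by (simp add: comp12_def z0_def z1_def z2_def)
  have c2: "c \<noteq> 0 \<Longrightarrow> comp21 b a w (z2 p + z1 q + z0 c) = 0" for p q c
    by (simp add: comp21_def z0_def z1_def z2_def)
  have first: "ser_mult sc (ser_mult (*) (monomial (z0 (-1)))
        (ser_mult (*) (quot_pow z1 (-1) z2 z0 \<gamma>) (quot_delta z1 (-1) z2 1 z0)))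
        (comp12 a b w) (- 1 - \<gamma> - of_int N, p, q) =
      bm (-1) (\<gamma> + of_int N) (\<lambda>p q. a p (b q w)) p q"
    unfolding 1 binom_mult_def
    by (subst delta_kernel_mult(1)[OF variable_system_120 vs, where B = "comp12 a b w", OF c1]) (auto simp: comp12_def z1_def z2_def)
  have second: "ser_mult sc (ser_mult (*) (monomial (z0 (-1)))
        (ser_mult (*) (quot_pow z2 (-1) z1 z0 \<gamma>) (quot_delta z2 (-1) z1 (-1) z0)))
        (comp21 b a w) (- 1 - \<gamma> - of_int N, p, q) =
      sc ((-1) powi N) (bm (-1) (\<gamma> + of_int N) (\<lambda>q p. b q (a p w)) q p)"
    unfolding 2 binom_mult_def
    by (subst delta_kernel_mult(1)[OF variable_system_210 vs, where B = "comp21 b a w", OF c2])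
      (auto simp: comp21_def z1_def z2_def scale_Sum_any minus_one_powi_minus)
  show ?thesis unfolding jacobi_lhs_def first second gap_coeff_def by simp
qed

lemma jacobi_lhs_eq_0:
  assumes "- 1 - e0 - \<gamma> \<notin> \<int>"
  shows "jacobi_lhs sc \<gamma> \<kappa> a b w (e0, p, q) = 0"
proof -
  have 1: "(e0, p, q) = z0 (-1) + (z1 p + z2 q + z0 (e0 + 1))"
    and 2: "(e0, p, q) = z0 (-1) + (z2 q + z1 p + z0 (e0 + 1))"
    by (auto simp: z0_def z1_def z2_def)
  have c1: "c \<noteq> 0 \<Longrightarrow> comp12 a b w (z1 p + z2 q + z0 c) = 0" for p q c
    by (simp add: comp12_def z0_def z1_def z2_def)
  have c2: "c \<noteq> 0 \<Longrightarrow> comp21 b a w (z2 p + z1 q + z0 c) = 0" for p q c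
    by (simp add: comp21_def z0_def z1_def z2_def)
  have ne: "e0 + 1 \<noteq> - \<gamma> - of_int N" for N
  proof
    assume "e0 + 1 = - \<gamma> - of_int N"
    then have "- 1 - e0 - \<gamma> = of_int N" by (metis add.commute add_diff_cancel_left' diff_diff_eq minus_diff_commute minus_diff_eq)
    then show False using assms by simp
  qed
  have first: "ser_mult sc (ser_mult (*) (monomial (z0 (-1)))
        (ser_mult (*) (quot_pow z1 (-1) z2 z0 \<gamma>) (quot_delta z1 (-1) z2 1 z0)))
        (comp12 a b w) (e0, p, q) = 0"
    unfolding 1 by (rule delta_kernel_mult(2)[OF variable_system_120 vs, where B = "comp12 a b w", OF c1 ne])
  have second: "ser_mult sc (ser_mult (*) (monomial (z0 (-1)))
        (ser_mult (*) (quot_pow z2 (-1) z1 z0 \<gamma>) (quot_delta z2 (-1) z1 (-1) z0)))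
        (comp21 b a w) (e0, p, q) = 0"
    unfolding 2 by (rule delta_kernel_mult(2)[OF variable_system_210 vs, where B = "comp21 b a w", OF c2 ne])
  show ?thesis unfolding jacobi_lhs_def first second by simp
qed

text \<open>The exponent \<open>\<sigma>\<close> only decides on which coset of
  \<open>z1\<close>-exponents the series lives; on that coset the coefficient no longer mentions
  it.\<close>

lemma jacobi_rhs_coeff:
  assumes "e1 + \<sigma> \<in> \<int>"
  shows "jacobi_rhs sc \<sigma> YW Y u v w (e0, e1, e2) =
    Sum_any (\<lambda>i::nat. sc ((- 1 - e1) gchoose i) (YW (Y u (e0 - of_nat i) v) (e2 + 1 + e1 + of_nat i) w))"
proof -
  have 1: "(e0, e1, e2) = z2 (-1) + (z1 e1 + z0 e0 + z2 (e2 + 1))"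
    by (auto simp: z0_def z1_def z2_def)
  define B :: "exps \<Rightarrow> 'w" where "B = (\<lambda>(p0, p1, p2). if p1 = 0 then YW (Y u p0 v) p2 w else 0)"
  have B: "a \<noteq> 0 \<Longrightarrow> B (z1 a + z0 b + z2 c) = 0" for a b c
    by (simp add: B_def z0_def z1_def z2_def)
  obtain M where M: "e1 = - \<sigma> + of_int M"
    using assms by (metis Ints_cases add_diff_cancel_right' add.commute uminus_add_conv_diff)
  \<comment> \<open>Negating the upper index absorbs the sign of \<open>z1 - z0\<close>.\<close>
  have s: "(e1 + of_nat i gchoose i) * (-1) ^ i = (- 1 - e1) gchoose i" for i
    using gbinomial_negated_upper[of "- 1 - e1" i] by (simp add: algebra_simps)
  show ?thesis
    unfolding jacobi_rhs_def 1 ser_mult_commute[of "quot_delta z1 (- 1) z0 1 z2"] B_def[symmetric]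
    by (subst delta_kernel_mult'(1)[OF variable_system_102 vs, where B = B, OF B M])
      (auto simp: s B_def z0_def z2_def)
qed

lemma jacobi_rhs_eq_0:
  assumes "e1 + \<sigma> \<notin> \<int>"
  shows "jacobi_rhs sc \<sigma> YW Y u v w (e0, e1, e2) = 0"
proof -
  have 1: "(e0, e1, e2) = z2 (-1) + (z1 e1 + z0 e0 + z2 (e2 + 1))"
    by (auto simp: z0_def z1_def z2_def)
  define B :: "exps \<Rightarrow> 'w" where "B = (\<lambda>(p0, p1, p2). if p1 = 0 then YW (Y u p0 v) p2 w else 0)"
  have B: "a \<noteq> 0 \<Longrightarrow> B (z1 a + z0 b + z2 c) = 0" for a b c
    by (simp add: B_def z0_def z1_def z2_def)
  have M: "e1 \<noteq> - \<sigma> + of_int M" for M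
    using assms by auto
  show ?thesis
    unfolding jacobi_rhs_def 1 ser_mult_commute[of "quot_delta z1 (- 1) z0 1 z2"] B_def[symmetric]
    by (rule delta_kernel_mult'(2)[OF variable_system_102 vs, where B = B, OF B M])
qed

text \<open>The residue factor contains \<open>z1\<close> only as \<open>z1\<close> to the power
  \<open>\<sigma>\<close>, so the residue in \<open>z1\<close> reads the single exponent
  \<open>- 1 - \<sigma>\<close>. This is the line of exponents on which products are given directly
  by Jacobi coefficients.\<close>

lemma field_prod_on_eq:
  "field_prod_on sc \<gamma> \<kappa> \<sigma> a n b p w = Sum_any (\<lambda>i::nat. sc (- \<sigma> gchoose i)
    (jacobi_lhs sc \<gamma> \<kappa> a b w (- 1 - n - of_nat i, - 1 - \<sigma>, p + \<sigma> + of_nat i)))"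
proof -
  have "ser_mult sc (ser_mult (*) (monomial (z0 n)) A) J e = ser_mult sc A J (e - z0 n)" for A J e
  proof -
    have bij: "bij (\<lambda>d::exps. d + z0 n)"
      by (rule bij_betw_byWitness[of _ "\<lambda>d. d - z0 n"]) auto
    show ?thesis unfolding ser_mult_def[of sc]
      by (rule Sum_any.reindex_cong[OF bij])
        (auto simp: fun_eq_iff ser_mult_monomial[OF vector_space_times] algebra_simps)
  qed
  then show ?thesis unfolding field_prod_on_def
    by (simp add: quot_pow_mult[OF variable_system_201 vs]) (simp add: z0_def z1_def z2_def algebra_simps)
qed

lemma weakly_commutative_iff:
  "weakly_commutative form c sc g a h b \<longleftrightarrow>
    (\<exists>k::nat. \<forall>w p q. gc (c g h * (-1) powi int k) (form g h + of_int (int k)) a b w p q = 0)"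
proof -
  have 1: "ser_mult sc (bin_pow z1 (-1) z2 \<alpha>) (comp12 a b w) (e0, p, q) =
      (if e0 = 0 then bm (-1) \<alpha> (\<lambda>p q. a p (b q w)) p q else 0)" for \<alpha> w e0 p q
    unfolding bin_pow_mult[OF variable_system_120 vs] binom_mult_def
    by (simp add: comp12_def z1_def z2_def algebra_simps)
  have 2: "ser_mult sc (bin_pow z2 (-1) z1 \<alpha>) (comp21 b a w) (e0, p, q) =
      (if e0 = 0 then bm (-1) \<alpha> (\<lambda>q p. b q (a p w)) q p else 0)" for \<alpha> w e0 p q
    unfolding bin_pow_mult[OF variable_system_210 vs] binom_mult_def
    by (simp add: comp21_def z1_def z2_def algebra_simps)
  show ?thesis unfolding weakly_commutative_def gap_coeff_def fun_eq_iff split_paired_All 1 2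
    by (auto simp: add.commute mult.commute)
qed

end

section \<open>Graded fields, their products and the Jacobi identity\<close>

lemma cong2_Ints: "cong2 x y \<Longrightarrow> x - y \<in> \<int>"
  unfolding cong2_def by auto

lemma cong2_refl: "cong2 x x"
  unfolding cong2_def by (rule exI[of _ 0]) simp

lemma cong2_add: assumes "cong2 x y" "cong2 x' y'" shows "cong2 (x + x') (y + y')"
proof -
  from assms obtain m m' :: int where "x - y = 2 * of_int m" "x' - y' = 2 * of_int m'"
    unfolding cong2_def by blast
  then have "x + x' - (y + y') = 2 * of_int (m + m')" by (simp add: algebra_simps)
  then show ?thesis unfolding cong2_def by blast
qed

lemma cong2_trans: assumes "cong2 x y" "cong2 y z" shows "cong2 x z"
proof -
  from assms obtain m m' :: int where "x - y = 2 * of_int m" "y - z = 2 * of_int m'"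
    unfolding cong2_def by blast
  then have "x - z = 2 * of_int (m + m')" by (simp add: algebra_simps)
  then show ?thesis unfolding cong2_def by blast
qed

lemma cong2_add_self: assumes "cong2 x (x + x)" shows "cong2 x 0"
proof -
  from assms obtain m :: int where "x - (x + x) = 2 * of_int m" unfolding cong2_def by blast
  then have "x - 0 = 2 * of_int (- m)" by (simp add: minus_equation_iff[of x])
  then show ?thesis unfolding cong2_def by blast
qed

context group_data
begin

lemma form_0_right: "cong2 (form g 0) 0"
  using form_add_right[of g 0 0] by (intro cong2_add_self) simp

lemma form_0_left: "cong2 (form 0 g) 0"
  using form_add_left[of 0 0 g] by (intro cong2_add_self) simp

lemma c_0_left: "c 0 g = 1" and c_0_right: "c g 0 = 1"
  using c_add_left[of 0 0 g] c_add_right[of g 0 0] c_nonzero[of 0 g] c_nonzero[of g 0] by simp_all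

lemma c_swap: "c g h * c h g = 1"
proof -
  have "c g g * c g h * (c h g * c h h) = 1 \<or> c g g * c h g * (c g h * c h h) = 1"
    using c_alternating[of "g + h"] unfolding c_add_left c_add_right by blast
  then show ?thesis by (auto simp: c_alternating mult.commute)
qed

end

context gset_data
begin

lemma formS_add_left: "cong2 (formS (g + h) s) (formS g s + formS h s)"
proof -
  have "cong2 (formS (g + h) s) (form g 0 + form h 0 + formS g s + formS h s)"
    using formS_add[of g h 0 s] by (simp add: act_zero)
  moreover have "cong2 (form g 0 + form h 0 + (formS g s + formS h s)) (0 + 0 + (formS g s + formS h s))"
    by (intro cong2_add form_0_right cong2_refl)
  ultimately show ?thesis by (auto simp: add_ac intro: cong2_trans)
qed

lemma formS_0: "cong2 (formS 0 s) 0"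
  using formS_add_left[of 0 0 s] by (intro cong2_add_self) simp

lemma formS_act: "cong2 (formS g (act h s)) (form g h + formS g s)"
proof -
  have "cong2 (formS g (act h s)) (form g h + form 0 h + formS g s + formS 0 s)"
    using formS_add[of g 0 h s] by simp
  moreover have "cong2 (form g h + form 0 h + formS g s + formS 0 s) (form g h + 0 + formS g s + 0)"
    by (intro cong2_add form_0_left formS_0 cong2_refl)
  ultimately show ?thesis by (auto intro: cong2_trans)
qed

end

text \<open>For \<open>M > 0\<close> the recurrence computes \<open>u\<close> upwards from the base
  line. For \<open>M < 0\<close>, once the line \<open>M + 1\<close> is known to vanish, it reads
  \<open>u N M q = - u (N + 1) M (q + 1)\<close>, and iterating this reaches
  \<open>N \<ge> K\<close>.\<close>

lemma recurrence_zero: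
  fixes u :: "int \<Rightarrow> int \<Rightarrow> complex \<Rightarrow> 'w::ab_group_add"
  assumes rec: "\<And>N M q. u N (M + 1) q = u N M (q - 1) + u (N + 1) M q"
    and top: "\<And>N M q. N \<ge> K \<Longrightarrow> u N M q = 0"
    and base: "\<And>N q. u N 0 q = 0"
  shows "u N M q = 0"
proof (induction M arbitrary: N q rule: int_induct[where k = 0])
  case base
  then show ?case by (rule assms(3))
next
  case (step1 M)
  then show ?case by (simp add: rec)
next
  case (step2 M)
  have step: "u N (M - 1) q = - u (N + 1) (M - 1) (q + 1)" for N q
    using rec[of N "M - 1" "q + 1"] step2.IH by (simp add: eq_neg_iff_add_eq_0)
  have "u (K - int d) (M - 1) q = 0" for d q
  proof (induction d arbitrary: q)
    case (Suc d)
    have "K - int (Suc d) + 1 = K - int d" by simp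
    then show ?case using Suc by (subst step) (simp only: minus_zero)
  qed (simp add: top)
  from this[of "nat (K - N)"] show ?case
    by (cases "N \<ge> K") (auto simp: top)
qed

section \<open>Graded fields and the support of their gap coefficients\<close>

context complex_vector_space
begin

lemma subspace_Sum_any:
  assumes "subspace S" "\<And>x. f x \<in> S"
  shows "Sum_any f \<in> S"
  unfolding Sum_any.expand_set by (rule subspace_sum[OF assms(1)]) (rule assms(2))

lemma binom_mult_linear:
  assumes "diag_truncated f" "diag_truncated g"
  shows "bm \<epsilon> \<alpha> (\<lambda>p q. sc k (f p q) + g p q) p q = sc k (bm \<epsilon> \<alpha> f p q) + bm \<epsilon> \<alpha> g p q"
proof -
  obtain B where B: "\<And>i. i \<ge> B \<Longrightarrow> f (p - \<alpha> + of_nat i) (q - of_nat i) = 0"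
    using diag_truncatedE[OF assms(1)] by metis
  obtain B' where B': "\<And>i. i \<ge> B' \<Longrightarrow> g (p - \<alpha> + of_nat i) (q - of_nat i) = 0"
    using diag_truncatedE[OF assms(2)] by metis
  let ?B = "max B B'"
  have "bm \<epsilon> \<alpha> f p q = (\<Sum>i<?B. sc ((\<alpha> gchoose i) * \<epsilon> ^ i) (f (p - \<alpha> + of_nat i) (q - of_nat i)))"
    unfolding binom_mult_def by (rule Sum_any_bounded) (simp add: B)
  moreover have "bm \<epsilon> \<alpha> g p q = (\<Sum>i<?B. sc ((\<alpha> gchoose i) * \<epsilon> ^ i) (g (p - \<alpha> + of_nat i) (q - of_nat i)))"
    unfolding binom_mult_def by (rule Sum_any_bounded) (simp add: B')
  moreover have "bm \<epsilon> \<alpha> (\<lambda>p q. sc k (f p q) + g p q) p q = (\<Sum>i<?B. sc ((\<alpha> gchoose i) * \<epsilon> ^ i)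
      (sc k (f (p - \<alpha> + of_nat i) (q - of_nat i)) + g (p - \<alpha> + of_nat i) (q - of_nat i)))"
    unfolding binom_mult_def by (rule Sum_any_bounded) (simp add: B B')
  ultimately show ?thesis
    by (simp add: scale_right_distrib sum.distrib scale_sum_right mult.commute)
qed

end

text \<open>Truncation is a bound on real parts, asked for homogeneous vectors only. Since the
  exponents on such a vector lie in one coset of the integers, this amounts to the finite set of
  leading exponents in \<open>lower_truncated\<close> when \<open>C\<close> is the whole space
  (\<open>field_comp_iff\<close>).\<close>

definition graded_field :: "('g \<Rightarrow> 's \<Rightarrow> 's) \<Rightarrow> ('g \<Rightarrow> 's \<Rightarrow> complex) \<Rightarrow>
    (complex \<Rightarrow> 'w \<Rightarrow> 'w) \<Rightarrow> 'w set \<Rightarrow> ('s \<Rightarrow> 'w set) \<Rightarrow> 'g \<Rightarrow> (complex \<Rightarrow> 'w \<Rightarrow> 'w::ab_group_add) \<Rightarrow> bool"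
  where "graded_field act formS sc C W g a \<longleftrightarrow>
    (\<forall>p. linear_map_on sc C sc (a p)) \<and>
    (\<forall>s. \<forall>w\<in>W s. \<forall>p. a p w \<in> W (act g s) \<and> (a p w \<noteq> 0 \<longrightarrow> formS g s + p \<in> \<int>)) \<and>
    (\<forall>s. \<forall>w\<in>W s. \<exists>R. \<forall>p. Re p < R \<longrightarrow> a p w = 0)"

text \<open>The fields act on a subspace \<open>C\<close> only, so that the results apply both to \<open>W\<close> and to the vertex operators
  \<open>Y(a, z)\<close> acting on the space of generated fields.\<close>

locale field_setting = gset_data form c act formS + graded_subspace sc C W
  for form :: "'g::ab_group_add \<Rightarrow> 'g \<Rightarrow> complex" and c
    and act :: "'g \<Rightarrow> 's \<Rightarrow> 's" and formS
    and sc :: "complex \<Rightarrow> 'w::ab_group_add \<Rightarrow> 'w" and C and W :: "'s \<Rightarrow> 'w set"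
begin

sublocale complex_vector_space sc ..

abbreviation gf where "gf \<equiv> graded_field act formS sc C W"

lemma W_C: "w \<in> W s \<Longrightarrow> w \<in> C"
  using component_subset by blast

lemma zero_W: "0 \<in> W s"
  using subspace_0[OF component_subspace] .

lemma zero_C: "0 \<in> C"
  using subspace_0[OF carrier_subspace] .

lemma gf_add: "gf g a \<Longrightarrow> x \<in> C \<Longrightarrow> y \<in> C \<Longrightarrow> a p (x + y) = a p x + a p y"
  and gf_scale: "gf g a \<Longrightarrow> x \<in> C \<Longrightarrow> a p (sc k x) = sc k (a p x)"
  unfolding graded_field_def linear_map_on_def by auto

lemma gf_0: "gf g a \<Longrightarrow> a p 0 = 0"
  using gf_add[of g a 0 0 p] zero_C by simp

lemma gf_W: "gf g a \<Longrightarrow> w \<in> W s \<Longrightarrow> a p w \<in> W (act g s)"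
  and gf_Ints: "gf g a \<Longrightarrow> w \<in> W s \<Longrightarrow> a p w \<noteq> 0 \<Longrightarrow> formS g s + p \<in> \<int>"
  unfolding graded_field_def by blast+

lemma gf_sum:
  assumes "gf g a" "\<And>i. i \<in> I \<Longrightarrow> v i \<in> C"
  shows "a p (\<Sum>i\<in>I. sc (k i) (v i)) = (\<Sum>i\<in>I. sc (k i) (a p (v i)))"
proof (cases "finite I")
  case True
  then show ?thesis using assms(2)
  proof induction
    case (insert i I)
    have "(\<Sum>i\<in>I. sc (k i) (v i)) \<in> C"
      using insert by (intro subspace_sum[OF carrier_subspace] subspace_scale[OF carrier_subspace]) auto
    then show ?case
      using insert assms(1) by (simp add: gf_add gf_scale subspace_scale[OF carrier_subspace])
  qed (simp add: gf_0[OF assms(1)])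
qed (simp add: gf_0[OF assms(1)])

lemma gf_lower:
  assumes "gf g a" "w \<in> W s"
  obtains R where "\<And>p. Re p < R \<Longrightarrow> a p w = 0"
  using assms unfolding graded_field_def by blast

text \<open>Only finitely many of the vectors are nonzero, so their truncation bounds have a
  minimum. Uniform bounds of this kind make the nested sums of Dong's lemma finite.\<close>

lemma gf_lower_family:
  assumes "gf g a" and "\<And>i. \<exists>s. v i \<in> W s" and "\<And>i::nat. i \<ge> B \<Longrightarrow> v i = 0"
  obtains R where "\<And>p i. Re p < R \<Longrightarrow> a p (v i) = 0"
proof -
  have "\<exists>R. \<forall>p. Re p < R \<longrightarrow> a p (v i) = 0" for i
    using assms(2)[of i] gf_lower[OF assms(1)] by metis
  then obtain R where R: "\<And>i p. Re p < R i \<Longrightarrow> a p (v i) = 0" by metis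
  \<comment> \<open>The inserted 0 keeps the set nonempty when \<open>B = 0\<close>.\<close>
  define R' where "R' = Min (insert 0 (R ` {..<B}))"
  have "a p (v i) = 0" if "Re p < R'" for p i
  proof (cases "i < B")
    case True
    then have "R' \<le> R i" unfolding R'_def by (intro Min_le) auto
    then show ?thesis using R that by simp
  next
    case False
    then show ?thesis using assms(3) gf_0[OF assms(1)] by simp
  qed
  then show ?thesis using that by blast
qed

lemma nat_bound:
  obtains B :: nat where "\<And>l. l \<ge> B \<Longrightarrow> x - real l < R"
proof
  fix l assume "nat \<lceil>x - R\<rceil> + 1 \<le> l"
  then show "x - real l < R" by linarith
qed

lemma gf_bound_family:
  assumes "gf g a" and "\<And>i. \<exists>s. v i \<in> W s" and "\<And>i::nat. i \<ge> B \<Longrightarrow> v i = 0"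
  obtains L :: nat where "\<And>l i. l \<ge> L \<Longrightarrow> a (x + of_nat i - of_nat l) (v i) = 0"
proof -
  obtain R where R: "\<And>p i. Re p < R \<Longrightarrow> a p (v i) = 0"
    using gf_lower_family[of g a v B, OF assms] by blast
  obtain L where L: "\<And>l. l \<ge> L \<Longrightarrow> Re x - real l < R - real B"
    using nat_bound[of "Re x" "R - real B"] by blast
  have "a (x + of_nat i - of_nat l) (v i) = 0" if "l \<ge> L" for l i
  proof (cases "i < B")
    case True
    then show ?thesis using L[OF that] by (intro R) (auto simp: field_simps)
  next
    case False
    then show ?thesis using assms(3) gf_0[OF assms(1)] by simp
  qed
  then show ?thesis using that by blast
qed

lemma gf_bound:
  assumes "gf g a" "w \<in> W s"
  obtains L :: nat where "\<And>l. l \<ge> L \<Longrightarrow> a (x - of_nat l) w = 0"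
proof -
  obtain R where R: "\<And>p. Re p < R \<Longrightarrow> a p w = 0" using gf_lower[OF assms] by blast
  obtain L where L: "\<And>l. l \<ge> L \<Longrightarrow> Re x - real l < R" using nat_bound[of "Re x" R] by blast
  show ?thesis by (rule that[of L]) (use L in \<open>auto intro!: R\<close>)
qed

lemma diag_truncated_comp:
  assumes "gf g a" "gf h b" "w \<in> W s"
  shows "diag_truncated (\<lambda>p q. a p (b q w))"
  unfolding diag_truncated_def
proof (intro allI)
  fix p q
  obtain L where "\<And>l. l \<ge> L \<Longrightarrow> b (q - of_nat l) w = 0" using gf_bound[OF assms(2,3)] by blast
  then show "\<exists>B::nat. \<forall>i\<ge>B. a (p + of_nat i) (b (q - of_nat i) w) = 0"
    using gf_0[OF assms(1)] by metis
qed

text \<open>Multiply by \<open>z\<^sub>1 - z\<^sub>2\<close>. In the second expansion this is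
  \<open>- (z\<^sub>2 - z\<^sub>1)\<close>, so raising the exponent by one costs a sign there; this
  is why a sign \<open>(-1) powi N\<close> accompanies every exponent.\<close>

lemma gap_coeff_Suc:
  assumes "gf g a" "gf h b" "w \<in> W s"
  shows "gc (- \<kappa>) (n + 1) a b w p q = gc \<kappa> n a b w (p - 1) q - gc \<kappa> n a b w p (q - 1)"
  unfolding gap_coeff_def
  by (simp add: binom_mult_Suc[OF diag_truncated_comp[OF assms]]
      binom_mult_Suc[OF diag_truncated_comp[OF assms(2,1,3)]] scale_right_distrib scale_right_diff_distrib)

lemma gap_coeff_eq_0_up:
  assumes "gf g a" "gf h b" "w \<in> W s" and 0: "\<And>p q. gc \<kappa> n a b w p q = 0"
  shows "gc (\<kappa> * (-1) ^ d) (n + of_nat d) a b w p q = 0"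
proof (induction d arbitrary: p q)
  case (Suc d)
  show ?case
    using gap_coeff_Suc[OF assms(1-3), of "\<kappa> * (-1) ^ d" "n + of_nat d" p q] Suc
    by (simp add: add_ac)
qed (simp add: 0)

lemma gap_coeff_linear:
  assumes "gf g a" "gf h b" "w \<in> W s" "w' \<in> W s"
  shows "gc \<kappa> n a b (sc k w + w') p q = sc k (gc \<kappa> n a b w p q) + gc \<kappa> n a b w' p q"
proof -
  have lin: "a p (b q (sc k w + w')) = sc k (a p (b q w)) + a p (b q w')"
    if "gf g a" "gf h b" for a b p q g h
  proof -
    have "w \<in> C" "w' \<in> C" "b q w \<in> C" "b q w' \<in> C"
      using assms(3,4) W_C gf_W[OF that(2)] by blast+
    then show ?thesis
      by (simp add: gf_add[OF that(1)] gf_add[OF that(2)] gf_scale[OF that(1)] gf_scale[OF that(2)]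
        subspace_scale[OF carrier_subspace])
  qed
  show ?thesis
    unfolding gap_coeff_def lin[OF assms(1,2)] lin[OF assms(2,1)]
    by (subst (1 2) binom_mult_linear)
      (auto intro: diag_truncated_comp assms simp: algebra_simps scale_right_distrib scale_left_commute)
qed

lemma W_binom_mult:
  assumes "\<And>p q. f p q \<in> W s"
  shows "bm \<epsilon> \<alpha> f p q \<in> W s"
  unfolding binom_mult_def
  by (intro subspace_Sum_any[OF component_subspace] subspace_scale[OF component_subspace] assms)

lemma gap_coeff_W:
  assumes "gf g a" "gf h b" "w \<in> W s"
  shows "gc \<kappa> n a b w p q \<in> W (act (g + h) s)"
proof -
  have "a p (b q w) \<in> W (act (g + h) s)" "b q (a p w) \<in> W (act (g + h) s)" for p q
    using gf_W[OF assms(1) gf_W[OF assms(2,3)]] gf_W[OF assms(2) gf_W[OF assms(1,3)]]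
    by (simp_all add: act_add[symmetric] add.commute)
  then show ?thesis unfolding gap_coeff_def
    by (intro subspace_diff[OF component_subspace] subspace_scale[OF component_subspace] W_binom_mult)
qed

text \<open>In the first term \<open>a\<close> acts on the component \<open>act h s\<close>, where
  its exponents are moved by \<open>form g h\<close>, and the binomial factor moves them back by
  \<open>n\<close>. In the second term \<open>a\<close> acts on \<open>w\<close> directly. The two
  supports agree because \<open>n\<close> is congruent to \<open>form g h\<close>.\<close>

lemma gap_coeff_eq_0_left:
  assumes "gf g a" "gf h b" "w \<in> W s" and n: "n - form g h \<in> \<int>" and p: "formS g s + p \<notin> \<int>"
  shows "gc \<kappa> n a b w p q = 0"
proof -
  have 1: "a (p - n + of_nat i) (b (q - of_nat i) w) = 0" for i
  proof (rule ccontr)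
    assume "\<not> ?thesis"
    then have "formS g (act h s) + (p - n + of_nat i) \<in> \<int>"
      using gf_Ints[OF assms(1) gf_W[OF assms(2,3)]] by blast
    then have "formS g (act h s) + (p - n + of_nat i) - (formS g (act h s) - (form g h + formS g s))
        + (n - form g h) - of_nat i \<in> \<int>"
      by (rule Ints_diff[OF Ints_add[OF Ints_diff[OF _ cong2_Ints[OF formS_act]] n] Ints_of_nat])
    then show False using p by (simp add: algebra_simps)
  qed
  have 2: "a (p - of_nat i) w = 0" for i
  proof (rule ccontr)
    assume "\<not> ?thesis"
    then have "formS g s + (p - of_nat i) + of_nat i \<in> \<int>"
      using gf_Ints[OF assms(1,3)] Ints_add Ints_of_nat by blast
    then show False using p by simp
  qed
  show ?thesis unfolding gap_coeff_def binom_mult_def 1 2 gf_0[OF assms(2)] by simp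
qed

lemma gap_coeff_eq_0_right:
  assumes "gf g a" "gf h b" "w \<in> W s" and n: "n - form g h \<in> \<int>" and q: "formS h s + q \<notin> \<int>"
  shows "gc \<kappa> n a b w p q = 0"
proof -
  have 1: "b (q - n + of_nat i) (a (p - of_nat i) w) = 0" for i
  proof (rule ccontr)
    assume "\<not> ?thesis"
    then have "formS h (act g s) + (q - n + of_nat i) \<in> \<int>"
      using gf_Ints[OF assms(2) gf_W[OF assms(1,3)]] by blast
    then have "formS h (act g s) + (q - n + of_nat i) - (formS h (act g s) - (form h g + formS h s))
        + (n - form g h) - (form h g - form g h) - of_nat i \<in> \<int>"
      by (rule Ints_diff[OF Ints_diff[OF Ints_add[OF Ints_diff[OF _ cong2_Ints[OF formS_act]] n]
            cong2_Ints[OF form_sym]] Ints_of_nat])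
    then show False using q by (simp add: algebra_simps)
  qed
  have 2: "b (q - of_nat i) w = 0" for i
  proof (rule ccontr)
    assume "\<not> ?thesis"
    then have "formS h s + (q - of_nat i) + of_nat i \<in> \<int>"
      using gf_Ints[OF assms(2,3)] Ints_add Ints_of_nat by blast
    then show False using q by simp
  qed
  show ?thesis unfolding gap_coeff_def binom_mult_def 1 2 gf_0[OF assms(1)] by simp
qed

text \<open>For fixed \<open>p\<close> the second term involves only finitely many nonzero vectors
  \<open>a (p - of_nat i) w\<close>, so one truncation bound for \<open>b\<close> serves them
  all.\<close>

lemma gap_coeff_lower:
  assumes "gf g a" "gf h b" "w \<in> W s"
  obtains R where "\<And>q. Re q < R \<Longrightarrow> gc \<kappa> n a b w p q = 0"
proof -
  obtain R1 where R1: "\<And>q. Re q < R1 \<Longrightarrow> b q w = 0" using gf_lower[OF assms(2,3)] by blast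
  obtain L where L: "\<And>l. l \<ge> L \<Longrightarrow> a (p - of_nat l) w = 0" using gf_bound[OF assms(1,3)] by blast
  have "\<exists>s. a (p - of_nat i) w \<in> W s" for i :: nat using gf_W[OF assms(1,3)] by blast
  from gf_lower_family[OF assms(2), of "\<lambda>i. a (p - of_nat i) w" L, OF this L]
  obtain R2 where R2: "\<And>q i. Re q < R2 \<Longrightarrow> b q (a (p - of_nat i) w) = 0" by blast
  let ?R = "min R1 (R2 + Re n - real L)"
  have "gc \<kappa> n a b w p q = 0" if q: "Re q < ?R" for q
  proof -
    have 1: "b (q - of_nat i) w = 0" for i by (rule R1) (use q in auto)
    have 2: "b (q - n + of_nat i) (a (p - of_nat i) w) = 0" for i
    proof (cases "i < L")
      case True then show ?thesis by (intro R2) (use q in auto)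
    next
      case False then show ?thesis using L gf_0[OF assms(2)] by simp
    qed
    show ?thesis unfolding gap_coeff_def binom_mult_def 1 2 gf_0[OF assms(1)] by simp
  qed
  then show ?thesis using that by blast
qed

text \<open>This is the coefficient of \<open>z0\<close> to the power
  \<open>- 1 - form g h - of_int N\<close> in the left-hand side of the Jacobi identity. With
  \<open>form\<close> zero, \<open>c\<close> one and \<open>N = 0\<close> it is the ordinary
  commutator.\<close>

definition commutator where
  "commutator g a h b N = gc (c g h * (-1) powi N) (form g h + of_int N) a b"

text \<open>The bound is an integer and may be negative, because moving between representatives of
  \<open>form\<close> shifts it by an even number. \<open>wcf_weakly_commutative\<close> returns to
  natural exponents.\<close>

definition wc_bound where
  "wc_bound g a h b K \<longleftrightarrow> (\<forall>N\<ge>K. \<forall>s. \<forall>w\<in>W s. \<forall>p q. commutator g a h b N w p q = 0)"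

definition weakly_commute where
  "weakly_commute g a h b \<longleftrightarrow> (\<exists>K. wc_bound g a h b K)"

lemma wc_zero: "wc_bound g a h b K \<Longrightarrow> N \<ge> K \<Longrightarrow> w \<in> W s \<Longrightarrow> commutator g a h b N w p q = 0"
  unfolding wc_bound_def by blast

lemma wc_boundI:
  assumes "gf g a" "gf h b" and 0: "\<And>s w p q. w \<in> W s \<Longrightarrow> commutator g a h b K w p q = 0"
  shows "wc_bound g a h b K"
  unfolding wc_bound_def
proof (intro allI impI ballI)
  fix N s w p q assume N: "K \<le> N" and w: "w \<in> W s"
  have K: "of_int N = of_int K + (of_nat (nat (N - K)) :: complex)" using N by simp
  have K': "(-1 :: complex) powi N = (-1) powi K * (-1) ^ nat (N - K)"
    using N by (simp add: power_int_add[symmetric] flip: power_int_of_nat)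
  show "commutator g a h b N w p q = 0"
    using gap_coeff_eq_0_up[OF assms(1,2) w, of "c g h * (-1) powi K" "form g h + of_int K" "nat (N - K)"] 0[OF w]
    unfolding commutator_def K K' by (simp add: add.assoc mult.assoc)
qed

lemma wcfI:
  assumes "gf g a" "gf h b" "\<And>s w p q. w \<in> W s \<Longrightarrow> commutator g a h b K w p q = 0"
  shows "weakly_commute g a h b"
  unfolding weakly_commute_def by (rule exI, rule wc_boundI[OF assms(1,2)], rule assms(3))

lemma weakly_commutative_wcf:
  assumes "gf g a" "gf h b" "weakly_commutative form c sc g a h b"
  shows "weakly_commute g a h b"
proof -
  obtain k :: nat where "\<And>w p q. gc (c g h * (-1) powi int k) (form g h + of_int (int k)) a b w p q = 0"
    using assms(3) unfolding weakly_commutative_iff by blast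
  then show ?thesis using wcfI[OF assms(1,2), of "int k"] unfolding commutator_def by blast
qed

lemma X_Suc:
  assumes "gf g a" "gf h b" "w \<in> W s"
  shows "commutator g a h b (N + 1) w p q = commutator g a h b N w (p - 1) q - commutator g a h b N w p (q - 1)"
  unfolding commutator_def using gap_coeff_Suc[OF assms, of "c g h * (-1) powi N" "form g h + of_int N" p q]
  by (simp add: power_int_add add_ac)

section \<open>Homogeneous components and products of fields\<close>

lemma component_eq:
  assumes "x \<in> C" shows "decomposes W (\<lambda>s. component W s x) x"
proof -
  have "(\<lambda>s. component W s x) = (THE f. decomposes W f x)" unfolding component_def ..
  then show ?thesis using theI'[OF direct_sum[OF assms]] by simp
qed

lemma component_unique:
  assumes "x \<in> C" "decomposes W f x" shows "component W s x = f s"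
  using direct_sum[OF assms(1)] component_eq[OF assms(1)] assms(2) by metis

lemma component_homog: assumes "w \<in> W s" shows "component W t w = (if t = s then w else 0)"
proof (rule component_unique[OF W_C[OF assms]])
  have "Sum_any (\<lambda>t. if t = s then w else 0) = w" by (subst Sum_any_single[of s]) auto
  then show "decomposes W (\<lambda>t. if t = s then w else 0) w"
    using assms zero_W unfolding decomposes_def by auto
qed

lemma component_W: "x \<in> C \<Longrightarrow> component W s x \<in> W s"
  and finite_component: "x \<in> C \<Longrightarrow> finite {s. component W s x \<noteq> 0}"
  and Sum_any_component: "x \<in> C \<Longrightarrow> Sum_any (\<lambda>s. component W s x) = x"
  using component_eq unfolding decomposes_def by auto

lemma component_add:
  assumes "x \<in> C" "y \<in> C" shows "component W s (x + y) = component W s x + component W s y"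
proof (rule component_unique)
  have "finite {s. component W s x + component W s y \<noteq> 0}"
    by (rule finite_subset[OF _ finite_UnI[OF finite_component[OF assms(1)] finite_component[OF assms(2)]]]) auto
  then show "decomposes W (\<lambda>s. component W s x + component W s y) (x + y)"
    unfolding decomposes_def using assms component_W subspace_add[OF component_subspace]
    by (auto simp: Sum_any.distrib finite_component Sum_any_component)
qed (use assms subspace_add[OF carrier_subspace] in auto)

lemma component_scale:
  assumes "x \<in> C" shows "component W s (sc k x) = sc k (component W s x)"
proof (rule component_unique)
  have "finite {s. sc k (component W s x) \<noteq> 0}"
    by (rule finite_subset[OF _ finite_component[OF assms]]) auto
  then show "decomposes W (\<lambda>s. sc k (component W s x)) (sc k x)"
    unfolding decomposes_def using assms component_W subspace_scale[OF component_subspace]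
    by (auto simp: scale_Sum_any[symmetric] Sum_any_component)
qed (use assms subspace_scale[OF carrier_subspace] in auto)

abbreviation fprod where "fprod \<equiv> field_prod form c formS sc W"

text \<open>Products vanish unless \<open>n\<close> is congruent to \<open>form g h\<close> modulo
  integers (\<open>fprod_nonint\<close>); an integer index covers the remaining ones.\<close>

abbreviation iprod where "iprod g a h b N \<equiv> fprod g a (form g h + of_int N) h b"

lemma field_prod_on_0:
  assumes "gf g a" "gf h b"
  shows "field_prod_on sc \<gamma> \<kappa> \<sigma> a n b p 0 = 0"
proof -
  have "comp12 a b 0 = (\<lambda>_. 0)" "comp21 b a 0 = (\<lambda>_. 0)"
    unfolding comp12_def comp21_def using gf_0[OF assms(1)] gf_0[OF assms(2)] by auto
  then show ?thesis unfolding field_prod_on_eq jacobi_lhs_def ser_mult_def by simp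
qed

lemma fprod_homog:
  assumes "gf g a" "gf h b" "w \<in> W s"
  shows "fprod g a n h b p w = field_prod_on sc (form g h) (c g h) (formS g s) a n b p w"
  unfolding field_prod_def
  by (subst Sum_any_single[of s]) (auto simp: component_homog[OF assms(3)] field_prod_on_0[OF assms(1,2)])

lemma field_prod_on_int:
  "field_prod_on sc (form g h) (c g h) \<sigma> a (form g h + of_int N) b p w =
    Sum_any (\<lambda>i::nat. sc (- \<sigma> gchoose i) (commutator g a h b (N + int i) w (- 1 - \<sigma>) (p + \<sigma> + of_nat i)))"
proof -
  have "jacobi_lhs sc (form g h) (c g h) a b w (- 1 - (form g h + of_int N) - of_nat i, x, y) =
      commutator g a h b (N + int i) w x y" for i :: nat and x y
    using jacobi_lhs_coeff[of "form g h" "c g h" a b w "N + int i" x y] by (simp add: commutator_def algebra_simps)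
  then show ?thesis unfolding field_prod_on_eq by simp
qed

lemma field_prod_on_nonint:
  assumes "n - form g h \<notin> \<int>"
  shows "field_prod_on sc (form g h) (c g h) \<sigma> a n b p w = 0"
proof -
  have "jacobi_lhs sc (form g h) (c g h) a b w (- 1 - n - of_nat i, x, y) = 0" for i x y
  proof (rule jacobi_lhs_eq_0)
    show "- 1 - (- 1 - n - of_nat i) - form g h \<notin> \<int>"
    proof
      assume "- 1 - (- 1 - n - of_nat i) - form g h \<in> \<int>"
      then have "- 1 - (- 1 - n - of_nat i) - form g h - of_nat i \<in> \<int>" by (rule Ints_diff[OF _ Ints_of_nat])
      then show False using assms by simp
    qed
  qed
  then show ?thesis unfolding field_prod_on_eq by simp
qed

lemma fprod_nonint: "n - form g h \<notin> \<int> \<Longrightarrow> fprod g a n h b p w = 0"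
  unfolding field_prod_def by (simp add: field_prod_on_nonint)

lemma fprod_int:
  assumes "gf g a" "gf h b" "w \<in> W s"
  shows "fprod g a (form g h + of_int N) h b p w = Sum_any (\<lambda>i::nat. sc (- formS g s gchoose i)
    (commutator g a h b (N + int i) w (- 1 - formS g s) (p + formS g s + of_nat i)))"
  unfolding fprod_homog[OF assms] field_prod_on_int ..

lemma fprod_cases:
  assumes "\<And>N. n = form g h + of_int N \<Longrightarrow> P (form g h + of_int N)" and "n - form g h \<notin> \<int> \<Longrightarrow> P n"
  shows "P n"
proof (cases "n - form g h \<in> \<int>")
  case True
  then obtain N where "n - form g h = of_int N" by (auto elim: Ints_cases)
  then have "n = form g h + of_int N" by (metis add.commute diff_add_cancel)
  then show ?thesis using assms(1) by simp
qed (rule assms(2))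

context
  fixes g h a b K
  assumes a: "gf g a" and b: "gf h b"
    and K: "wc_bound g a h b K"
begin

lemma fprod_sum:
  assumes "w \<in> W s" "K \<le> N + int B"
  shows "iprod g a h b N p w = (\<Sum>i<B. sc (- formS g s gchoose i)
    (commutator g a h b (N + int i) w (- 1 - formS g s) (p + formS g s + of_nat i)))"
  unfolding fprod_int[OF a b assms(1)]
  by (rule Sum_any_bounded) (use wc_zero[OF K _ assms(1)] assms(2) in auto)

lemma fprod_top: "N \<ge> K \<Longrightarrow> w \<in> W s \<Longrightarrow> iprod g a h b N p w = 0"
  by (subst fprod_sum[where B = 0]) auto

lemma fprod_W:
  assumes "w \<in> W s" shows "fprod g a n h b p w \<in> W (act (g + h) s)"
proof (rule fprod_cases[of n g h])
  fix N show "iprod g a h b N p w \<in> W (act (g + h) s)"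
    unfolding fprod_int[OF a b assms(1)] commutator_def
    by (intro subspace_Sum_any[OF component_subspace] subspace_scale[OF component_subspace]
        gap_coeff_W[OF a b assms])
qed (simp add: fprod_nonint zero_W)

lemma fprod_Ints:
  assumes "w \<in> W s" "fprod g a n h b p w \<noteq> 0" shows "formS (g + h) s + p \<in> \<int>"
proof -
  have "n - form g h \<in> \<int>" using assms(2) fprod_nonint by blast
  then obtain N where "n - form g h = of_int N" by (auto elim: Ints_cases)
  then have n: "n = form g h + of_int N" by (metis add.commute diff_add_cancel)
  have "\<exists>i. commutator g a h b (N + int i) w (- 1 - formS g s) (p + formS g s + of_nat i) \<noteq> 0"
  proof (rule ccontr)
    assume "\<not> ?thesis"
    then show False using assms unfolding n fprod_int[OF a b assms(1)] by simp
  qed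
  then obtain i :: nat where i: "commutator g a h b (N + int i) w (- 1 - formS g s) (p + formS g s + of_nat i) \<noteq> 0" by blast
  have "formS h s + (p + formS g s + of_nat i) \<in> \<int>"
    by (rule ccontr) (use i gap_coeff_eq_0_right[OF a b assms(1), of "form g h + of_int (N + int i)"] in \<open>simp add: commutator_def\<close>)
  then have "(formS h s + (p + formS g s + of_nat i)) + (formS (g + h) s - (formS g s + formS h s)) - of_nat i \<in> \<int>"
    by (rule Ints_diff[OF Ints_add[OF _ cong2_Ints[OF formS_add_left]] Ints_of_nat])
  then show ?thesis by (simp add: algebra_simps)
qed

lemma fprod_lower:
  assumes "w \<in> W s" obtains R where "\<And>p. Re p < R \<Longrightarrow> fprod g a n h b p w = 0"
proof (rule fprod_cases[of n g h])
  fix N assume n: "n = form g h + of_int N"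
  have "\<exists>R. \<forall>q. Re q < R \<longrightarrow> commutator g a h b (N + int i) w (- 1 - formS g s) q = 0" for i
    unfolding commutator_def using gap_coeff_lower[OF a b assms] by metis
  then obtain R where R: "\<And>i q. Re q < R i \<Longrightarrow> commutator g a h b (N + int i) w (- 1 - formS g s) q = 0" by metis
  let ?B = "nat (K - N)"
  let ?R = "Min (insert 0 ((\<lambda>i. R i - Re (formS g s) - real i) ` {..<?B}))"
  show thesis
  proof (rule that[of ?R])
    fix p assume p: "Re p < ?R"
    have "commutator g a h b (N + int i) w (- 1 - formS g s) (p + formS g s + of_nat i) = 0" if "i < ?B" for i
    proof (rule R)
      have "?R \<le> R i - Re (formS g s) - real i" by (rule Min_le) (use that in auto)
      then have "Re p < R i - Re (formS g s) - real i" using p by (rule less_le_trans[rotated])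
      then show "Re (p + formS g s + of_nat i) < R i" by simp
    qed
    then show "fprod g a n h b p w = 0"
      unfolding n by (subst fprod_sum[where B = ?B, OF assms]) auto
  qed
qed (use that[of 0] fprod_nonint in blast)

lemma field_prod_on_linear:
  assumes "w \<in> W s" "w' \<in> W s"
  shows "fprod g a n h b p (sc k w + w') = sc k (fprod g a n h b p w) + fprod g a n h b p w'"
proof (rule fprod_cases[of n g h])
  fix N
  have s: "sc k w + w' \<in> W s"
    using assms by (intro subspace_add[OF component_subspace] subspace_scale[OF component_subspace])
  have B: "K \<le> N + int (nat (K - N))" by simp
  have "commutator g a h b M (sc k w + w') x y = sc k (commutator g a h b M w x y) + commutator g a h b M w' x y" for M x y
    unfolding commutator_def by (rule gap_coeff_linear[OF a b assms])
  then show "iprod g a h b N p (sc k w + w') = sc k (iprod g a h b N p w) + iprod g a h b N p w'"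
    unfolding fprod_sum[OF assms(1) B] fprod_sum[OF assms(2) B] fprod_sum[OF s B]
    by (simp add: scale_right_distrib sum.distrib scale_sum_right mult.commute)
qed (simp add: fprod_nonint)

lemma fprod_component: 
  assumes "x \<in> C" shows "fprod g a n h b p x = Sum_any (\<lambda>s. fprod g a n h b p (component W s x))"
  by (simp only: fprod_homog[OF a b component_W[OF assms]]) (simp add: field_prod_def)

end

end

section \<open>Products as graded fields, and the Jacobi identity\<close>

context field_setting
begin

lemma C_induct [consumes 1, case_names zero add]:
  assumes "x \<in> C" "P 0" "\<And>s y z. y \<in> W s \<Longrightarrow> z \<in> C \<Longrightarrow> P z \<Longrightarrow> P (y + z)"
  shows "P x"
proof -
  have comp_C: "component W s x \<in> C" for s using component_W[OF assms(1)] W_C by blast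
  have "finite F \<Longrightarrow> (\<Sum>s\<in>F. component W s x) \<in> C \<and> P (\<Sum>s\<in>F. component W s x)" for F
  proof (induction rule: finite_induct)
    case (insert s F)
    then show ?case
      using assms(3)[OF component_W[OF assms(1)]] subspace_add[OF carrier_subspace comp_C] by simp
  qed (simp add: assms(2) zero_C)
  from this[OF finite_component[OF assms(1)]]
  show ?thesis using Sum_any_component[OF assms(1)] unfolding Sum_any.expand_set by simp
qed

lemma finite_Sum_any_component:
  assumes "x \<in> C" "\<And>s. f s 0 = 0"
  shows "finite {s. f s (component W s x) \<noteq> 0}"
  by (rule finite_subset[OF _ finite_component[OF assms(1)]]) (use assms(2) in auto)

lemma fprod_gf:
  assumes a: "gf g a" and b: "gf h b" and ab: "weakly_commute g a h b"
  shows "gf (g + h) (fprod g a n h b)"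
proof -
  obtain K where K: "wc_bound g a h b K"
    using ab unfolding weakly_commute_def by blast
  let ?f = "fprod g a n h b"
  have f0: "?f p 0 = 0" for p
    using field_prod_on_linear[OF a b K zero_W zero_W, where n = n and p = p and k = 1] by simp
  have fin: "finite {s. ?f p (component W s x) \<noteq> 0}" if "x \<in> C" for x p
    by (rule finite_Sum_any_component[OF that, of "\<lambda>_. ?f p"]) (rule f0)
  note comp = fprod_component[OF a b K]
  have "linear_map_on sc C sc (?f p)" for p
    unfolding linear_map_on_def
  proof (intro conjI ballI allI)
    fix x y k assume x: "x \<in> C"
    {
      assume y: "y \<in> C"
      have xy: "x + y \<in> C" using x y subspace_add[OF carrier_subspace] by blast
      have "?f p (component W s (x + y)) = ?f p (component W s x) + ?f p (component W s y)" for s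
        using field_prod_on_linear[OF a b K component_W[OF x] component_W[OF y], where n = n and p = p and k = 1]
        by (simp add: component_add[OF x y])
      then show "?f p (x + y) = ?f p x + ?f p y"
        unfolding comp[OF x] comp[OF y] comp[OF xy] by (simp add: Sum_any.distrib fin x y)
    }
    have kx: "sc k x \<in> C" using x subspace_scale[OF carrier_subspace] by blast
    have "?f p (component W s (sc k x)) = sc k (?f p (component W s x))" for s
      using field_prod_on_linear[OF a b K component_W[OF x] zero_W, where n = n and p = p and k = k]
      by (simp add: component_scale[OF x] f0)
    then show "?f p (sc k x) = sc k (?f p x)"
      unfolding comp[OF x] comp[OF kx] by (simp add: scale_Sum_any)
  qed
  moreover have "\<exists>R. \<forall>p. Re p < R \<longrightarrow> ?f p w = 0" if "w \<in> W s" for s w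
    using fprod_lower[OF a b K that] by metis
  ultimately show ?thesis
    unfolding graded_field_def by (simp add: fprod_W[OF a b K] fprod_Ints[OF a b K])
qed

context
  fixes g h a b K
  assumes a: "gf g a" and b: "gf h b"
    and K: "wc_bound g a h b K"
begin

lemma jacobi_identity_aux:
  assumes w: "w \<in> W s"
  shows "commutator g a h b N w (- 1 - formS g s - of_int M) q =
    Sum_any (\<lambda>j::nat. sc (formS g s + of_int M gchoose j) (iprod g a h b (N + int j) (q - formS g s - of_int M + of_nat j) w))"
proof -
  let ?\<sigma> = "formS g s"
  \<comment> \<open>\<open>M\<close> counts the distance of the \<open>z1\<close>-exponent from the
    line \<open>- 1 - ?\<sigma>\<close> on which the product is defined.\<close>
  define S where "S N M q = Sum_any (\<lambda>j::nat. sc (?\<sigma> + of_int M gchoose j)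
    (iprod g a h b (N + int j) (q - ?\<sigma> - of_int M + of_nat j) w))" for N M q
  have top: "iprod g a h b N p w = 0" if "N \<ge> K" for N p by (rule fprod_top[OF a b K that w])
  define u where "u N M q = commutator g a h b N w (- 1 - ?\<sigma> - of_int M) q - S N M q" for N M q
  have "u N M q = 0"
  proof (rule recurrence_zero[of u K])
    fix N M q
    have "S N (M + 1) q = S N M (q - 1) + S (N + 1) M q"
    proof -
      let ?B = "nat (K - N)"
      \<comment> \<open>\<open>G\<close> puts the three sums on one index; in
        \<open>S (N + 1) M q\<close> it occurs shifted by one, so that Pascal's rule for the upper
        index \<open>?\<sigma> + of_int M\<close> matches them.\<close>
      define G where "G j = iprod g a h b (N + int j) (q - ?\<sigma> - of_int M - 1 + of_nat j) w" for j
      have G0: "G j = 0" if "j \<ge> ?B" for j unfolding G_def by (rule top) (use that in auto)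
      have 1: "S N (M + 1) q = (\<Sum>j<Suc ?B. sc ((?\<sigma> + of_int M) + 1 gchoose j) (G j))"
        unfolding S_def
        by (subst Sum_any_bounded[of "Suc ?B"])
          (use G0 in \<open>auto simp: G_def algebra_simps simp del: sum.lessThan_Suc\<close>)
      have 2: "S N M (q - 1) = (\<Sum>j<Suc ?B. sc (?\<sigma> + of_int M gchoose j) (G j))"
        unfolding S_def
        by (subst Sum_any_bounded[of "Suc ?B"])
          (use G0 in \<open>auto simp: G_def algebra_simps simp del: sum.lessThan_Suc\<close>)
      have G_Suc: "iprod g a h b (N + 1 + int j) (q - ?\<sigma> - of_int M + of_nat j) w = G (Suc j)" for j
        unfolding G_def by (simp add: algebra_simps)
      have 3: "S (N + 1) M q = (\<Sum>j<?B. sc (?\<sigma> + of_int M gchoose j) (G (Suc j)))"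
        unfolding S_def G_Suc by (subst Sum_any_bounded[of ?B]) (use G0 in auto)
      show ?thesis unfolding 1 2 3 sum.lessThan_Suc_shift gbinomial_Suc_Suc
        by (simp add: scale_left_distrib sum.distrib)
    qed
    moreover have "commutator g a h b N w (- 1 - ?\<sigma> - of_int (M + 1)) q =
        commutator g a h b N w (- 1 - ?\<sigma> - of_int M) (q - 1) + commutator g a h b (N + 1) w (- 1 - ?\<sigma> - of_int M) q"
      using X_Suc[OF a b w, of N "- 1 - ?\<sigma> - of_int M" q] by (simp add: algebra_simps)
    ultimately show "u N (M + 1) q = u N M (q - 1) + u (N + 1) M q"
      unfolding u_def by simp
  next
    fix N M q assume "K \<le> N"
    then show "u N M q = 0" unfolding u_def S_def using wc_zero[OF K _ w] top by (simp del: of_int_add)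
  next
    fix N q
    let ?h = "\<lambda>k. commutator g a h b (N + int k) w (- 1 - ?\<sigma>) (q + of_nat k)"
    \<comment> \<open>On this line the products are expanded by definition, and the binomials of
      \<open>?\<sigma>\<close> and \<open>- ?\<sigma>\<close> convolve to
      \<open>0 gchoose k\<close>, which leaves only \<open>k = 0\<close>.\<close>
    have "S N 0 q = Sum_any (\<lambda>j. sc (?\<sigma> gchoose j) (Sum_any (\<lambda>i. sc (- ?\<sigma> gchoose i) (?h (j + i)))))"
      unfolding S_def fprod_int[OF a b w] by (simp add: algebra_simps)
    also have "\<dots> = Sum_any (\<lambda>k. sc (\<Sum>i\<le>k. (?\<sigma> gchoose i) * (- ?\<sigma> gchoose (k - i))) (?h k))"
      by (rule Sum_any_Cauchy[of "nat (K - N)"]) (use wc_zero[OF K _ w] in auto)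
    also have "\<dots> = ?h 0"
      unfolding gbinomial_Vandermonde_atMost by (subst Sum_any_single[of 0]) (auto simp: gbinomial_0_left)
    finally show "u N 0 q = 0" unfolding u_def by simp
  qed
  then show ?thesis unfolding u_def S_def by simp
qed

lemma jacobi_identity:
  assumes w: "w \<in> W s" and p: "formS g s + p \<in> \<int>"
  shows "commutator g a h b N w p q =
    Sum_any (\<lambda>j::nat. sc (- 1 - p gchoose j) (iprod g a h b (N + int j) (q + 1 + p + of_nat j) w))"
proof -
  obtain m where "formS g s + p = of_int m" using p by (auto elim: Ints_cases)
  then have p': "p = of_int m - formS g s" by (simp add: eq_diff_eq add.commute)
  show ?thesis
    using jacobi_identity_aux[OF w, of N "- m - 1" q] unfolding p' by (simp add: algebra_simps)
qed

lemma jacobi_identity_sum: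
  assumes w: "w \<in> W s" and p: "formS g s + p \<in> \<int>" and "K \<le> N + int B"
  shows "commutator g a h b N w p q = (\<Sum>j<B. sc (- 1 - p gchoose j) (iprod g a h b (N + int j) (q + 1 + p + of_nat j) w))"
  unfolding jacobi_identity[OF w p]
  by (rule Sum_any_bounded) (use fprod_top[OF a b K _ w] assms(3) in \<open>simp del: of_int_add\<close>)

end

section \<open>Bilinearity, symmetry and the identity field\<close>

lemma gf_linear:
  assumes "gf g a" "gf g a'"
  shows "gf g (\<lambda>p w. sc k (a p w) + a' p w)"
  unfolding graded_field_def
proof (intro conjI allI ballI impI)
  fix p show "linear_map_on sc C sc (\<lambda>w. sc k (a p w) + a' p w)"
    unfolding linear_map_on_def
    using assms by (auto simp: gf_add gf_scale scale_right_distrib scale_left_commute)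
next
  fix s w p assume w: "w \<in> W s"
  show "sc k (a p w) + a' p w \<in> W (act g s)"
    using gf_W[OF assms(1) w] gf_W[OF assms(2) w] subspace_add[OF component_subspace]
      subspace_scale[OF component_subspace] by blast
  assume "sc k (a p w) + a' p w \<noteq> 0"
  then have "a p w \<noteq> 0 \<or> a' p w \<noteq> 0" by auto
  then show "formS g s + p \<in> \<int>" using gf_Ints assms w by blast
next
  fix s w assume w: "w \<in> W s"
  obtain R where R: "\<And>p. Re p < R \<Longrightarrow> a p w = 0" using gf_lower[OF assms(1) w] by blast
  obtain R' where R': "\<And>p. Re p < R' \<Longrightarrow> a' p w = 0" using gf_lower[OF assms(2) w] by blast
  show "\<exists>R. \<forall>p. Re p < R \<longrightarrow> sc k (a p w) + a' p w = 0"
    by (rule exI[of _ "min R R'"]) (use R R' in auto)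
qed

lemma gf_zero: "gf g (\<lambda>p w. 0)"
  unfolding graded_field_def linear_map_on_def by (auto simp: zero_W)

lemma gap_coeff_linear_left:
  assumes "gf g a" "gf g a'" "gf h b" "w \<in> W s"
  shows "gc \<kappa> n (\<lambda>p w. sc k (a p w) + a' p w) b w p q = sc k (gc \<kappa> n a b w p q) + gc \<kappa> n a' b w p q"
proof -
  have lin: "b q (sc k (a p w) + a' p w) = sc k (b q (a p w)) + b q (a' p w)" for p q
  proof -
    have "a p w \<in> C" "a' p w \<in> C"
      using gf_W[OF assms(1,4)] gf_W[OF assms(2,4)] W_C by blast+
    then show ?thesis
      by (simp add: gf_add[OF assms(3)] gf_scale[OF assms(3)] subspace_scale[OF carrier_subspace])
  qed
  show ?thesis unfolding gap_coeff_def lin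
    binom_mult_linear[OF diag_truncated_comp[OF assms(1,3,4)] diag_truncated_comp[OF assms(2,3,4)]]
    binom_mult_linear[OF diag_truncated_comp[OF assms(3,1,4)] diag_truncated_comp[OF assms(3,2,4)]]
    by (simp add: algebra_simps scale_right_distrib scale_left_commute)
qed

lemma gap_coeff_swap:
  assumes "\<kappa> * \<kappa>' = 1"
  shows "gc \<kappa>' n b a w q p = sc (- \<kappa>') (gc \<kappa> n a b w p q)"
  unfolding gap_coeff_def using assms by (simp add: scale_right_diff_distrib mult.commute)

text \<open>\<open>form h g\<close> and \<open>form g h\<close> may differ by an even integer, which
  the shift \<open>m\<close> compensates without changing a sign. The two scalars are then inverse
  to each other by \<open>c_swap\<close>, so exchanging the fields multiplies the gap by a
  unit.\<close>

lemma X_swap: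
  obtains m where "\<And>a b N w p q. commutator h b g a (N + m) w q p = sc (- (c h g * (-1) powi N)) (commutator g a h b N w p q)"
proof -
  obtain m :: int where m: "form h g - form g h = 2 * of_int m"
    using form_sym[of h g] unfolding cong2_def by blast
  have 1: "(-1::complex) powi (N + - (2 * m)) = (-1) powi N" for N
  proof -
    have "(-1::complex) powi (N + - (2 * m)) = (-1) powi N * (-1) powi (- (2 * m))" by (rule power_int_add) auto
    also have "(-1::complex) powi (- (2 * m)) = 1"
      unfolding minus_one_powi_minus by (simp add: power_int_mult)
    finally show ?thesis by simp
  qed
  have 2: "form h g + of_int (N + - (2 * m)) = form g h + of_int N" for N
    using m by (simp add: algebra_simps)
  have 3: "(-1::complex) powi N * (-1) powi N = 1" for N
    by (simp add: power_int_mult_distrib[symmetric])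
  have 4: "(c g h * (-1) powi N) * (c h g * (-1) powi N) = 1" for N
  proof -
    have "(c g h * (-1) powi N) * (c h g * (-1) powi N) = (c g h * c h g) * ((-1) powi N * (-1) powi N)"
      by (simp only: mult_ac)
    then show ?thesis by (simp only: c_swap 3 mult_1)
  qed
  show ?thesis
    by (rule that[of "- (2 * m)"]) (simp only: commutator_def 1 2 gap_coeff_swap[OF 4])
qed

lemma wcf_sym: assumes "weakly_commute g a h b" shows "weakly_commute h b g a"
proof -
  obtain K where K: "wc_bound g a h b K"
    using assms unfolding weakly_commute_def by blast
  obtain m where m: "\<And>a b N w p q. commutator h b g a (N + m) w q p = sc (- (c h g * (-1) powi N)) (commutator g a h b N w p q)"
    using X_swap[of h g] by blast
  have "commutator h b g a N w p q = 0" if "N \<ge> K + m" "w \<in> W s" for N s w p q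
    using m[of b a "N - m" w p q] wc_zero[OF K _ that(2)] that(1) by simp
  then show ?thesis unfolding weakly_commute_def wc_bound_def by blast
qed

lemma wcf_linear_left:
  assumes "gf g a" "gf g a'" "gf h b" "weakly_commute g a h b" "weakly_commute g a' h b"
  shows "weakly_commute g (\<lambda>p w. sc k (a p w) + a' p w) h b"
proof -
  obtain K where K: "wc_bound g a h b K"
    using assms(4) unfolding weakly_commute_def by blast
  obtain K' where K': "wc_bound g a' h b K'"
    using assms(5) unfolding weakly_commute_def by blast
  have "commutator g (\<lambda>p w. sc k (a p w) + a' p w) h b N w p q = 0" if "N \<ge> max K K'" "w \<in> W s" for N s w p q
    using wc_zero[OF K _ that(2)] wc_zero[OF K' _ that(2)] that(1)
    by (simp add: gap_coeff_linear_left[OF assms(1-3) that(2)] commutator_def)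
  then show ?thesis unfolding weakly_commute_def wc_bound_def by blast
qed

lemma wcf_linear_right:
  assumes "gf g a" "gf h b" "gf h b'" "weakly_commute g a h b" "weakly_commute g a h b'"
  shows "weakly_commute g a h (\<lambda>p w. sc k (b p w) + b' p w)"
  using wcf_linear_left[OF assms(2,3,1) wcf_sym[OF assms(4)] wcf_sym[OF assms(5)]] by (rule wcf_sym)

lemma wcf_zero_left: "gf h b \<Longrightarrow> weakly_commute g (\<lambda>p w. 0) h b"
  unfolding weakly_commute_def wc_bound_def commutator_def gap_coeff_def binom_mult_def by (simp add: gf_0)

abbreviation (input) idf :: "complex \<Rightarrow> 'w \<Rightarrow> 'w" where
  "idf \<equiv> (\<lambda>p w. if p = 0 then w else 0)"

lemma gf_id: "gf 0 idf"
  unfolding graded_field_def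
proof (intro conjI allI ballI impI)
  fix p show "linear_map_on sc C sc (\<lambda>w. if p = 0 then w else 0)"
    unfolding linear_map_on_def by auto
next
  fix s w and p :: complex assume w: "w \<in> W s"
  show "(if p = 0 then w else 0) \<in> W (act 0 s)" using w by (simp add: act_zero zero_W)
  assume "(if p = 0 then w else 0) \<noteq> 0"
  then show "formS 0 s + p \<in> \<int>" using cong2_Ints[OF formS_0] by (simp split: if_splits)
next
  fix s w assume "w \<in> W s"
  show "\<exists>R. \<forall>p. Re p < R \<longrightarrow> (if p = 0 then w else 0) = 0" by (rule exI[of _ 0]) auto
qed

lemma wcf_id_left: assumes "gf g a" shows "weakly_commute 0 idf g a"
proof -
  obtain m :: int where m: "form 0 g - 0 = 2 * of_int m" using form_0_left unfolding cong2_def by blast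
  show ?thesis
  \<comment> \<open>With this bound the exponent is exactly 0 and the scalar is 1, so the two terms
    of the gap cancel.\<close>
  proof (rule wcfI[OF gf_id assms, of "- (2 * m)"])
    fix s w p q assume "w \<in> W s"
    have n: "form 0 g + of_int (- (2 * m)) = 0" using m by simp
    have k: "c 0 g * (-1) powi - (2 * m) = 1"
      unfolding minus_one_powi_minus by (simp add: c_0_left power_int_mult)
    show "commutator 0 idf g a (- (2 * m)) w p q = 0"
      unfolding commutator_def n k gap_coeff_def by (simp add: binom_mult_0 gf_0[OF assms])
  qed
qed

text \<open>A formal sum may be split only when its parts are finite; a common commutativity bound
  for \<open>a\<close>, \<open>a'\<close> and their combination truncates the three sums at the same
  place.\<close>

lemma fprod_linear_left:
  assumes "gf g a" "gf g a'" "gf h b" "weakly_commute g a h b" "weakly_commute g a' h b" "w \<in> C"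
  shows "fprod g (\<lambda>p w. sc k (a p w) + a' p w) n h b p w = sc k (fprod g a n h b p w) + fprod g a' n h b p w"
  using assms(6)
proof (induction w rule: C_induct)
  case zero
  note gf = fprod_gf[OF assms(1,3,4)] fprod_gf[OF assms(2,3,5)]
    fprod_gf[OF gf_linear[OF assms(1,2)] assms(3) wcf_linear_left[OF assms(1-5)]]
  show ?case using gf_0[OF gf(1)] gf_0[OF gf(2)] gf_0[OF gf(3)] by simp
next
  case (add s y z)
  note gf = fprod_gf[OF assms(1,3,4)] fprod_gf[OF assms(2,3,5)]
    fprod_gf[OF gf_linear[OF assms(1,2)] assms(3) wcf_linear_left[OF assms(1-5)]]
  have hom: "fprod g (\<lambda>p w. sc k (a p w) + a' p w) n h b p y = sc k (fprod g a n h b p y) + fprod g a' n h b p y"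
  proof (rule fprod_cases[of n g h])
    fix N
    obtain K where K: "wc_bound g a h b K"
    using assms(4) unfolding weakly_commute_def by blast
    obtain K' where K': "wc_bound g a' h b K'"
    using assms(5) unfolding weakly_commute_def by blast
    have lin: "commutator g (\<lambda>p w. sc k (a p w) + a' p w) h b M w p q = sc k (commutator g a h b M w p q) + commutator g a' h b M w p q"
      if "w \<in> W s" for M w s p q
      unfolding commutator_def by (rule gap_coeff_linear_left[OF assms(1-3) that])
    have K'': "wc_bound g (\<lambda>p w. sc k (a p w) + a' p w) h b (max K K')"
      unfolding wc_bound_def using K K' by (auto simp: lin wc_zero)
    let ?B = "nat (max K K' - N)"
    have B: "K \<le> N + int ?B" "K' \<le> N + int ?B" "max K K' \<le> N + int ?B" by auto
    show "fprod g (\<lambda>p w. sc k (a p w) + a' p w) (form g h + of_int N) h b p y =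
        sc k (fprod g a (form g h + of_int N) h b p y) + fprod g a' (form g h + of_int N) h b p y"
      unfolding fprod_sum[OF assms(1,3) K add(1) B(1)] fprod_sum[OF assms(2,3) K' add(1) B(2)]
        fprod_sum[OF gf_linear[OF assms(1,2)] assms(3) K'' add(1) B(3)]
      by (simp add: lin[OF add(1)] scale_right_distrib sum.distrib scale_sum_right mult.commute)
  qed (simp add: fprod_nonint)
  note y = W_C[OF add(1)]
  show ?case
    unfolding gf_add[OF gf(1) y add(2)] gf_add[OF gf(2) y add(2)] gf_add[OF gf(3) y add(2)] hom add(3)
    by (simp add: scale_right_distrib)
qed

text \<open>Exchanging the two fields reduces this to linearity on the left; the exchange divides by
  \<open>\<kappa>\<close>.\<close>

lemma gap_coeff_linear_right:
  assumes "gf g a" "gf h b" "gf h b'" "w \<in> W s" "\<kappa> \<noteq> 0"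
  shows "gc \<kappa> n a (\<lambda>p w. sc k (b p w) + b' p w) w p q = sc k (gc \<kappa> n a b w p q) + gc \<kappa> n a b' w p q"
proof -
  have \<kappa>: "inverse \<kappa> * \<kappa> = 1" using assms(5) by simp
  show ?thesis unfolding gap_coeff_swap[OF \<kappa>, of _ a] gap_coeff_linear_left[OF assms(2,3,1,4)]
    by (simp add: scale_right_distrib mult.commute scale_right_diff_distrib scale_left_commute)
qed

lemma fprod_linear_right:
  assumes "gf g a" "gf h b" "gf h b'" "weakly_commute g a h b" "weakly_commute g a h b'" "w \<in> C"
  shows "fprod g a n h (\<lambda>p w. sc k (b p w) + b' p w) p w = sc k (fprod g a n h b p w) + fprod g a n h b' p w"
  using assms(6)
proof (induction w rule: C_induct)
  case zero
  note gf = fprod_gf[OF assms(1,2,4)] fprod_gf[OF assms(1,3,5)]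
    fprod_gf[OF assms(1) gf_linear[OF assms(2,3)] wcf_linear_right[OF assms(1-5)]]
  show ?case using gf_0[OF gf(1)] gf_0[OF gf(2)] gf_0[OF gf(3)] by simp
next
  case (add s y z)
  note gf = fprod_gf[OF assms(1,2,4)] fprod_gf[OF assms(1,3,5)]
    fprod_gf[OF assms(1) gf_linear[OF assms(2,3)] wcf_linear_right[OF assms(1-5)]]
  have hom: "fprod g a n h (\<lambda>p w. sc k (b p w) + b' p w) p y = sc k (fprod g a n h b p y) + fprod g a n h b' p y"
  proof (rule fprod_cases[of n g h])
    fix N
    obtain K where K: "wc_bound g a h b K"
    using assms(4) unfolding weakly_commute_def by blast
    obtain K' where K': "wc_bound g a h b' K'"
    using assms(5) unfolding weakly_commute_def by blast
    have lin: "commutator g a h (\<lambda>p w. sc k (b p w) + b' p w) M w p q = sc k (commutator g a h b M w p q) + commutator g a h b' M w p q"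
      if "w \<in> W s" for M w s p q
      unfolding commutator_def by (rule gap_coeff_linear_right[OF assms(1-3) that]) (simp add: c_nonzero)
    have K'': "wc_bound g a h (\<lambda>p w. sc k (b p w) + b' p w) (max K K')"
      unfolding wc_bound_def using K K' by (auto simp: lin wc_zero)
    let ?B = "nat (max K K' - N)"
    have B: "K \<le> N + int ?B" "K' \<le> N + int ?B" "max K K' \<le> N + int ?B" by auto
    show "fprod g a (form g h + of_int N) h (\<lambda>p w. sc k (b p w) + b' p w) p y =
        sc k (fprod g a (form g h + of_int N) h b p y) + fprod g a (form g h + of_int N) h b' p y"
      unfolding fprod_sum[OF assms(1,2) K add(1) B(1)] fprod_sum[OF assms(1,3) K' add(1) B(2)]
        fprod_sum[OF assms(1) gf_linear[OF assms(2,3)] K'' add(1) B(3)]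
      by (simp add: lin[OF add(1)] scale_right_distrib sum.distrib scale_sum_right mult.commute)
  qed (simp add: fprod_nonint)
  note y = W_C[OF add(1)]
  show ?case
    unfolding gf_add[OF gf(1) y add(2)] gf_add[OF gf(2) y add(2)] gf_add[OF gf(3) y add(2)] hom add(3)
    by (simp add: scale_right_distrib)
qed

end

section \<open>Dong's lemma\<close>

text \<open>Both sides are \<open>\<alpha> gchoose (i + r)\<close> times the number of ways to
  choose \<open>i\<close> out of \<open>i + r\<close>.\<close>

lemma gbinomial_trinomial_swap:
  fixes \<alpha> :: complex
  shows "(\<alpha> gchoose i) * (\<alpha> - of_nat i gchoose r) = (\<alpha> gchoose r) * (\<alpha> - of_nat r gchoose i)"
proof -
  have "(\<alpha> gchoose (i + r)) * (of_nat (i + r) gchoose i) = (\<alpha> gchoose i) * (\<alpha> - of_nat i gchoose r)"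
    using gbinomial_trinomial_revision[of i "i + r" \<alpha>] by simp
  moreover have "(\<alpha> gchoose (i + r)) * (of_nat (i + r) gchoose r) = (\<alpha> gchoose r) * (\<alpha> - of_nat r gchoose i)"
    using gbinomial_trinomial_revision[of r "i + r" \<alpha>] by simp
  moreover have "(of_nat (i + r) gchoose i :: complex) = of_nat (i + r) gchoose r"
    using gbinomial_of_nat_symmetric[of i "i + r", where 'a = complex] by simp
  ultimately show ?thesis by simp
qed

text \<open>In Dong's lemma \<open>i\<close> runs over a binomial series and \<open>j\<close> over
  products. Here \<open>i\<close> is isolated in one binomial with upper index
  \<open>\<alpha> - of_nat r\<close>, so the sum over \<open>i\<close> becomes a binomial power
  whose exponent is lowered by \<open>r\<close>.\<close>

lemma gbinomial_product_left:
  fixes \<alpha> :: complex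
  shows "(\<alpha> gchoose i) * (\<sigma> + \<alpha> - of_nat i gchoose j) =
    (\<Sum>r\<le>j. (\<sigma> gchoose (j - r)) * (\<alpha> gchoose r) * (\<alpha> - of_nat r gchoose i))"
proof -
  have "(\<sigma> + \<alpha> - of_nat i gchoose j) = (\<Sum>r\<le>j. (\<alpha> - of_nat i gchoose r) * (\<sigma> gchoose (j - r)))"
    unfolding gbinomial_Vandermonde_atMost by (simp add: add.commute add_diff_eq)
  then have "(\<alpha> gchoose i) * (\<sigma> + \<alpha> - of_nat i gchoose j) =
      (\<Sum>r\<le>j. (\<sigma> gchoose (j - r)) * ((\<alpha> gchoose i) * (\<alpha> - of_nat i gchoose r)))"
    by (simp add: sum_distrib_left mult_ac)
  then show ?thesis unfolding gbinomial_trinomial_swap by (simp add: mult.assoc)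
qed

text \<open>The counterpart for the other order of the fields; the factor
  \<open>of_nat i gchoose r\<close> shifts the series by \<open>r\<close> places, as in
  \<open>double_binom_mult_shift\<close>.\<close>

lemma gbinomial_product_right:
  fixes \<alpha> :: complex
  shows "(\<alpha> gchoose i) * (\<sigma> + of_nat i gchoose j) =
    (\<Sum>r\<le>j. (\<sigma> gchoose (j - r)) * ((\<alpha> gchoose i) * (of_nat i gchoose r)))"
proof -
  have "(\<sigma> + of_nat i gchoose j) = (\<Sum>r\<le>j. (of_nat i gchoose r) * (\<sigma> gchoose (j - r)))"
    unfolding gbinomial_Vandermonde_atMost by (simp add: add.commute)
  then show ?thesis by (simp add: sum_distrib_left mult_ac)
qed

abbreviation sgb :: "complex \<Rightarrow> nat \<Rightarrow> complex" where
  "sgb \<gamma> i \<equiv> (\<gamma> gchoose i) * (-1) ^ i"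

lemma Sum_any_shift:
  fixes f :: "nat \<Rightarrow> 'a::comm_monoid_add"
  assumes "\<And>i. i < r \<Longrightarrow> f i = 0"
  shows "Sum_any f = Sum_any (\<lambda>i. f (r + i))"
  by (rule Sum_any_reindex) (use assms in \<open>auto simp: image_iff not_le[symmetric] le_iff_add\<close>)

section \<open>Double binomial sums over finite squares\<close>

context complex_vector_space
begin

lemma double_binom_mult:
  assumes "\<And>l. l \<ge> B \<Longrightarrow> f (P - \<beta> - \<delta> + of_nat l) (q - of_nat l) = 0"
  shows "(\<Sum>i'<B. \<Sum>i<B. sc (sgb \<beta> i' * sgb \<delta> i) (f (P - \<beta> - \<delta> + of_nat (i' + i)) (q - of_nat (i' + i)))) =
    bm (-1) (\<beta> + \<delta>) f P q"
proof -
  let ?h = "\<lambda>l. f (P - \<beta> - \<delta> + of_nat l) (q - of_nat l)"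
  have "(\<Sum>i'<B. \<Sum>i<B. sc (sgb \<beta> i' * sgb \<delta> i) (?h (i' + i))) =
      (\<Sum>i'<B. sc (sgb \<beta> i') (\<Sum>i<B. sc (sgb \<delta> i) (?h (i' + i))))"
    by (simp add: scale_sum_right)
  also have "\<dots> = Sum_any (\<lambda>i'. sc (sgb \<beta> i') (\<Sum>i<B. sc (sgb \<delta> i) (?h (i' + i))))"
    by (rule Sum_any_bounded[symmetric]) (use assms in \<open>simp del: of_nat_add\<close>)
  also have "\<dots> = Sum_any (\<lambda>i'. sc (sgb \<beta> i') (Sum_any (\<lambda>i. sc (sgb \<delta> i) (?h (i' + i)))))"
    by (subst (2) Sum_any_bounded[of B]) (use assms in \<open>simp_all del: of_nat_add\<close>)
  also have "\<dots> = Sum_any (\<lambda>k. sc (\<Sum>i\<le>k. sgb \<beta> i * sgb \<delta> (k - i)) (?h k))"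
    by (rule Sum_any_Cauchy[of B]) (rule assms)
  finally show ?thesis
    unfolding binom_mult_def gbinomial_Vandermonde_sign by (simp add: diff_diff_eq)
qed

text \<open>The factor \<open>of_nat i gchoose r\<close> removes the terms with
  \<open>i < r\<close>. After replacing \<open>i\<close> by \<open>r + i\<close>, trinomial revision
  splits off the binomial of \<open>\<alpha>\<close> over \<open>r\<close> and leaves that of
  \<open>\<alpha> - of_nat r\<close>.\<close>

lemma double_binom_mult_shift:
  assumes "\<And>l. l \<ge> B \<Longrightarrow> f (P - \<beta> - \<alpha> + of_nat l) (q - of_nat l) = 0"
  shows "(\<Sum>i'<B. \<Sum>i<B. sc (sgb \<beta> i' * (sgb \<alpha> i * (of_nat i gchoose r)))
      (f (P - \<beta> - \<alpha> + of_nat (i' + i)) (q - of_nat (i' + i)))) =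
    sc (sgb \<alpha> r) (bm (-1) (\<beta> + (\<alpha> - of_nat r)) f P (q - of_nat r))"
proof -
  let ?h = "\<lambda>l. f (P - \<beta> - \<alpha> + of_nat l) (q - of_nat l)"
  have inner: "(\<Sum>i<B. sc (sgb \<alpha> i * (of_nat i gchoose r)) (?h (i' + i))) =
      sc (sgb \<alpha> r) (Sum_any (\<lambda>i. sc (sgb (\<alpha> - of_nat r) i) (?h (r + (i' + i)))))" for i'
  proof -
    have "(\<Sum>i<B. sc (sgb \<alpha> i * (of_nat i gchoose r)) (?h (i' + i))) =
        Sum_any (\<lambda>i. sc (sgb \<alpha> i * (of_nat i gchoose r)) (?h (i' + i)))"
      by (rule Sum_any_bounded[symmetric]) (use assms in \<open>simp del: of_nat_add\<close>)
    also have "\<dots> = Sum_any (\<lambda>i. sc (sgb \<alpha> (r + i) * (of_nat (r + i) gchoose r)) (?h (i' + (r + i))))"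
      by (rule Sum_any_shift) (simp add: of_nat_gbinomial[symmetric] gbinomial_binomial binomial_eq_0)
    also have "\<dots> = Sum_any (\<lambda>i. sc (sgb \<alpha> r) (sc (sgb (\<alpha> - of_nat r) i) (?h (r + (i' + i)))))"
    proof (rule Sum_any.cong)
      fix i
      have "sgb \<alpha> (r + i) * (of_nat (r + i) gchoose r) = sgb \<alpha> r * sgb (\<alpha> - of_nat r) i"
        using gbinomial_trinomial_revision[of r "r + i" \<alpha>] by (simp add: power_add mult_ac)
      then show "sc (sgb \<alpha> (r + i) * (of_nat (r + i) gchoose r)) (?h (i' + (r + i))) =
          sc (sgb \<alpha> r) (sc (sgb (\<alpha> - of_nat r) i) (?h (r + (i' + i))))"
        by (simp add: add.left_commute)
    qed
    finally show ?thesis by (simp add: scale_Sum_any)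
  qed
  have "(\<Sum>i'<B. \<Sum>i<B. sc (sgb \<beta> i' * (sgb \<alpha> i * (of_nat i gchoose r))) (?h (i' + i))) =
      (\<Sum>i'<B. sc (sgb \<beta> i') (\<Sum>i<B. sc (sgb \<alpha> i * (of_nat i gchoose r)) (?h (i' + i))))"
    by (simp add: scale_sum_right)
  also have "\<dots> = (\<Sum>i'<B. sc (sgb \<alpha> r) (sc (sgb \<beta> i') (Sum_any (\<lambda>i. sc (sgb (\<alpha> - of_nat r) i) (?h (r + (i' + i)))))))"
    unfolding inner by (simp add: mult.commute)
  also have "\<dots> = Sum_any (\<lambda>i'. sc (sgb \<alpha> r) (sc (sgb \<beta> i') (Sum_any (\<lambda>i. sc (sgb (\<alpha> - of_nat r) i) (?h (r + (i' + i)))))))"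
    by (rule Sum_any_bounded[symmetric]) (use assms in \<open>simp del: of_nat_add\<close>)
  also have "\<dots> = sc (sgb \<alpha> r) (Sum_any (\<lambda>i'. sc (sgb \<beta> i') (Sum_any (\<lambda>i. sc (sgb (\<alpha> - of_nat r) i) (?h (r + (i' + i)))))))"
    by (simp only: scale_Sum_any)
  also have "\<dots> = sc (sgb \<alpha> r) (Sum_any (\<lambda>k. sc (\<Sum>i\<le>k. sgb \<beta> i * sgb (\<alpha> - of_nat r) (k - i)) (?h (r + k))))"
    by (subst Sum_any_Cauchy[of B]) (use assms in \<open>auto simp del: of_nat_add\<close>)
  finally show ?thesis
    unfolding binom_mult_def gbinomial_Vandermonde_sign by (simp add: algebra_simps)
qed

end

context field_setting
begin

text \<open>\<open>d(z)\<close> passes \<open>b(y)\<close> under \<open>a(x)\<close>, and then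
  passes \<open>a(x)\<close> on the vector \<open>b(y) w\<close>. Multiplication of
  \<open>(x - y)^n a(x) b(y) d(z) w\<close> by \<open>(x - z)^\<alpha> (y - z)^\<beta>\<close> pays
  for the two exchanges and turns into \<open>(z - x)^\<alpha> (z - y)^\<beta>\<close>; the sums
  over \<open>i\<close> and \<open>i'\<close> expand these factors. From \<open>B0\<close> on, a
  finite square contains all nonzero terms.\<close>

lemma triple_commute:
  assumes a: "gf ga a" and b: "gf gb b" and d: "gf gd d" and w: "w \<in> W s"
    and za: "\<forall>s. \<forall>w\<in>W s. \<forall>p q. gc \<kappa>1 \<alpha> a d w p q = 0"
    and zb: "\<forall>s. \<forall>w\<in>W s. \<forall>p q. gc \<kappa>2 \<beta> b d w p q = 0"
  obtains B0 :: nat where "\<And>B. B \<ge> B0 \<Longrightarrow>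
    (\<Sum>i'<B. \<Sum>i<B. sc (sgb \<beta> i' * sgb \<alpha> i) (bm (-1) n (\<lambda>x y. a x (b y (d (q - of_nat (i' + i)) w)))
        (p1 - \<alpha> + of_nat i) (p - \<beta> + of_nat i'))) =
    sc (\<kappa>1 * \<kappa>2) (\<Sum>i'<B. \<Sum>i<B. sc (sgb \<beta> i' * sgb \<alpha> i) (d (q - \<beta> - \<alpha> + of_nat (i' + i))
        (bm (-1) n (\<lambda>x y. a x (b y w)) (p1 - of_nat i) (p - of_nat i'))))"
proof -
  note zero = gf_0[OF a] gf_0[OF b] gf_0[OF d]
  obtain L1 where L1: "\<And>l. l \<ge> L1 \<Longrightarrow> d (q - of_nat l) w = 0" using gf_bound[OF d w] by blast
  have hd: "\<exists>s. d (q - of_nat l) w \<in> W s" for l using gf_W[OF d w] by blast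
  obtain J where J: "\<And>l i. l \<ge> J \<Longrightarrow> b (p - \<beta> + of_nat i - of_nat l) (d (q - of_nat i) w) = 0"
    using gf_bound_family[OF b, where v = "\<lambda>l. d (q - of_nat l) w" and B = L1, OF hd L1] by blast
  obtain L2 where L2: "\<And>l. l \<ge> L2 \<Longrightarrow> b (p - of_nat l) w = 0" using gf_bound[OF b w] by blast
  have hb: "\<exists>s. b (p - of_nat l) w \<in> W s" for l using gf_W[OF b w] by blast
  obtain I where I: "\<And>l i. l \<ge> I \<Longrightarrow> d (q - \<beta> + of_nat i - of_nat l) (b (p - of_nat i) w) = 0"
    using gf_bound_family[OF d, where v = "\<lambda>l. b (p - of_nat l) w" and B = L2, OF hb L2] by blast
  obtain I2 where I2: "\<And>l i. l \<ge> I2 \<Longrightarrow> a (p1 - n + of_nat i - of_nat l) (b (p - of_nat i) w) = 0"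
    using gf_bound_family[OF a, where v = "\<lambda>l. b (p - of_nat l) w" and B = L2, OF hb L2] by blast
  \<comment> \<open>\<open>T1\<close>, \<open>T2\<close> and \<open>T3\<close> are the summands in
    the operator orders \<open>a b d\<close>, \<open>a d b\<close> and \<open>d a b\<close>, with
    \<open>j\<close> expanding the factor \<open>(x - y)^n\<close>.\<close>
  define T1 where "T1 i' i j = a (p1 - \<alpha> - n + of_nat i + of_nat j) (b (p - \<beta> + of_nat i' - of_nat j) (d (q - of_nat (i' + i)) w))" for i' i j :: nat
  define T2 where "T2 i' i j = a (p1 - \<alpha> - n + of_nat i + of_nat j) (d (q - \<beta> + of_nat i' - of_nat i) (b (p - of_nat (i' + j)) w))" for i' i j :: nat
  define T3 where "T3 i' i j = d (q - \<beta> - \<alpha> + of_nat (i' + i)) (a (p1 - n + of_nat j - of_nat i) (b (p - of_nat (i' + j)) w))" for i' i j :: nat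
  \<comment> \<open>The first two bounds depend on \<open>i + j\<close> only and the third on
    \<open>i + i'\<close> only, so each is uniform in the remaining index.\<close>
  have b_J: "b (p - \<beta> + of_nat i' - of_nat j) (d (q - of_nat (i' + i)) w) = 0" if "i + j \<ge> J" for i' i j
    using J[of "i + j" "i' + i"] that by (simp add: algebra_simps)
  have d_I: "d (q - \<beta> + of_nat i' - of_nat i) (b (p - of_nat (i' + j)) w) = 0" if "i + j \<ge> I" for i' i j
    using I[of "i + j" "i' + j"] that by (simp add: algebra_simps)
  have a_I2: "a (p1 - n + of_nat j - of_nat i) (b (p - of_nat (i' + j)) w) = 0" if "i + i' \<ge> I2" for i' i j
    using I2[of "i + i'" "i' + j"] that by (simp add: algebra_simps)
  define B0 where "B0 = Max {L1, J, L2, I, I2}"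
  have B0: "B0 \<ge> L1" "B0 \<ge> J" "B0 \<ge> L2" "B0 \<ge> I" "B0 \<ge> I2" unfolding B0_def by auto
  have "(\<Sum>i'<B. \<Sum>i<B. sc (sgb \<beta> i' * sgb \<alpha> i) (bm (-1) n (\<lambda>x y. a x (b y (d (q - of_nat (i' + i)) w)))
        (p1 - \<alpha> + of_nat i) (p - \<beta> + of_nat i'))) =
    sc (\<kappa>1 * \<kappa>2) (\<Sum>i'<B. \<Sum>i<B. sc (sgb \<beta> i' * sgb \<alpha> i) (d (q - \<beta> - \<alpha> + of_nat (i' + i))
        (bm (-1) n (\<lambda>x y. a x (b y w)) (p1 - of_nat i) (p - of_nat i'))))" if B: "B \<ge> B0" for B
  proof -
    have 1: "bm (-1) n (\<lambda>x y. a x (b y (d (q - of_nat (i' + i)) w))) (p1 - \<alpha> + of_nat i) (p - \<beta> + of_nat i') =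
        (\<Sum>j<B. sc (sgb n j) (T1 i' i j))" for i' i
      unfolding binom_mult_def T1_def
    proof (subst Sum_any_bounded[of B])
      fix j assume "B \<le> j"
      then have "i + j \<ge> J" using B B0 by simp
      then show "sc (sgb n j) (a (p1 - \<alpha> + of_nat i - n + of_nat j)
          (b (p - \<beta> + of_nat i' - of_nat j) (d (q - of_nat (i' + i)) w))) = 0"
        by (simp only: b_J zero scale_zero_right)
    qed (simp add: algebra_simps)
    have 3: "d (q - \<beta> - \<alpha> + of_nat (i' + i)) (bm (-1) n (\<lambda>x y. a x (b y w)) (p1 - of_nat i) (p - of_nat i')) =
        (\<Sum>j<B. sc (sgb n j) (T3 i' i j))" for i' i
    proof -
      have "bm (-1) n (\<lambda>x y. a x (b y w)) (p1 - of_nat i) (p - of_nat i') =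
          (\<Sum>j<B. sc (sgb n j) (a (p1 - n + of_nat j - of_nat i) (b (p - of_nat (i' + j)) w)))"
        unfolding binom_mult_def
      proof (subst Sum_any_bounded[of B])
        fix j assume "B \<le> j"
        then have "b (p - of_nat (i' + j)) w = 0" using B B0 by (intro L2) simp
        then show "sc (sgb n j) (a (p1 - of_nat i - n + of_nat j) (b (p - of_nat i' - of_nat j) w)) = 0"
          by (simp add: zero diff_diff_eq)
      qed (simp add: algebra_simps)
      then show ?thesis unfolding T3_def
        by (simp add: gf_sum[OF d W_C[OF gf_W[OF a gf_W[OF b w]]]])
    qed
    have step1: "(\<Sum>i'<B. sc (sgb \<beta> i') (T1 i' i j)) = sc \<kappa>2 (\<Sum>i'<B. sc (sgb \<beta> i') (T2 i' i j))" for i j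
    proof -
      have e1: "bm (-1) \<beta> (\<lambda>x y. b x (d y w)) (p - of_nat j) (q - of_nat i) =
          (\<Sum>i'<B. sc (sgb \<beta> i') (b (p - \<beta> + of_nat i' - of_nat j) (d (q - of_nat (i' + i)) w)))"
        unfolding binom_mult_def
      proof (subst Sum_any_bounded[of B])
        fix i' assume "B \<le> i'"
        then have "d (q - of_nat (i' + i)) w = 0" using B B0 by (intro L1) simp
        then show "sc (sgb \<beta> i') (b (p - of_nat j - \<beta> + of_nat i') (d (q - of_nat i - of_nat i') w)) = 0"
          by (simp add: zero algebra_simps)
      qed (simp add: algebra_simps)
      have e2: "bm (-1) \<beta> (\<lambda>y x. d y (b x w)) (q - of_nat i) (p - of_nat j) =
          (\<Sum>i'<B. sc (sgb \<beta> i') (d (q - \<beta> + of_nat i' - of_nat i) (b (p - of_nat (i' + j)) w)))"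
        unfolding binom_mult_def
      proof (subst Sum_any_bounded[of B])
        fix i' assume "B \<le> i'"
        then have "b (p - of_nat (i' + j)) w = 0" using B B0 by (intro L2) simp
        then show "sc (sgb \<beta> i') (d (q - of_nat i - \<beta> + of_nat i') (b (p - of_nat j - of_nat i') w)) = 0"
          by (simp add: zero algebra_simps)
      qed (simp add: algebra_simps)
      have "(\<Sum>i'<B. sc (sgb \<beta> i') (b (p - \<beta> + of_nat i' - of_nat j) (d (q - of_nat (i' + i)) w))) =
          sc \<kappa>2 (\<Sum>i'<B. sc (sgb \<beta> i') (d (q - \<beta> + of_nat i' - of_nat i) (b (p - of_nat (i' + j)) w)))"
        using zb[rule_format, OF w, of "p - of_nat j" "q - of_nat i"] unfolding gap_coeff_def e1 e2 by simp
      from arg_cong[OF this, of "a (p1 - \<alpha> - n + of_nat i + of_nat j)"]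
      moreover have "(\<Sum>i'<B. sc (sgb \<beta> i') (d (q - \<beta> + of_nat i' - of_nat i) (b (p - of_nat (i' + j)) w))) \<in> C"
        by (intro subspace_sum[OF carrier_subspace] subspace_scale[OF carrier_subspace]
            W_C[OF gf_W[OF d gf_W[OF b w]]])
      ultimately show ?thesis unfolding T1_def T2_def
        by (simp only: gf_scale[OF a] gf_sum[OF a W_C[OF gf_W[OF b gf_W[OF d w]]]]
            gf_sum[OF a W_C[OF gf_W[OF d gf_W[OF b w]]]])
    qed
    have step2: "(\<Sum>i<B. sc (sgb \<alpha> i) (T2 i' i j)) = sc \<kappa>1 (\<Sum>i<B. sc (sgb \<alpha> i) (T3 i' i j))" for i' j
    proof -
      let ?u = "b (p - of_nat (i' + j)) w"
      have e1: "bm (-1) \<alpha> (\<lambda>x y. a x (d y ?u)) (p1 - n + of_nat j) (q - \<beta> + of_nat i') =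
          (\<Sum>i<B. sc (sgb \<alpha> i) (T2 i' i j))"
        unfolding binom_mult_def T2_def
      proof (subst Sum_any_bounded[of B])
        fix i assume "B \<le> i"
        then have "i + j \<ge> I" using B B0 by simp
        then show "sc (sgb \<alpha> i) (a (p1 - n + of_nat j - \<alpha> + of_nat i) (d (q - \<beta> + of_nat i' - of_nat i) ?u)) = 0"
          by (simp only: d_I zero scale_zero_right)
      qed (simp add: algebra_simps)
      have e2: "bm (-1) \<alpha> (\<lambda>y x. d y (a x ?u)) (q - \<beta> + of_nat i') (p1 - n + of_nat j) =
          (\<Sum>i<B. sc (sgb \<alpha> i) (T3 i' i j))"
        unfolding binom_mult_def T3_def
      proof (subst Sum_any_bounded[of B])
        fix i assume "B \<le> i"
        then have "i + i' \<ge> I2" using B B0 by simp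
        then show "sc (sgb \<alpha> i) (d (q - \<beta> + of_nat i' - \<alpha> + of_nat i) (a (p1 - n + of_nat j - of_nat i) ?u)) = 0"
          by (simp only: a_I2 zero scale_zero_right)
      qed (simp add: algebra_simps)
      show ?thesis
        using za[rule_format, OF gf_W[OF b w], of "p - of_nat (i' + j)" "p1 - n + of_nat j" "q - \<beta> + of_nat i'"]
        unfolding gap_coeff_def e1 e2 by simp
    qed
    have "(\<Sum>i'<B. \<Sum>i<B. sc (sgb \<beta> i' * sgb \<alpha> i) (\<Sum>j<B. sc (sgb n j) (T1 i' i j))) =
        (\<Sum>i'<B. \<Sum>i<B. \<Sum>j<B. sc (sgb \<alpha> i * sgb n j) (sc (sgb \<beta> i') (T1 i' i j)))"
      by (simp add: scale_sum_right mult_ac)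
    also have "\<dots> = (\<Sum>i<B. \<Sum>j<B. \<Sum>i'<B. sc (sgb \<alpha> i * sgb n j) (sc (sgb \<beta> i') (T1 i' i j)))"
      by (subst sum.swap, subst (2) sum.swap) (rule refl)
    also have "\<dots> = (\<Sum>i<B. \<Sum>j<B. sc (sgb \<alpha> i * sgb n j) (sc \<kappa>2 (\<Sum>i'<B. sc (sgb \<beta> i') (T2 i' i j))))"
      unfolding scale_sum_right[symmetric] step1 ..
    also have "\<dots> = (\<Sum>i<B. \<Sum>j<B. \<Sum>i'<B. sc (\<kappa>2 * sgb n j * sgb \<beta> i') (sc (sgb \<alpha> i) (T2 i' i j)))"
      by (simp add: scale_sum_right mult_ac)
    also have "\<dots> = (\<Sum>j<B. \<Sum>i'<B. \<Sum>i<B. sc (\<kappa>2 * sgb n j * sgb \<beta> i') (sc (sgb \<alpha> i) (T2 i' i j)))"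
      by (subst sum.swap, subst (2) sum.swap) (rule refl)
    also have "\<dots> = (\<Sum>j<B. \<Sum>i'<B. sc (\<kappa>2 * sgb n j * sgb \<beta> i') (sc \<kappa>1 (\<Sum>i<B. sc (sgb \<alpha> i) (T3 i' i j))))"
      unfolding scale_sum_right[symmetric] step2 ..
    also have "\<dots> = (\<Sum>j<B. \<Sum>i'<B. \<Sum>i<B. sc (\<kappa>1 * \<kappa>2 * (sgb \<beta> i' * sgb \<alpha> i) * sgb n j) (T3 i' i j))"
      by (simp add: scale_sum_right mult_ac)
    also have "\<dots> = (\<Sum>i'<B. \<Sum>i<B. \<Sum>j<B. sc (\<kappa>1 * \<kappa>2 * (sgb \<beta> i' * sgb \<alpha> i) * sgb n j) (T3 i' i j))"
      by (subst sum.swap, subst (2) sum.swap) (rule refl)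
    also have "\<dots> = sc (\<kappa>1 * \<kappa>2) (\<Sum>i'<B. \<Sum>i<B. sc (sgb \<beta> i' * sgb \<alpha> i) (\<Sum>j<B. sc (sgb n j) (T3 i' i j)))"
      by (simp add: scale_sum_right mult_ac)
    finally show ?thesis unfolding 1 3 .
  qed
  then show ?thesis using that by blast
qed

end

context field_setting
begin

lemma gf_diff_scale:
  assumes "gf g d" "x \<in> C" "y \<in> C"
  shows "d p (x - sc k y) = d p x - sc k (d p y)"
proof -
  have "d p (x + sc (- k) y) = d p x + sc (- k) (d p y)"
    by (simp only: gf_add[OF assms(1,2) subspace_scale[OF carrier_subspace assms(3)]] gf_scale[OF assms(1,3)])
  then show ?thesis by simp
qed

lemma W_bm_comp:
  assumes "gf g a" "gf h b" "w \<in> W s"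
  shows "bm \<epsilon> n (\<lambda>x y. a x (b y w)) p q \<in> C"
  by (rule W_C, rule W_binom_mult) (rule gf_W[OF assms(1) gf_W[OF assms(2,3)]])

text \<open>Moving \<open>d\<close> past either term of the gap of \<open>a\<close> and
  \<open>b\<close> costs the same two factors; the second term is \<open>triple_commute\<close> with
  the roles of \<open>a\<close> and \<open>b\<close> exchanged.\<close>

lemma X_commute:
  assumes a: "gf g a" and b: "gf h b" and d: "gf k d" and w: "w \<in> W s"
    and za: "\<forall>s. \<forall>w\<in>W s. \<forall>p q. gc \<kappa>1 \<alpha> a d w p q = 0"
    and zb: "\<forall>s. \<forall>w\<in>W s. \<forall>p q. gc \<kappa>2 \<beta> b d w p q = 0"
  obtains B0 :: nat where "\<And>B. B \<ge> B0 \<Longrightarrow>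
    (\<Sum>i'<B. \<Sum>i<B. sc (sgb \<beta> i' * sgb \<alpha> i)
      (commutator g a h b N (d (q - of_nat (i' + i)) w) (p1 - \<alpha> + of_nat i) (p - \<beta> + of_nat i'))) =
    sc (\<kappa>1 * \<kappa>2) (\<Sum>i'<B. \<Sum>i<B. sc (sgb \<beta> i' * sgb \<alpha> i)
      (d (q - \<beta> - \<alpha> + of_nat (i' + i)) (commutator g a h b N w (p1 - of_nat i) (p - of_nat i'))))"
proof -
  let ?n = "form g h + of_int N"
  let ?\<kappa> = "c g h * (-1) powi N"
  obtain B1 where B1: "\<And>B. B \<ge> B1 \<Longrightarrow>
    (\<Sum>i'<B. \<Sum>i<B. sc (sgb \<beta> i' * sgb \<alpha> i) (bm (-1) ?n (\<lambda>x y. a x (b y (d (q - of_nat (i' + i)) w)))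
        (p1 - \<alpha> + of_nat i) (p - \<beta> + of_nat i'))) =
    sc (\<kappa>1 * \<kappa>2) (\<Sum>i'<B. \<Sum>i<B. sc (sgb \<beta> i' * sgb \<alpha> i) (d (q - \<beta> - \<alpha> + of_nat (i' + i))
        (bm (-1) ?n (\<lambda>x y. a x (b y w)) (p1 - of_nat i) (p - of_nat i'))))"
    using triple_commute[OF a b d w za zb, where n = ?n and q = q and p = p and ?p1.0 = p1] by blast
  obtain B2 where B2: "\<And>B. B \<ge> B2 \<Longrightarrow>
    (\<Sum>i'<B. \<Sum>i<B. sc (sgb \<alpha> i' * sgb \<beta> i) (bm (-1) ?n (\<lambda>x y. b x (a y (d (q - of_nat (i' + i)) w)))
        (p - \<beta> + of_nat i) (p1 - \<alpha> + of_nat i'))) =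
    sc (\<kappa>2 * \<kappa>1) (\<Sum>i'<B. \<Sum>i<B. sc (sgb \<alpha> i' * sgb \<beta> i) (d (q - \<alpha> - \<beta> + of_nat (i' + i))
        (bm (-1) ?n (\<lambda>x y. b x (a y w)) (p - of_nat i) (p1 - of_nat i'))))"
    using triple_commute[OF b a d w zb za, where n = ?n and q = q and p = p1 and ?p1.0 = p] by blast
  show ?thesis
  proof (rule that[of "max B1 B2"])
    fix B assume "max B1 B2 \<le> B"
    then have BB: "B \<ge> B1" "B \<ge> B2" by auto
    have 2: "(\<Sum>i'<B. \<Sum>i<B. sc (sgb \<beta> i' * sgb \<alpha> i) (bm (-1) ?n (\<lambda>x y. b x (a y (d (q - of_nat (i' + i)) w)))
        (p - \<beta> + of_nat i') (p1 - \<alpha> + of_nat i))) =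
      sc (\<kappa>1 * \<kappa>2) (\<Sum>i'<B. \<Sum>i<B. sc (sgb \<beta> i' * sgb \<alpha> i) (d (q - \<beta> - \<alpha> + of_nat (i' + i))
        (bm (-1) ?n (\<lambda>x y. b x (a y w)) (p - of_nat i') (p1 - of_nat i))))"
    proof -
      have q: "q - \<alpha> - \<beta> = q - \<beta> - \<alpha>" by simp
      have swap: "(\<Sum>i'<B. \<Sum>i<B. sc (sgb \<beta> i' * sgb \<alpha> i) (F i' i)) =
          (\<Sum>i'<B. \<Sum>i<B. sc (sgb \<alpha> i' * sgb \<beta> i) (F i i'))" for F
        by (rule trans[OF sum.swap]) (simp add: mult.commute)
      show ?thesis
        unfolding swap using B2[OF BB(2)] unfolding q mult.commute[of \<kappa>2]
        by (simp only: add.commute)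
    qed
    have dX: "d y (commutator g a h b N w u v) =
        d y (bm (-1) ?n (\<lambda>x y. a x (b y w)) u v) - sc ?\<kappa> (d y (bm (-1) ?n (\<lambda>x y. b x (a y w)) v u))" for y u v
      unfolding commutator_def gap_coeff_def by (rule gf_diff_scale[OF d W_bm_comp[OF a b w] W_bm_comp[OF b a w]])
    have "(\<Sum>i'<B. \<Sum>i<B. sc (sgb \<beta> i' * sgb \<alpha> i)
        (commutator g a h b N (d (q - of_nat (i' + i)) w) (p1 - \<alpha> + of_nat i) (p - \<beta> + of_nat i'))) =
      (\<Sum>i'<B. \<Sum>i<B. sc (sgb \<beta> i' * sgb \<alpha> i) (bm (-1) ?n (\<lambda>x y. a x (b y (d (q - of_nat (i' + i)) w)))
        (p1 - \<alpha> + of_nat i) (p - \<beta> + of_nat i'))) -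
      sc ?\<kappa> (\<Sum>i'<B. \<Sum>i<B. sc (sgb \<beta> i' * sgb \<alpha> i) (bm (-1) ?n (\<lambda>x y. b x (a y (d (q - of_nat (i' + i)) w)))
        (p - \<beta> + of_nat i') (p1 - \<alpha> + of_nat i)))"
      unfolding commutator_def gap_coeff_def
      by (simp add: scale_right_diff_distrib sum_subtractf scale_sum_right mult_ac)
    also have "\<dots> = sc (\<kappa>1 * \<kappa>2) (\<Sum>i'<B. \<Sum>i<B. sc (sgb \<beta> i' * sgb \<alpha> i)
      (d (q - \<beta> - \<alpha> + of_nat (i' + i)) (commutator g a h b N w (p1 - of_nat i) (p - of_nat i'))))"
      unfolding 2 B1[OF BB(1)] dX
      by (simp add: scale_right_diff_distrib sum_subtractf scale_sum_right mult_ac)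
    finally show "(\<Sum>i'<B. \<Sum>i<B. sc (sgb \<beta> i' * sgb \<alpha> i)
        (commutator g a h b N (d (q - of_nat (i' + i)) w) (p1 - \<alpha> + of_nat i) (p - \<beta> + of_nat i'))) = \<dots>" .
  qed
qed

context
  fixes g h k a b d K K1 K2
  assumes a: "gf g a" and b: "gf h b" and d: "gf k d"
    and K: "wc_bound g a h b K" and K1: "wc_bound g a k d K1" and K2: "wc_bound h b k d K2"
begin

text \<open>This is \<open>X_commute\<close> on the line where the first exponent is
  \<open>- 1 - formS g s\<close>, with the gap of \<open>a\<close> and \<open>b\<close> rewritten on
  both sides through products by the Jacobi identity. The sums over \<open>i\<close> and
  \<open>i'\<close> then collapse to gap coefficients of the products \<open>e j\<close> with
  \<open>d\<close>.\<close>

lemma dong_sum: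
  fixes N
  defines "\<alpha> \<equiv> form g k + of_int K1" and "\<beta> \<equiv> form h k + of_int K2"
    and "\<kappa> \<equiv> (c g k * (-1) powi K1) * (c h k * (-1) powi K2)"
    and "e \<equiv> \<lambda>j. iprod g a h b (N + int j)"
  assumes w: "w \<in> W s"
  shows "(\<Sum>j<nat (K - N). \<Sum>r\<le>j. sc ((formS g s gchoose (j - r)) * (\<alpha> gchoose r))
    (gc (\<kappa> * (-1) ^ r) (\<beta> + (\<alpha> - of_nat r)) (e j) d w (p - formS g s + of_nat j - of_nat r) q)) = 0"
proof -
  let ?\<sigma> = "formS g s"
  let ?J = "nat (K - N)"
  have ab: "weakly_commute g a h b" unfolding weakly_commute_def using K by blast
  have e: "gf (g + h) (e j)" for j unfolding e_def by (rule fprod_gf[OF a b ab])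
  have za: "\<forall>s. \<forall>w\<in>W s. \<forall>p q. gc (c g k * (-1) powi K1) \<alpha> a d w p q = 0"
    using wc_zero[OF K1 order_refl] unfolding commutator_def \<alpha>_def by blast
  have zb: "\<forall>s. \<forall>w\<in>W s. \<forall>p q. gc (c h k * (-1) powi K2) \<beta> b d w p q = 0"
    using wc_zero[OF K2 order_refl] unfolding commutator_def \<beta>_def by blast
  obtain B0 where B0: "\<And>B. B \<ge> B0 \<Longrightarrow>
    (\<Sum>i'<B. \<Sum>i<B. sc (sgb \<beta> i' * sgb \<alpha> i)
      (commutator g a h b N (d (q - of_nat (i' + i)) w) (- 1 - ?\<sigma> - \<alpha> + of_nat i) (p - \<beta> + of_nat i'))) =
    sc \<kappa> (\<Sum>i'<B. \<Sum>i<B. sc (sgb \<beta> i' * sgb \<alpha> i)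
      (d (q - \<beta> - \<alpha> + of_nat (i' + i)) (commutator g a h b N w (- 1 - ?\<sigma> - of_nat i) (p - of_nat i'))))"
    unfolding \<kappa>_def using X_commute[OF a b d w za zb, where N = N and q = q and p = p and ?p1.0 = "- 1 - ?\<sigma>"] by blast
  obtain L1 where L1: "\<And>l. l \<ge> L1 \<Longrightarrow> d (q - of_nat l) w = 0" using gf_bound[OF d w] by blast
  have "\<exists>L. \<forall>l\<ge>L. e j (p - ?\<sigma> + of_nat j - of_nat l) w = 0" for j :: nat
    using gf_bound[OF e w] by metis
  then obtain L where L: "\<And>j l. l \<ge> L j \<Longrightarrow> e j (p - ?\<sigma> + of_nat j - of_nat l) w = 0" by metis
  define B where "B = Max (insert B0 (insert L1 (L ` {..<?J})))"
  have B: "B \<ge> B0" "B \<ge> L1" "\<And>j. j < ?J \<Longrightarrow> B \<ge> L j"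
    unfolding B_def by (rule Max_ge; simp)+
  define F where "F j l = e j (p - ?\<sigma> + of_nat j - \<beta> - \<alpha> + of_nat l) (d (q - of_nat l) w)" for j l :: nat
  define G where "G j l = d (q - \<beta> - \<alpha> + of_nat l) (e j (p - ?\<sigma> + of_nat j - of_nat l) w)" for j l :: nat
  define cc where "cc j r = (?\<sigma> gchoose (j - r)) * (\<alpha> gchoose r)" for j r
  have KJ: "K \<le> N + int ?J" by simp
  \<comment> \<open>Here the gap acts on a vector of degree \<open>act k s\<close>. Its first
    exponent lies on the right coset because \<open>\<alpha>\<close> is congruent to
    \<open>form g k\<close>, and the same shift by \<open>\<alpha>\<close> enters the upper index of
    the binomial.\<close>
  have XL: "commutator g a h b N (d (q - of_nat (i' + i)) w) (- 1 - ?\<sigma> - \<alpha> + of_nat i) (p - \<beta> + of_nat i') =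
      (\<Sum>j<?J. sc (?\<sigma> + \<alpha> - of_nat i gchoose j) (F j (i' + i)))" for i' i
  proof -
    have "formS g (act k s) - (form g k + ?\<sigma>) + (of_int (int i - 1 - K1)) \<in> \<int>"
      by (rule Ints_add[OF cong2_Ints[OF formS_act] Ints_of_int])
    then have "formS g (act k s) + (- 1 - ?\<sigma> - \<alpha> + of_nat i) \<in> \<int>"
      unfolding \<alpha>_def by (simp add: algebra_simps)
    from jacobi_identity_sum[OF a b K gf_W[OF d w] this KJ]
    show ?thesis unfolding F_def e_def by (simp add: algebra_simps)
  qed
  have XR: "commutator g a h b N w (- 1 - ?\<sigma> - of_nat i) (p - of_nat i') =
      (\<Sum>j<?J. sc (?\<sigma> + of_nat i gchoose j) (e j (p - ?\<sigma> + of_nat j - of_nat (i' + i)) w))" for i' i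
  proof -
    have "?\<sigma> + (- 1 - ?\<sigma> - of_nat i) = of_int (- 1 - int i)" by simp
    then have "?\<sigma> + (- 1 - ?\<sigma> - of_nat i) \<in> \<int>" by (metis Ints_of_int)
    from jacobi_identity_sum[OF a b K w this KJ]
    show ?thesis unfolding e_def by (simp add: algebra_simps)
  qed
  have left: "(\<Sum>i'<B. \<Sum>i<B. sc (sgb \<beta> i' * sgb \<alpha> i)
      (commutator g a h b N (d (q - of_nat (i' + i)) w) (- 1 - ?\<sigma> - \<alpha> + of_nat i) (p - \<beta> + of_nat i'))) =
      (\<Sum>j<?J. \<Sum>r\<le>j. sc (cc j r) (bm (-1) (\<beta> + (\<alpha> - of_nat r)) (\<lambda>x y. e j x (d y w))
        (p - ?\<sigma> + of_nat j - of_nat r) q))"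
  proof -
    have 1: "(\<Sum>i'<B. \<Sum>i<B. sc (sgb \<beta> i' * sgb (\<alpha> - of_nat r) i) (F j (i' + i))) =
        bm (-1) (\<beta> + (\<alpha> - of_nat r)) (\<lambda>x y. e j x (d y w)) (p - ?\<sigma> + of_nat j - of_nat r) q" for j r
      using double_binom_mult[of B "\<lambda>x y. e j x (d y w)" "p - ?\<sigma> + of_nat j - of_nat r" \<beta> "\<alpha> - of_nat r" q]
        L1 B(2) gf_0[OF e] unfolding F_def by (simp add: algebra_simps)
    have 2: "sgb \<beta> i' * sgb \<alpha> i * (?\<sigma> + \<alpha> - of_nat i gchoose j) =
        (\<Sum>r\<le>j. cc j r * (sgb \<beta> i' * sgb (\<alpha> - of_nat r) i))" for i' i j
    proof -
      have "sgb \<beta> i' * sgb \<alpha> i * (?\<sigma> + \<alpha> - of_nat i gchoose j) =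
          sgb \<beta> i' * (-1) ^ i * ((\<alpha> gchoose i) * (?\<sigma> + \<alpha> - of_nat i gchoose j))" by simp
      then show ?thesis unfolding gbinomial_product_left cc_def by (simp add: sum_distrib_left mult_ac)
    qed
    have "(\<Sum>i'<B. \<Sum>i<B. sc (sgb \<beta> i' * sgb \<alpha> i)
        (commutator g a h b N (d (q - of_nat (i' + i)) w) (- 1 - ?\<sigma> - \<alpha> + of_nat i) (p - \<beta> + of_nat i'))) =
      (\<Sum>i'<B. \<Sum>i<B. \<Sum>j<?J. sc (sgb \<beta> i' * sgb \<alpha> i * (?\<sigma> + \<alpha> - of_nat i gchoose j)) (F j (i' + i)))"
      unfolding XL by (simp add: scale_sum_right)
    also have "\<dots> = (\<Sum>i'<B. \<Sum>i<B. \<Sum>j<?J. \<Sum>r\<le>j. sc (cc j r) (sc (sgb \<beta> i' * sgb (\<alpha> - of_nat r) i) (F j (i' + i))))"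
      unfolding 2 scale_sum_left by simp
    also have "\<dots> = (\<Sum>j<?J. \<Sum>i'<B. \<Sum>i<B. \<Sum>r\<le>j. sc (cc j r) (sc (sgb \<beta> i' * sgb (\<alpha> - of_nat r) i) (F j (i' + i))))"
      by (subst (2) sum.swap, subst sum.swap) (rule refl)
    also have "\<dots> = (\<Sum>j<?J. \<Sum>r\<le>j. \<Sum>i'<B. \<Sum>i<B. sc (cc j r) (sc (sgb \<beta> i' * sgb (\<alpha> - of_nat r) i) (F j (i' + i))))"
      by (subst (3) sum.swap, subst (2) sum.swap) (rule refl)
    finally show ?thesis unfolding scale_sum_right[symmetric] 1 .
  qed
  have right: "(\<Sum>i'<B. \<Sum>i<B. sc (sgb \<beta> i' * sgb \<alpha> i)
      (d (q - \<beta> - \<alpha> + of_nat (i' + i)) (commutator g a h b N w (- 1 - ?\<sigma> - of_nat i) (p - of_nat i')))) =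
      (\<Sum>j<?J. \<Sum>r\<le>j. sc (cc j r) (sc ((-1) ^ r) (bm (-1) (\<beta> + (\<alpha> - of_nat r)) (\<lambda>y x. d y (e j x w))
        q (p - ?\<sigma> + of_nat j - of_nat r))))"
  proof -
    have 1: "(\<Sum>i'<B. \<Sum>i<B. sc (sgb \<beta> i' * (sgb \<alpha> i * (of_nat i gchoose r))) (G j (i' + i))) =
        sc (sgb \<alpha> r) (bm (-1) (\<beta> + (\<alpha> - of_nat r)) (\<lambda>y x. d y (e j x w)) q (p - ?\<sigma> + of_nat j - of_nat r))"
      if "j < ?J" for j r
      unfolding G_def
      by (rule double_binom_mult_shift) (use L B(3)[OF that] gf_0[OF d] in \<open>auto\<close>)
    have dsum: "d y (\<Sum>j<?J. sc (?\<sigma> + of_nat i gchoose j) (e j (p - ?\<sigma> + of_nat j - of_nat l) w)) =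
        (\<Sum>j<?J. sc (?\<sigma> + of_nat i gchoose j) (d y (e j (p - ?\<sigma> + of_nat j - of_nat l) w)))" for y i l
      by (rule gf_sum[OF d W_C[OF gf_W[OF e w]]])
    have 2: "sgb \<beta> i' * sgb \<alpha> i * (?\<sigma> + of_nat i gchoose j) =
        (\<Sum>r\<le>j. (?\<sigma> gchoose (j - r)) * (sgb \<beta> i' * (sgb \<alpha> i * (of_nat i gchoose r))))" for i' i j
    proof -
      have "sgb \<beta> i' * sgb \<alpha> i * (?\<sigma> + of_nat i gchoose j) =
          sgb \<beta> i' * (-1) ^ i * ((\<alpha> gchoose i) * (?\<sigma> + of_nat i gchoose j))" by simp
      then show ?thesis unfolding gbinomial_product_right by (simp add: sum_distrib_left mult_ac)
    qed
    have "(\<Sum>i'<B. \<Sum>i<B. sc (sgb \<beta> i' * sgb \<alpha> i)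
      (d (q - \<beta> - \<alpha> + of_nat (i' + i)) (commutator g a h b N w (- 1 - ?\<sigma> - of_nat i) (p - of_nat i')))) =
      (\<Sum>i'<B. \<Sum>i<B. \<Sum>j<?J. sc (sgb \<beta> i' * sgb \<alpha> i * (?\<sigma> + of_nat i gchoose j)) (G j (i' + i)))"
      unfolding XR dsum G_def by (simp add: scale_sum_right)
    also have "\<dots> = (\<Sum>i'<B. \<Sum>i<B. \<Sum>j<?J. \<Sum>r\<le>j. sc (?\<sigma> gchoose (j - r)) (sc (sgb \<beta> i' * (sgb \<alpha> i * (of_nat i gchoose r))) (G j (i' + i))))"
      unfolding 2 scale_sum_left by simp
    also have "\<dots> = (\<Sum>j<?J. \<Sum>i'<B. \<Sum>i<B. \<Sum>r\<le>j. sc (?\<sigma> gchoose (j - r)) (sc (sgb \<beta> i' * (sgb \<alpha> i * (of_nat i gchoose r))) (G j (i' + i))))"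
      by (subst (2) sum.swap, subst sum.swap) (rule refl)
    also have "\<dots> = (\<Sum>j<?J. \<Sum>r\<le>j. \<Sum>i'<B. \<Sum>i<B. sc (?\<sigma> gchoose (j - r)) (sc (sgb \<beta> i' * (sgb \<alpha> i * (of_nat i gchoose r))) (G j (i' + i))))"
      by (subst (3) sum.swap, subst (2) sum.swap) (rule refl)
    also have "\<dots> = (\<Sum>j<?J. \<Sum>r\<le>j. sc (?\<sigma> gchoose (j - r)) (sc (sgb \<alpha> r) (bm (-1) (\<beta> + (\<alpha> - of_nat r)) (\<lambda>y x. d y (e j x w))
        q (p - ?\<sigma> + of_nat j - of_nat r))))"
      unfolding scale_sum_right[symmetric] by (rule sum.cong[OF refl], rule sum.cong[OF refl]) (simp only: 1 lessThan_iff)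
    finally show ?thesis by (simp add: cc_def mult.assoc)
  qed
  show ?thesis
    using B0[OF B(1)] unfolding left right gap_coeff_def cc_def[symmetric]
    by (simp add: scale_right_diff_distrib sum_subtractf scale_sum_right mult_ac)
qed

text \<open>Multiplying the relation by the difference of the two variables raises all its exponents
  by one, by \<open>gap_coeff_Suc\<close>.\<close>

lemma dong_sum_shift:
  fixes N
  defines "\<alpha> \<equiv> form g k + of_int K1" and "\<beta> \<equiv> form h k + of_int K2"
    and "\<kappa> \<equiv> (c g k * (-1) powi K1) * (c h k * (-1) powi K2)"
    and "e \<equiv> \<lambda>j. iprod g a h b (N + int j)"
  assumes w: "w \<in> W s"
  shows "(\<Sum>j<nat (K - N). \<Sum>r\<le>j. sc ((formS g s gchoose (j - r)) * (\<alpha> gchoose r))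
    (gc (\<kappa> * (-1) ^ r * (-1) ^ T) (\<beta> + (\<alpha> - of_nat r) + of_nat T) (e j) d w (p - formS g s + of_nat j - of_nat r) q)) = 0"
proof (induction T arbitrary: p q)
  case 0
  show ?case using dong_sum[OF w, where N = N and p = p and q = q] unfolding \<alpha>_def \<beta>_def \<kappa>_def e_def by simp
next
  case (Suc T)
  have ab: "weakly_commute g a h b" unfolding weakly_commute_def using K by blast
  have e: "gf (g + h) (e j)" for j unfolding e_def by (rule fprod_gf[OF a b ab])
  let ?\<sigma> = "formS g s"
  have "gc (\<kappa> * (-1) ^ r * (-1) ^ Suc T) (\<beta> + (\<alpha> - of_nat r) + of_nat (Suc T)) (e j) d w (p - ?\<sigma> + of_nat j - of_nat r) q =
      gc (\<kappa> * (-1) ^ r * (-1) ^ T) (\<beta> + (\<alpha> - of_nat r) + of_nat T) (e j) d w ((p - 1) - ?\<sigma> + of_nat j - of_nat r) q -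
      gc (\<kappa> * (-1) ^ r * (-1) ^ T) (\<beta> + (\<alpha> - of_nat r) + of_nat T) (e j) d w (p - ?\<sigma> + of_nat j - of_nat r) (q - 1)" for j r
    using gap_coeff_Suc[OF e[of j] d w, where \<kappa> = "\<kappa> * (-1) ^ r * (-1) ^ T" and n = "\<beta> + (\<alpha> - of_nat r) + of_nat T" and p = "p - ?\<sigma> + of_nat j - of_nat r" and q = q]
    by (simp add: algebra_simps)
  then show ?case
    using Suc[of "p - 1" q] Suc[of p "q - 1"]
    by (simp only: scale_right_diff_distrib sum_subtractf diff_zero)
qed

text \<open>Induction on \<open>K - N\<close>, downwards from the products that vanish. In the
  relation of \<open>dong_sum_shift\<close> the term \<open>j = 0\<close> is the wanted gap. A term
  with \<open>j > 0\<close> involves the product at \<open>N + j\<close>, with exponent lowered by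
  \<open>r \<le> j\<close>; as the required bound drops by \<open>j\<close> as well, the induction
  hypothesis removes it.\<close>

lemma dong_bound:
  defines "\<alpha> \<equiv> form g k + of_int K1" and "\<beta> \<equiv> form h k + of_int K2"
    and "\<kappa> \<equiv> (c g k * (-1) powi K1) * (c h k * (-1) powi K2)"
  assumes "M \<ge> K - N" and w: "w \<in> W s"
  shows "gc (\<kappa> * (-1) powi M) (\<beta> + \<alpha> + of_int M) (iprod g a h b N) d w p q = 0"
  using assms(4,5)
proof (induction "nat (K - N)" arbitrary: N M w s p q rule: less_induct)
  case less
  show ?case
  proof (cases "N \<ge> K")
    case True
    have "iprod g a h b N p w = 0" if "w \<in> W s" for w s p by (rule fprod_top[OF a b K True that])
    then have "iprod g a h b N p w = 0" "iprod g a h b N p (d q w) = 0" for p q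
      using less.prems(2) gf_W[OF d] by blast+
    then show ?thesis unfolding gap_coeff_def binom_mult_def by (simp add: gf_0[OF d])
  next
    case False
    then obtain T where T: "M = int T" using less.prems(1) by (metis nonneg_int_cases diff_ge_0_iff_ge linorder_linear order_trans)
    let ?\<sigma> = "formS g s"
    let ?t = "\<lambda>j r. sc ((?\<sigma> gchoose (j - r)) * (\<alpha> gchoose r))
      (gc (\<kappa> * (-1) ^ r * (-1) ^ T) (\<beta> + (\<alpha> - of_nat r) + of_nat T) (iprod g a h b (N + int j)) d w (p + ?\<sigma> - ?\<sigma> + of_nat j - of_nat r) q)"
    have zero: "?t j r = 0" if "j \<noteq> 0" "r \<le> j" for j r
    proof -
      have s: "\<kappa> * (-1) ^ r * (-1) ^ T = \<kappa> * (-1) powi (int T - int r)"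
      proof -
        have "(-1 :: complex) powi (int T - int r) = (-1) powi (int T) * (-1) powi (- int r)"
          by (subst power_int_add[symmetric]) auto
        then show ?thesis unfolding minus_one_powi_minus by (simp add: mult_ac)
      qed
      have "gc (\<kappa> * (-1) powi (int T - int r)) (\<beta> + \<alpha> + of_int (int T - int r)) (iprod g a h b (N + int j)) d w
          (p + ?\<sigma> - ?\<sigma> + of_nat j - of_nat r) q = 0"
        by (rule less.hyps) (use that less.prems False T in auto)
      then show ?thesis unfolding s by (simp add: algebra_simps)
    qed
    have "(\<Sum>j<nat (K - N). \<Sum>r\<le>j. ?t j r) = (\<Sum>j\<in>{0}. \<Sum>r\<le>j. ?t j r)"
      by (rule sum.mono_neutral_right) (use False zero in \<open>auto simp del: of_nat_add of_int_add intro!: sum.neutral\<close>)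
    then have "?t 0 0 = 0"
      using dong_sum_shift[OF less.prems(2), where N = N and T = T and p = "p + ?\<sigma>" and q = q] unfolding \<alpha>_def \<beta>_def \<kappa>_def by simp
    then show ?thesis unfolding T by simp
  qed
qed

end

theorem wcf_fprod:
  assumes a: "gf g a" and b: "gf h b" and d: "gf k d"
    and ab: "weakly_commute g a h b" and ad: "weakly_commute g a k d" and bd: "weakly_commute h b k d"
  shows "weakly_commute (g + h) (fprod g a n h b) k d"
proof (rule fprod_cases[of n g h])
  assume "n - form g h \<notin> \<int>"
  then have "fprod g a n h b = (\<lambda>p w. 0)" by (intro ext) (rule fprod_nonint)
  then show ?thesis using wcf_zero_left[OF d] by simp
next
  fix N
  obtain K where K: "wc_bound g a h b K" using ab unfolding weakly_commute_def by blast
  obtain K1 where K1: "wc_bound g a k d K1" using ad unfolding weakly_commute_def by blast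
  obtain K2 where K2: "wc_bound h b k d K2" using bd unfolding weakly_commute_def by blast
  obtain t :: int where t: "form (g + h) k - (form g k + form h k) = 2 * of_int t"
    using form_add_left[of g h k] unfolding cong2_def by blast
  \<comment> \<open>The three bounds add up, and \<open>2 * t\<close> corrects for the
    representative of \<open>form (g + h) k\<close>.\<close>
  define M where "M = K1 + K2 + (K - N) - 2 * t"
  have n: "form (g + h) k + of_int M = (form h k + of_int K2) + (form g k + of_int K1) + of_int (K - N)"
    using t unfolding M_def by (simp add: algebra_simps)
  have "(-1 :: complex) powi M = (-1) powi (K1 + K2 + (K - N)) * (-1) powi (- (2 * t))"
    unfolding M_def by (subst power_int_add[symmetric]) auto
  also have "(-1 :: complex) powi (- (2 * t)) = 1"
    unfolding minus_one_powi_minus by (simp add: power_int_mult)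
  finally have s: "c (g + h) k * (-1) powi M = (c g k * (-1) powi K1) * (c h k * (-1) powi K2) * (-1) powi (K - N)"
    by (simp add: c_add_left power_int_add)
  show "weakly_commute (g + h) (iprod g a h b N) k d"
    by (rule wcfI[OF fprod_gf[OF a b ab] d, where K = M])
      (unfold commutator_def n s, rule dong_bound[OF a b d K K1 K2 order_refl])
qed

end

section \<open>Weak commutativity of vertex operators\<close>

text \<open>\<open>total_deriv_pow\<close> is the divided power \<open>(\<partial>\<^sub>x + \<partial>\<^sub>y)^l / l!\<close>, and \<open>shift_mult\<close> multiplies a series in \<open>x, y, z\<close> by
  \<open>(z + x)^m (z + y)^m'\<close>.\<close>

definition total_deriv :: "(complex \<Rightarrow> 'w \<Rightarrow> 'w) \<Rightarrow> (complex \<Rightarrow> complex \<Rightarrow> 'w) \<Rightarrow> complex \<Rightarrow> complex \<Rightarrow> 'w::comm_monoid_add"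
  where "total_deriv sc f P Q = sc (P + 1) (f (P + 1) Q) + sc (Q + 1) (f P (Q + 1))"

definition total_deriv_pow :: "(complex \<Rightarrow> 'w \<Rightarrow> 'w) \<Rightarrow> nat \<Rightarrow> (complex \<Rightarrow> complex \<Rightarrow> 'w) \<Rightarrow> complex \<Rightarrow> complex \<Rightarrow> 'w::comm_monoid_add"
  where "total_deriv_pow sc l f P Q =
    (\<Sum>i\<le>l. sc ((P + of_nat i gchoose i) * (Q + of_nat (l - i) gchoose (l - i))) (f (P + of_nat i) (Q + of_nat (l - i))))"

definition shift_mult where
  "shift_mult sc m m' E P Q q = Sum_any (\<lambda>j'::nat. sc (m' gchoose j') (Sum_any (\<lambda>j::nat. sc (m gchoose j)
    (E (P - of_nat j) (Q - of_nat j') (q - m - m' + of_nat j + of_nat j')))))"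
  for sc :: "complex \<Rightarrow> 'w \<Rightarrow> 'w::comm_monoid_add"

text \<open>The arguments of \<open>E\<close> are the exponents of \<open>x\<close>,
  \<open>y\<close> and \<open>z\<close>. The index \<open>i\<close> follows the expansion of a power
  of \<open>x - y\<close>, the indices \<open>j\<close> and \<open>j'\<close> follow those of
  \<open>z + x\<close> and \<open>z + y\<close>. One bound for all of them, uniform in the last
  exponent, lets these multiplications be interchanged.\<close>

definition jointly_truncated :: "(complex \<Rightarrow> complex \<Rightarrow> complex \<Rightarrow> 'w::zero) \<Rightarrow> bool" where
  "jointly_truncated E \<longleftrightarrow> (\<forall>P Q. \<exists>B::nat. \<forall>i j j' q. i \<ge> B \<or> j \<ge> B \<or> j' \<ge> B \<longrightarrow>
    E (P + of_nat i - of_nat j) (Q - of_nat i - of_nat j') q = 0)"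

definition doubly_truncated :: "(complex \<Rightarrow> complex \<Rightarrow> complex \<Rightarrow> 'w::zero) \<Rightarrow> bool" where
  "doubly_truncated E \<longleftrightarrow> (\<forall>P Q. \<exists>B::nat. \<forall>j j' q. j \<ge> B \<or> j' \<ge> B \<longrightarrow>
    E (P - of_nat j) (Q - of_nat j') q = 0)"

lemma gbinomial_lower_index:
  fixes P :: "'a::field_char_0"
  shows "(P + 1) * (P + of_nat (Suc i) gchoose i) = of_nat (Suc i) * (P + of_nat (Suc i) gchoose Suc i)"
  using gbinomial_mult_1[of "P + of_nat (Suc i)" i] by (simp add: algebra_simps)

section \<open>Total derivatives and multiplication by shifted powers\<close>

context complex_vector_space
begin

abbreviation td where "td \<equiv> total_deriv sc"
abbreviation tdp where "tdp \<equiv> total_deriv_pow sc"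
abbreviation sm where "sm \<equiv> shift_mult sc"

text \<open>A term with \<open>i\<close> derivatives in one variable and \<open>Suc l - i\<close> in
  the other receives these two numbers as weights from the two partial derivatives, and they add up
  to \<open>Suc l\<close>.\<close>

lemma total_deriv_pow_Suc: "td (tdp l f) P Q = sc (of_nat (Suc l)) (tdp (Suc l) f P Q)"
proof -
  let ?c = "\<lambda>i. (P + of_nat i gchoose i) * (Q + of_nat (Suc l - i) gchoose (Suc l - i))"
  let ?f = "\<lambda>i. f (P + of_nat i) (Q + of_nat (Suc l - i))"
  have 1: "sc (P + 1) (tdp l f (P + 1) Q) = (\<Sum>i\<le>Suc l. sc (of_nat i * ?c i) (?f i))"
  proof -
    have "sc (P + 1) (tdp l f (P + 1) Q) = (\<Sum>i\<le>l. sc (of_nat (Suc i) * ?c (Suc i)) (?f (Suc i)))"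
      unfolding total_deriv_pow_def scale_sum_right
    proof (rule sum.cong[OF refl])
      fix i
      have "(P + 1) * ((P + 1 + of_nat i gchoose i) * (Q + of_nat (l - i) gchoose (l - i))) = of_nat (Suc i) * ?c (Suc i)"
        using gbinomial_lower_index[of P i] by (simp add: add_ac)
      moreover have "f (P + 1 + of_nat i) (Q + of_nat (l - i)) = ?f (Suc i)" by (simp add: add_ac)
      ultimately show "sc (P + 1) (sc ((P + 1 + of_nat i gchoose i) * (Q + of_nat (l - i) gchoose (l - i)))
          (f (P + 1 + of_nat i) (Q + of_nat (l - i)))) = sc (of_nat (Suc i) * ?c (Suc i)) (?f (Suc i))"
        by (simp only: scale_scale)
    qed
    then show ?thesis unfolding sum.atMost_Suc_shift by simp
  qed
  have 2: "sc (Q + 1) (tdp l f P (Q + 1)) = (\<Sum>i\<le>Suc l. sc (of_nat (Suc l - i) * ?c i) (?f i))"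
  proof -
    have "sc (Q + 1) (tdp l f P (Q + 1)) = (\<Sum>i\<le>l. sc (of_nat (Suc l - i) * ?c i) (?f i))"
      unfolding total_deriv_pow_def scale_sum_right
    proof (rule sum.cong[OF refl])
      fix i assume "i \<in> {..l}"
      then have l: "Suc l - i = Suc (l - i)" by auto
      have "(Q + 1) * ((P + of_nat i gchoose i) * (Q + 1 + of_nat (l - i) gchoose (l - i))) = of_nat (Suc l - i) * ?c i"
        using gbinomial_lower_index[of Q "l - i"] unfolding l by (simp add: add_ac)
      moreover have "f (P + of_nat i) (Q + 1 + of_nat (l - i)) = ?f i" unfolding l by (simp add: add_ac)
      ultimately show "sc (Q + 1) (sc ((P + of_nat i gchoose i) * (Q + 1 + of_nat (l - i) gchoose (l - i)))
          (f (P + of_nat i) (Q + 1 + of_nat (l - i)))) = sc (of_nat (Suc l - i) * ?c i) (?f i)"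
        by (simp only: scale_scale)
    qed
    then show ?thesis by simp
  qed
  have "sc (of_nat i * ?c i) (?f i) + sc (of_nat (Suc l - i) * ?c i) (?f i) = sc (of_nat (Suc l)) (sc (?c i) (?f i))"
    if "i \<le> Suc l" for i
  proof -
    have "of_nat i * ?c i + of_nat (Suc l - i) * ?c i = of_nat (Suc l) * ?c i"
      unfolding distrib_right[symmetric] of_nat_add[symmetric] using that by simp
    then show ?thesis by (simp only: scale_scale scale_left_distrib[symmetric])
  qed
  then have "(\<Sum>i\<le>Suc l. sc (of_nat i * ?c i) (?f i)) + (\<Sum>i\<le>Suc l. sc (of_nat (Suc l - i) * ?c i) (?f i)) =
      (\<Sum>i\<le>Suc l. sc (of_nat (Suc l)) (sc (?c i) (?f i)))"
    unfolding sum.distrib[symmetric] by (intro sum.cong) auto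
  then show ?thesis unfolding total_deriv_def 1 2 by (simp only: total_deriv_pow_def scale_sum_right)
qed

text \<open>The derivation \<open>\<partial>\<^sub>x + \<partial>\<^sub>y\<close> annihilates
  \<open>x - y\<close>, hence all its powers.\<close>

lemma total_deriv_binom_mult:
  assumes "diag_truncated f"
  shows "bm (-1) \<alpha> (td f) P Q = td (bm (-1) \<alpha> f) P Q"
proof -
  obtain B1 where B1: "\<And>r. r \<ge> B1 \<Longrightarrow> f (P - \<alpha> + 1 + of_nat r) (Q - of_nat r) = 0"
    using diag_truncatedE[OF assms] by metis
  obtain B2 where B2: "\<And>r. r \<ge> B2 \<Longrightarrow> f (P - \<alpha> + of_nat r) (Q + 1 - of_nat r) = 0"
    using diag_truncatedE[OF assms] by metis
  \<comment> \<open>One place beyond both bounds, so that the index shift between \<open>?k\<close>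
    and \<open>?h\<close> drops only a vanishing term.\<close>
  let ?B = "Suc (max B1 B2)"
  let ?h = "\<lambda>r. f (P - \<alpha> + 1 + of_nat r) (Q - of_nat r)"
  let ?k = "\<lambda>r. f (P - \<alpha> + of_nat r) (Q + 1 - of_nat r)"
  have hk: "?k (Suc r) = ?h r" for r by (simp add: algebra_simps)
  have hB: "?h (max B1 B2) = 0" by (rule B1) simp
  have "bm (-1) \<alpha> (td f) P Q = (\<Sum>r<?B. sc (sgb \<alpha> r) (sc (P - \<alpha> + of_nat r + 1) (?h r) + sc (Q - of_nat r + 1) (?k r)))"
    unfolding binom_mult_def total_deriv_def
    by (subst Sum_any_bounded[of ?B]) (use B1 B2 in \<open>auto simp: algebra_simps simp del: sum.lessThan_Suc\<close>)
  moreover have "bm (-1) \<alpha> f (P + 1) Q = (\<Sum>r<?B. sc (sgb \<alpha> r) (?h r))"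
    unfolding binom_mult_def
    by (subst Sum_any_bounded[of ?B]) (use B1 in \<open>auto simp: algebra_simps simp del: sum.lessThan_Suc\<close>)
  moreover have "bm (-1) \<alpha> f P (Q + 1) = (\<Sum>r<?B. sc (sgb \<alpha> r) (?k r))"
    unfolding binom_mult_def
    by (subst Sum_any_bounded[of ?B]) (use B2 in \<open>auto simp: algebra_simps simp del: sum.lessThan_Suc\<close>)
  moreover have "(\<Sum>r<?B. sc (sgb \<alpha> r) (sc (P - \<alpha> + of_nat r + 1) (?h r) + sc (Q - of_nat r + 1) (?k r))) -
      (\<Sum>r<?B. sc (sgb \<alpha> r * (P + 1)) (?h r)) - (\<Sum>r<?B. sc (sgb \<alpha> r * (Q + 1)) (?k r)) = 0"
  proof -
    have "(\<Sum>r<?B. sc (sgb \<alpha> r) (sc (P - \<alpha> + of_nat r + 1) (?h r) + sc (Q - of_nat r + 1) (?k r))) -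
        (\<Sum>r<?B. sc (sgb \<alpha> r * (P + 1)) (?h r)) - (\<Sum>r<?B. sc (sgb \<alpha> r * (Q + 1)) (?k r)) =
        (\<Sum>r<?B. sc (sgb \<alpha> r * (of_nat r - \<alpha>)) (?h r)) - (\<Sum>r<?B. sc (sgb \<alpha> r * of_nat r) (?k r))"
      unfolding sum_subtractf[symmetric]
    proof (rule sum.cong[OF refl])
      fix r :: nat
      have e1: "sgb \<alpha> r * (P - \<alpha> + of_nat r + 1) = sgb \<alpha> r * (P + 1) + sgb \<alpha> r * (of_nat r - \<alpha>)"
        and e2: "sgb \<alpha> r * (Q - of_nat r + 1) = sgb \<alpha> r * (Q + 1) - sgb \<alpha> r * of_nat r"
        by (simp_all add: algebra_simps)
      show "sc (sgb \<alpha> r) (sc (P - \<alpha> + of_nat r + 1) (?h r) + sc (Q - of_nat r + 1) (?k r)) -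
          sc (sgb \<alpha> r * (P + 1)) (?h r) - sc (sgb \<alpha> r * (Q + 1)) (?k r) =
          sc (sgb \<alpha> r * (of_nat r - \<alpha>)) (?h r) - sc (sgb \<alpha> r * of_nat r) (?k r)"
        unfolding scale_right_distrib[of "sgb \<alpha> r"] scale_scale e1 e2
        unfolding scale_left_distrib[of "sgb \<alpha> r * (P + 1)"] scale_left_diff_distrib[of "sgb \<alpha> r * (Q + 1)"]
        by simp
    qed
    \<comment> \<open>What is left comes from differentiating the power of \<open>x - y\<close> in
      either variable; the two parts cancel after this shift, by absorption in the binomial.\<close>
    also have "(\<Sum>r<?B. sc (sgb \<alpha> r * of_nat r) (?k r)) =
        (\<Sum>r<max B1 B2. sc (sgb \<alpha> (Suc r) * of_nat (Suc r)) (?h r))"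
      unfolding sum.lessThan_Suc_shift hk by simp
    also have "\<dots> = (\<Sum>r<max B1 B2. sc (sgb \<alpha> r * (of_nat r - \<alpha>)) (?h r))"
    proof (rule sum.cong[OF refl])
      fix r
      have "(\<alpha> gchoose Suc r) * of_nat (Suc r) = (\<alpha> - of_nat r) * (\<alpha> gchoose r)"
        using gbinomial_mult_1[of \<alpha> r] by (simp add: algebra_simps)
      moreover have "sgb \<alpha> (Suc r) * of_nat (Suc r) = - ((-1) ^ r) * ((\<alpha> gchoose Suc r) * of_nat (Suc r))"
        by (simp del: of_nat_Suc)
      ultimately have "sgb \<alpha> (Suc r) * of_nat (Suc r) = - ((-1) ^ r) * ((\<alpha> - of_nat r) * (\<alpha> gchoose r))"
        by (simp only:)
      also have "\<dots> = sgb \<alpha> r * (of_nat r - \<alpha>)"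
      proof -
        have "- u * ((\<alpha> - v) * x) = x * u * (v - \<alpha>)" for u v x :: complex by (simp add: algebra_simps)
        then show ?thesis .
      qed
      finally show "sc (sgb \<alpha> (Suc r) * of_nat (Suc r)) (?h r) = sc (sgb \<alpha> r * (of_nat r - \<alpha>)) (?h r)"
        by (simp only:)
    qed
    finally show ?thesis using hB by simp
  qed
  ultimately show ?thesis unfolding total_deriv_def
    by (simp add: scale_sum_right mult.commute diff_diff_eq del: sum.lessThan_Suc)
qed

lemma diag_truncated_total_deriv_pow:
  assumes "diag_truncated f" shows "diag_truncated (tdp l f)"
  unfolding diag_truncated_def
proof (intro allI)
  fix P Q
  have "\<exists>B::nat. \<forall>r\<ge>B. f (P + of_nat i + of_nat r) (Q + of_nat (l - i) - of_nat r) = 0" for i :: nat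
    using assms unfolding diag_truncated_def by blast
  then obtain B where B: "\<And>i r. r \<ge> B i \<Longrightarrow> f (P + of_nat i + of_nat r) (Q + of_nat (l - i) - of_nat r) = 0"
    by metis
  have "tdp l f (P + of_nat r) (Q - of_nat r) = 0" if "r \<ge> Max (B ` {..l})" for r
    unfolding total_deriv_pow_def
  proof (rule sum.neutral, rule ballI)
    fix i assume "i \<in> {..l}"
    then have "B i \<le> r" using that by simp
    from B[OF this] show "sc ((P + of_nat r + of_nat i gchoose i) * (Q - of_nat r + of_nat (l - i) gchoose (l - i)))
        (f (P + of_nat r + of_nat i) (Q - of_nat r + of_nat (l - i))) = 0"
      by (simp add: algebra_simps)
  qed
  then show "\<exists>B::nat. \<forall>r\<ge>B. tdp l f (P + of_nat r) (Q - of_nat r) = 0" by blast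
qed

lemma total_deriv_pow_binom_mult:
  assumes "diag_truncated f"
  shows "bm (-1) \<alpha> (tdp l f) P Q = tdp l (bm (-1) \<alpha> f) P Q"
proof (induction l arbitrary: P Q)
  case 0
  then show ?case unfolding total_deriv_pow_def binom_mult_def by simp
next
  case (Suc l)
  have pow: "tdp (Suc l) f = (\<lambda>P Q. sc (inverse (of_nat (Suc l))) (td (tdp l f) P Q))" for f
    unfolding total_deriv_pow_Suc by (simp del: of_nat_Suc)
  have "bm (-1) \<alpha> (tdp (Suc l) f) P Q = sc (inverse (of_nat (Suc l))) (bm (-1) \<alpha> (td (tdp l f)) P Q)"
    unfolding pow binom_mult_def by (simp add: scale_Sum_any mult.commute del: of_nat_Suc)
  also have "bm (-1) \<alpha> (td (tdp l f)) P Q = td (bm (-1) \<alpha> (tdp l f)) P Q"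
    by (rule total_deriv_binom_mult[OF diag_truncated_total_deriv_pow[OF assms]])
  also have "\<dots> = td (tdp l (bm (-1) \<alpha> f)) P Q"
    unfolding total_deriv_def Suc.IH ..
  finally show ?case unfolding pow .
qed

lemma total_deriv_pow_flip: "tdp l (\<lambda>P Q. f Q P) P Q = tdp l f Q P"
  unfolding total_deriv_pow_def
  by (rule sum.reindex_bij_witness[of _ "\<lambda>i. l - i" "\<lambda>i. l - i"]) (auto simp: mult.commute)

lemma double_Sum_any_bounded:
  fixes F :: "nat \<Rightarrow> nat \<Rightarrow> 'w"
  assumes "\<And>i j. i \<ge> B \<or> j \<ge> B \<Longrightarrow> F i j = 0"
  shows "Sum_any (\<lambda>i. sc (x i) (Sum_any (\<lambda>j. sc (y j) (F i j)))) = (\<Sum>i<B. \<Sum>j<B. sc (x i * y j) (F i j))"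
proof -
  have "Sum_any (\<lambda>j. sc (y j) (F i j)) = (\<Sum>j<B. sc (y j) (F i j))" for i
    by (rule Sum_any_bounded) (simp add: assms)
  then show ?thesis
    by (subst Sum_any_bounded[of B]) (auto simp: assms scale_sum_right)
qed

lemma shift_mult_bounded:
  assumes "\<And>j j' q. j \<ge> B \<or> j' \<ge> B \<Longrightarrow> E (P - of_nat j) (Q - of_nat j') q = 0"
  shows "sm m m' E P Q q = (\<Sum>j'<B. \<Sum>j<B. sc ((m' gchoose j') * (m gchoose j))
    (E (P - of_nat j) (Q - of_nat j') (q - m - m' + of_nat j + of_nat j')))"
  unfolding shift_mult_def by (rule double_Sum_any_bounded) (use assms in blast)

lemma jointly_truncated_binom_mult:
  assumes "jointly_truncated E"
  shows "doubly_truncated (\<lambda>P Q q. bm (-1) \<alpha> (\<lambda>P Q. E P Q q) P Q)"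
  unfolding doubly_truncated_def
proof (intro allI)
  fix P Q
  obtain B where B: "\<And>i j j' q. i \<ge> B \<or> j \<ge> B \<or> j' \<ge> B \<Longrightarrow>
    E (P - \<alpha> + of_nat i - of_nat j) (Q - of_nat i - of_nat j') q = 0"
    using assms unfolding jointly_truncated_def by blast
  have "bm (-1) \<alpha> (\<lambda>P Q. E P Q q) (P - of_nat j) (Q - of_nat j') = 0" if "j \<ge> B \<or> j' \<ge> B" for j j' q
    unfolding binom_mult_def
  proof (rule Sum_any_eq_0)
    fix i
    show "sc (sgb \<alpha> i) (E (P - of_nat j - \<alpha> + of_nat i) (Q - of_nat j' - of_nat i) q) = 0"
      using B[of i j j' q] that by (simp add: algebra_simps)
  qed
  then show "\<exists>B. \<forall>j j' q. B \<le> j \<or> B \<le> j' \<longrightarrow> bm (-1) \<alpha> (\<lambda>P Q. E P Q q) (P - of_nat j) (Q - of_nat j') = 0"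
    by blast
qed

text \<open>Both operations multiply by a scalar series; joint truncation makes the triple sum
  finite, so the order of summation is free.\<close>

lemma shift_mult_binom_mult:
  assumes "jointly_truncated E"
  shows "sm m m' (\<lambda>P Q q. bm (-1) \<alpha> (\<lambda>P Q. E P Q q) P Q) P Q q = bm (-1) \<alpha> (\<lambda>P Q. sm m m' E P Q q) P Q"
proof -
  obtain B where B: "\<And>i j j' q. i \<ge> B \<or> j \<ge> B \<or> j' \<ge> B \<Longrightarrow>
    E (P - \<alpha> + of_nat i - of_nat j) (Q - of_nat i - of_nat j') q = 0"
    using assms unfolding jointly_truncated_def by blast
  define F where "F i j j' = E (P - \<alpha> + of_nat i - of_nat j) (Q - of_nat i - of_nat j') (q - m - m' + of_nat j + of_nat j')"
    for i j j' :: nat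
  have 1: "bm (-1) \<alpha> (\<lambda>P Q. E P Q q') (P - of_nat j) (Q - of_nat j') =
      (\<Sum>i<B. sc (sgb \<alpha> i) (E (P - \<alpha> + of_nat i - of_nat j) (Q - of_nat i - of_nat j') q'))" for j j' q'
  proof -
    have "bm (-1) \<alpha> (\<lambda>P Q. E P Q q') (P - of_nat j) (Q - of_nat j') =
        Sum_any (\<lambda>i::nat. sc (sgb \<alpha> i) (E (P - \<alpha> + of_nat i - of_nat j) (Q - of_nat i - of_nat j') q'))"
      unfolding binom_mult_def by (simp add: algebra_simps)
    then show ?thesis by (simp add: Sum_any_bounded[of B] B)
  qed
  have "sm m m' (\<lambda>P Q q. bm (-1) \<alpha> (\<lambda>P Q. E P Q q) P Q) P Q q =
      (\<Sum>j'<B. \<Sum>j<B. sc ((m' gchoose j') * (m gchoose j)) (\<Sum>i<B. sc (sgb \<alpha> i) (F i j j')))"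
    unfolding F_def by (subst shift_mult_bounded[of B]) (auto simp: 1 B intro!: sum.neutral)
  also have "\<dots> = (\<Sum>j'<B. \<Sum>j<B. \<Sum>i<B. sc (sgb \<alpha> i * ((m' gchoose j') * (m gchoose j))) (F i j j'))"
    by (simp add: scale_sum_right mult_ac)
  also have "\<dots> = (\<Sum>i<B. \<Sum>j'<B. \<Sum>j<B. sc (sgb \<alpha> i * ((m' gchoose j') * (m gchoose j))) (F i j j'))"
    by (subst (2) sum.swap, subst sum.swap) (rule refl)
  also have "\<dots> = (\<Sum>i<B. sc (sgb \<alpha> i) (\<Sum>j'<B. \<Sum>j<B. sc ((m' gchoose j') * (m gchoose j)) (F i j j')))"
    by (simp add: scale_sum_right mult_ac)
  also have "\<dots> = (\<Sum>i<B. sc (sgb \<alpha> i) (sm m m' E (P - \<alpha> + of_nat i) (Q - of_nat i) q))"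
    unfolding F_def by (subst shift_mult_bounded[of B]) (use B in auto)
  also have "\<dots> = bm (-1) \<alpha> (\<lambda>P Q. sm m m' E P Q q) P Q"
    unfolding binom_mult_def
  proof (rule Sum_any_bounded[symmetric])
    fix i assume "B \<le> i"
    then have "sm m m' E (P - \<alpha> + of_nat i) (Q - of_nat i) q = 0"
      by (subst shift_mult_bounded[of B]) (use B in auto)
    then show "sc (sgb \<alpha> i) (sm m m' E (P - \<alpha> + of_nat i) (Q - of_nat i) q) = 0" by simp
  qed
  finally show ?thesis .
qed

lemma shift_mult_swap:
  assumes "doubly_truncated E"
  shows "sm m' m (\<lambda>Q P q. E P Q q) Q P q = sm m m' E P Q q"
proof -
  obtain B where B: "\<And>j j' q. j \<ge> B \<or> j' \<ge> B \<Longrightarrow> E (P - of_nat j) (Q - of_nat j') q = 0"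
    using assms unfolding doubly_truncated_def by blast
  have q: "q - m' - m + x + y = q - m - m' + y + x" for x y by simp
  have 1: "sm m m' E P Q q = (\<Sum>j'<B. \<Sum>j<B. sc ((m' gchoose j') * (m gchoose j))
    (E (P - of_nat j) (Q - of_nat j') (q - m - m' + of_nat j + of_nat j')))"
    by (rule shift_mult_bounded) (rule B)
  have 2: "sm m' m (\<lambda>Q P q. E P Q q) Q P q = (\<Sum>j<B. \<Sum>j'<B. sc ((m gchoose j) * (m' gchoose j'))
    (E (P - of_nat j) (Q - of_nat j') (q - m' - m + of_nat j' + of_nat j)))"
    by (rule shift_mult_bounded) (rule B, blast)
  show ?thesis unfolding 1 2 q by (rule trans[OF sum.swap]) (simp only: mult.commute)
qed

lemma shift_mult_diff:
  assumes "doubly_truncated E" "doubly_truncated E'"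
  shows "sm m m' (\<lambda>P Q q. E P Q q - sc k (E' P Q q)) P Q q = sm m m' E P Q q - sc k (sm m m' E' P Q q)"
proof -
  obtain B where B: "\<And>j j' q. j \<ge> B \<or> j' \<ge> B \<Longrightarrow> E (P - of_nat j) (Q - of_nat j') q = 0"
    using assms(1) unfolding doubly_truncated_def by blast
  obtain B' where B': "\<And>j j' q. j \<ge> B' \<or> j' \<ge> B' \<Longrightarrow> E' (P - of_nat j) (Q - of_nat j') q = 0"
    using assms(2) unfolding doubly_truncated_def by blast
  let ?B = "max B B'"
  have 1: "sm m m' E P Q q = (\<Sum>j'<?B. \<Sum>j<?B. sc ((m' gchoose j') * (m gchoose j))
    (E (P - of_nat j) (Q - of_nat j') (q - m - m' + of_nat j + of_nat j')))"
    by (rule shift_mult_bounded) (rule B, auto)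
  have 2: "sm m m' E' P Q q = (\<Sum>j'<?B. \<Sum>j<?B. sc ((m' gchoose j') * (m gchoose j))
    (E' (P - of_nat j) (Q - of_nat j') (q - m - m' + of_nat j + of_nat j')))"
    by (rule shift_mult_bounded) (rule B', auto)
  have 3: "sm m m' (\<lambda>P Q q. E P Q q - sc k (E' P Q q)) P Q q = (\<Sum>j'<?B. \<Sum>j<?B. sc ((m' gchoose j') * (m gchoose j))
    (E (P - of_nat j) (Q - of_nat j') (q - m - m' + of_nat j + of_nat j') -
      sc k (E' (P - of_nat j) (Q - of_nat j') (q - m - m' + of_nat j + of_nat j'))))"
    by (rule shift_mult_bounded) (subst B, auto simp: B')
  show ?thesis unfolding 1 2 3
    by (simp add: scale_right_diff_distrib sum_subtractf scale_sum_right mult.commute)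
qed

text \<open>The factors \<open>(z + x)^m\<close> and \<open>(z + y)^m'\<close> are cancelled one at
  a time, each as a binomial power in \<open>z\<close> and one other variable; \<open>F\<close> is
  the series multiplied by the first of them.\<close>

lemma shift_mult_cancel:
  assumes D: "doubly_truncated D" and 0: "\<And>P Q q. sm m m' D P Q q = 0"
  shows "D P Q q = 0"
proof -
  define F where "F P Q q = bm 1 m (\<lambda>q P. D P Q q) q P" for P Q q
  have F: "F P Q q = 0" for P Q q
  proof (rule binom_mult_eq_0_iff[of "\<lambda>q Q. F P Q q" 1 m'])
    show "diag_truncated (\<lambda>q Q. F P Q q)"
      unfolding diag_truncated_def
    proof (intro allI)
      fix q Q
      obtain B where B: "\<And>j j' q. j \<ge> B \<or> j' \<ge> B \<Longrightarrow> D (P - of_nat j) (Q - of_nat j') q = 0"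
        using D unfolding doubly_truncated_def by blast
      then show "\<exists>B::nat. \<forall>i\<ge>B. F P (Q - of_nat i) (q + of_nat i) = 0"
        unfolding F_def binom_mult_def by (intro exI[of _ B]) simp
    qed
    fix q Q
    show "bm 1 m' (\<lambda>q Q. F P Q q) q Q = 0"
      using 0[of P Q q] unfolding F_def binom_mult_def shift_mult_def by (simp add: algebra_simps)
  qed
  show ?thesis
  proof (rule binom_mult_eq_0_iff[of "\<lambda>q P. D P Q q" 1 m])
    show "diag_truncated (\<lambda>q P. D P Q q)"
      unfolding diag_truncated_def
    proof (intro allI)
      fix q P
      obtain B where B: "\<And>j j' q. j \<ge> B \<or> j' \<ge> B \<Longrightarrow> D (P - of_nat j) (Q - of_nat j') q = 0"
        using D unfolding doubly_truncated_def by blast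
      then show "\<exists>B::nat. \<forall>i\<ge>B. D (P - of_nat i) Q (q + of_nat i) = 0"
        by (intro exI[of _ B]) (metis diff_zero of_nat_0)
    qed
    fix q P show "bm 1 m (\<lambda>q P. D P Q q) q P = 0" using F unfolding F_def .
  qed
qed

end

section \<open>Iterated vertex operators\<close>

context field_setting
begin

text \<open>The coefficient of \<open>x^P\<close> in \<open>Y(a, x) b\<close>.\<close>

abbreviation yp where "yp g a h b P \<equiv> fprod g a (- P - 1) h b"

lemma yp_top:
  assumes "gf g a" "gf h b" "weakly_commute g a h b"
  obtains B :: nat where "\<And>j s w p. j \<ge> B \<Longrightarrow> w \<in> W s \<Longrightarrow> yp g a h b (P - of_nat j) p w = 0"
proof (cases "- P - 1 - form g h \<in> \<int>")
  case True
  obtain K where K: "wc_bound g a h b K" using assms(3) unfolding weakly_commute_def by blast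
  obtain N where N0: "- P - 1 - form g h = of_int N" using True by (auto elim: Ints_cases)
  have N: "- (P - of_nat j) - 1 = form g h + of_int (N + int j)" for j
  proof -
    have "- (P - of_nat j) - 1 = form g h + ((- P - 1 - form g h) + of_nat j)" by simp
    then show ?thesis unfolding N0 by simp
  qed
  show ?thesis
    by (rule that[of "nat (K - N)"]) (unfold N, rule fprod_top[OF assms(1,2) K], auto)
next
  case False
  have "- (P - of_nat j) - 1 - form g h \<notin> \<int>" for j
  proof
    assume "- (P - of_nat j) - 1 - form g h \<in> \<int>"
    then have "- (P - of_nat j) - 1 - form g h - of_nat j \<in> \<int>" by (rule Ints_diff[OF _ Ints_of_nat])
    moreover have "- (P - of_nat j) - 1 - form g h - of_nat j = - P - 1 - form g h" by simp
    ultimately show False using False by (simp only:)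
  qed
  then show ?thesis by (intro that[of 0]) (simp add: fprod_nonint)
qed

lemma fprod_zero_right:
  assumes "gf g a" "gf h b" "w \<in> W s" and 0: "\<And>s w q. w \<in> W s \<Longrightarrow> b q w = 0"
  shows "fprod g a n h b p w = 0"
proof (rule fprod_cases[of n g h])
  fix N
  have "commutator g a h b M w x y = 0" for M x y
    unfolding commutator_def gap_coeff_def binom_mult_def using 0[OF assms(3)] 0[OF gf_W[OF assms(1,3)]] gf_0[OF assms(1)]
    by simp
  then show "iprod g a h b N p w = 0" unfolding fprod_int[OF assms(1-3)] by simp
qed (rule fprod_nonint)

text \<open>For \<open>m\<close> so large that \<open>z^m a(z) w\<close> has only nonnegative powers, the Jacobi identity becomes
  \<open>(z + x)^m Y(a,x)d(z)w = (x + z)^m a(x + z)d(z)w\<close>.\<close>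

lemma weak_associativity:
  assumes a: "gf g a" and d: "gf k d" and ad: "weakly_commute g a k d" and w: "w \<in> W s"
    and m: "formS g s - m \<in> \<int>" and low: "\<And>i::nat. a (- 1 - m - of_nat i) w = 0"
  shows "Sum_any (\<lambda>j::nat. sc (m gchoose j) (yp g a k d (P - of_nat j) (q - m + of_nat j) w)) =
    Sum_any (\<lambda>i::nat. sc (P + of_nat i gchoose i) (a (P - m + of_nat i) (d (q - of_nat i) w)))"
proof (cases "- P - 1 - form g k \<in> \<int>")
  case True
  obtain K where K: "wc_bound g a k d K" using ad unfolding weakly_commute_def by blast
  obtain N where N: "- P - 1 - form g k = of_int N" using True by (auto elim: Ints_cases)
  have n: "- (P - of_nat j) - 1 = form g k + of_int (N + int j)" for j
  proof -
    have "- (P - of_nat j) - 1 = form g k + ((- P - 1 - form g k) + of_nat j)" by simp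
    then show ?thesis unfolding N by simp
  qed
  have n0: "form g k + of_int N = - P - 1" using n[of 0] by simp
  have "formS g s - m - 1 \<in> \<int>" by (rule Ints_diff[OF m Ints_1])
  then have p: "formS g s + (- 1 - m) \<in> \<int>" by (simp add: algebra_simps)
  have "Sum_any (\<lambda>j::nat. sc (m gchoose j) (yp g a k d (P - of_nat j) (q - m + of_nat j) w)) = commutator g a k d N w (- 1 - m) q"
    unfolding jacobi_identity[OF a d K w p] n by (simp add: algebra_simps)
  \<comment> \<open>At the first exponent \<open>- 1 - m\<close> the second term of the gap uses
    only coefficients of \<open>a\<close> that kill \<open>w\<close>.\<close>
  also have "\<dots> = bm (-1) (- P - 1) (\<lambda>p q. a p (d q w)) (- 1 - m) q"
    unfolding commutator_def gap_coeff_def n0 binom_mult_def low gf_0[OF d] by simp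
  also have "\<dots> = Sum_any (\<lambda>i::nat. sc (P + of_nat i gchoose i) (a (P - m + of_nat i) (d (q - of_nat i) w)))"
  proof -
    have "sgb (- P - 1) i = P + of_nat i gchoose i" for i
      using gbinomial_negated_upper[of "P + of_nat i" i] by simp
    then show ?thesis unfolding binom_mult_def by (simp add: algebra_simps)
  qed
  finally show ?thesis .
next
  case False
  have 1: "- (P - of_nat j) - 1 - form g k \<notin> \<int>" for j
  proof
    assume "- (P - of_nat j) - 1 - form g k \<in> \<int>"
    then have "- (P - of_nat j) - 1 - form g k - of_nat j \<in> \<int>" by (rule Ints_diff[OF _ Ints_of_nat])
    moreover have "- (P - of_nat j) - 1 - form g k - of_nat j = - P - 1 - form g k" by simp
    ultimately show False using False by (simp only:)
  qed
  have 2: "a (P - m + of_nat i) (d (q - of_nat i) w) = 0" for i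
  proof (rule ccontr)
    assume "\<not> ?thesis"
    then have "formS g (act k s) + (P - m + of_nat i) \<in> \<int>"
      using gf_Ints[OF a gf_W[OF d w]] by blast
    then have "formS g (act k s) + (P - m + of_nat i) - (formS g (act k s) - (form g k + formS g s))
        - (formS g s - m) - of_nat i \<in> \<int>"
      by (rule Ints_diff[OF Ints_diff[OF Ints_diff[OF _ cong2_Ints[OF formS_act]] m] Ints_of_nat])
    then have "P + form g k \<in> \<int>" by (simp add: algebra_simps)
    then have "- 1 - (P + form g k) \<in> \<int>" by (intro Ints_diff Ints_minus Ints_1)
    moreover have "- 1 - (P + form g k) = - P - 1 - form g k" by simp
    ultimately show False using False by (simp only:)
  qed
  show ?thesis unfolding 2 fprod_nonint[OF 1] by simp
qed

lemma large_exponent: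
  assumes "gf g a" "w \<in> W s"
  obtains m where "formS g s - m \<in> \<int>" "\<And>i::nat. a (- 1 - m - of_nat i) w = 0"
proof -
  obtain R where R: "\<And>p. Re p < R \<Longrightarrow> a p w = 0" using gf_lower[OF assms] by blast
  \<comment> \<open>The absolute values give \<open>Re m \<ge> \<bar>R\<bar>\<close>, so all
    exponents \<open>- 1 - m - of_nat i\<close> have real part below \<open>R\<close>.\<close>
  define m where "m = formS g s + of_nat (nat \<lceil>\<bar>R\<bar> + \<bar>Re (formS g s)\<bar>\<rceil>)"
  have "Re (- 1 - m - of_nat i) < R" for i :: nat
    unfolding m_def by simp linarith
  then show ?thesis by (intro that[of m] R) (simp_all add: m_def)
qed

context
  fixes g h k a b e
  assumes a: "gf g a" and b: "gf h b" and e: "gf k e"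
    and ab: "weakly_commute g a h b" and ae: "weakly_commute g a k e" and be: "weakly_commute h b k e"
begin

lemma gf_yp: "gf (h + k) (yp h b k e Q)"
  by (rule fprod_gf[OF b e be])

lemma wcf_yp: "weakly_commute g a (h + k) (yp h b k e Q)"
  by (rule wcf_sym, rule wcf_fprod[OF b e a be wcf_sym[OF ab] wcf_sym[OF ae]])

text \<open>The inner coefficient vanishes once \<open>i + j' \<ge> B1\<close>. This leaves finitely
  many pairs of inner exponent and \<open>i\<close>, each with its own truncation of the outer
  product.\<close>

lemma yp_yp_truncated:
  assumes w: "w \<in> W s"
  shows "jointly_truncated (\<lambda>P Q q. yp g a (h + k) (yp h b k e Q) P q w)"
  unfolding jointly_truncated_def
proof (intro allI)
  fix P Q
  obtain B1 where B1: "\<And>j s w p. j \<ge> B1 \<Longrightarrow> w \<in> W s \<Longrightarrow> yp h b k e (Q - of_nat j) p w = 0"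
    using yp_top[OF b e be, of Q] by blast
  define R where "R l i B \<longleftrightarrow> (\<forall>j\<ge>B. \<forall>p.
    yp g a (h + k) (yp h b k e (Q - of_nat l)) (P + of_nat i - of_nat j) p w = 0)" for l i B :: nat
  have "\<exists>B. R l i B" for l i
    unfolding R_def using yp_top[OF a gf_yp wcf_yp, of "P + of_nat i" "Q - of_nat l"] w by metis
  then obtain B2 where "\<And>l i. R l i (B2 l i)" by metis
  then have B2: "yp g a (h + k) (yp h b k e (Q - of_nat l)) (P + of_nat i - of_nat j) p w = 0"
    if "j \<ge> B2 l i" for l i j p
    using that unfolding R_def by blast
  define B where "B = Max (insert B1 ((\<lambda>(l, i). B2 l i) ` ({..<B1} \<times> {..<B1})))"
  have B: "B1 \<le> B" "\<And>l i. l < B1 \<Longrightarrow> i < B1 \<Longrightarrow> B2 l i \<le> B"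
  proof -
    show "B1 \<le> B" unfolding B_def by (rule Max_ge) auto
    show "B2 l i \<le> B" if "l < B1" "i < B1" for l i
      unfolding B_def by (rule Max_ge) (use that in \<open>force+\<close>)
  qed
  have "yp g a (h + k) (yp h b k e (Q - of_nat i - of_nat j')) (P + of_nat i - of_nat j) q w = 0"
    if "i \<ge> B \<or> j \<ge> B \<or> j' \<ge> B" for i j j' q
  proof (cases "i + j' \<ge> B1")
    case True
    have "yp h b k e (Q - of_nat i - of_nat j') p w = 0" if "w \<in> W s" for s w p
      using B1[OF True that] by (simp add: diff_diff_eq)
    then show ?thesis by (rule fprod_zero_right[OF a gf_yp w])
  next
    case False
    then have "j \<ge> B2 (i + j') i" using that B(1) B(2)[of "i + j'" i] by auto
    from B2[OF this] show ?thesis by (simp add: diff_diff_eq)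
  qed
  then show "\<exists>B::nat. \<forall>i j j' q. B \<le> i \<or> B \<le> j \<or> B \<le> j' \<longrightarrow>
      yp g a (h + k) (yp h b k e (Q - of_nat i - of_nat j')) (P + of_nat i - of_nat j) q w = 0" by blast
qed

text \<open>Weak associativity is used for the outer product and then, inside it, for the inner one.
  Each use turns \<open>a(x)\<close> or \<open>b(y)\<close> into its translate by \<open>z\<close>,
  a Taylor series; collecting the terms of total order \<open>l\<close> gives the divided power of
  the total derivative.\<close>

lemma shift_mult_yp_yp:
  assumes w: "w \<in> W s"
    and m: "formS g s - m \<in> \<int>" "\<And>i::nat. a (- 1 - m - of_nat i) w = 0"
    and m': "formS h s - m' \<in> \<int>" "\<And>i::nat. b (- 1 - m' - of_nat i) w = 0"
    and L: "\<And>l. l \<ge> L \<Longrightarrow> e (q - of_nat l) w = 0"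
  shows "sm m m' (\<lambda>P Q q. yp g a (h + k) (yp h b k e Q) P q w) P Q q =
    (\<Sum>l<L. tdp l (\<lambda>P Q. a (P - m) (b (Q - m') (e (q - of_nat l) w))) P Q)"
proof -
  obtain B1 where B1: "\<And>j s w p. j \<ge> B1 \<Longrightarrow> w \<in> W s \<Longrightarrow> yp h b k e (Q - of_nat j) p w = 0"
    using yp_top[OF b e be, of Q] by blast
  have "\<exists>s. yp h b k e (Q - of_nat j) x w \<in> W s" for j x using gf_W[OF gf_yp w] by blast
  have "\<exists>B::nat. \<forall>i\<ge>B. yp h b k e (Q - of_nat j') (q - m' + of_nat j' - of_nat i) w = 0" for j' :: nat
    using gf_bound[OF gf_yp w] by metis
  then obtain B2 where B2: "\<And>i j'. i \<ge> B2 j' \<Longrightarrow> yp h b k e (Q - of_nat j') (q - m' + of_nat j' - of_nat i) w = 0"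
    by metis
  define B where "B = Max (insert B1 (insert L (B2 ` {..<B1})))"
  have B: "B1 \<le> B" "L \<le> B" "\<And>l. l < B1 \<Longrightarrow> B2 l \<le> B"
    unfolding B_def by (rule Max_ge; simp)+
  have vanish: "yp h b k e (Q - of_nat j') (q - m' + of_nat j' - of_nat i) w = 0" if "j' \<ge> B \<or> i \<ge> B" for i j'
  proof (cases "j' \<ge> B1")
    case True then show ?thesis using B1 w by blast
  next
    case False then show ?thesis using that B(1) B(3)[of j'] by (intro B2) auto
  qed
  note zero = gf_0[OF a] gf_0[OF b]
  have yC: "yp h b k e Q' x w \<in> C" for Q' x by (rule W_C[OF gf_W[OF gf_yp w]])
  have beC: "b x (e y w) \<in> C" for x y by (rule W_C[OF gf_W[OF b gf_W[OF e w]]])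
  have "sm m m' (\<lambda>P Q q. yp g a (h + k) (yp h b k e Q) P q w) P Q q =
      Sum_any (\<lambda>j'::nat. sc (m' gchoose j') (Sum_any (\<lambda>i::nat. sc (P + of_nat i gchoose i)
        (a (P - m + of_nat i) (yp h b k e (Q - of_nat j') (q - m' + of_nat j' - of_nat i) w)))))"
  proof -
    have "Sum_any (\<lambda>j::nat. sc (m gchoose j) (yp g a (h + k) (yp h b k e (Q - of_nat j')) (P - of_nat j) (q - m - m' + of_nat j + of_nat j') w)) =
        Sum_any (\<lambda>i::nat. sc (P + of_nat i gchoose i)
          (a (P - m + of_nat i) (yp h b k e (Q - of_nat j') (q - m' + of_nat j' - of_nat i) w)))" for j'
      using weak_associativity[OF a gf_yp wcf_yp w m, of P "Q - of_nat j'" "q - m' + of_nat j'"]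
      by (simp add: algebra_simps)
    then show ?thesis unfolding shift_mult_def by simp
  qed
  also have "\<dots> = (\<Sum>j'<B. \<Sum>i<B. sc ((m' gchoose j') * (P + of_nat i gchoose i))
        (a (P - m + of_nat i) (yp h b k e (Q - of_nat j') (q - m' + of_nat j' - of_nat i) w)))"
    by (rule double_Sum_any_bounded) (use vanish zero in metis)
  also have "\<dots> = (\<Sum>i<B. sc (P + of_nat i gchoose i) (a (P - m + of_nat i)
      (\<Sum>j'<B. sc (m' gchoose j') (yp h b k e (Q - of_nat j') (q - m' + of_nat j' - of_nat i) w))))"
    unfolding gf_sum[OF a yC] by (rule trans[OF sum.swap]) (simp add: scale_sum_right mult.commute)
  also have "\<dots> = (\<Sum>i<B. sc (P + of_nat i gchoose i) (a (P - m + of_nat i)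
      (\<Sum>i'<B. sc (Q + of_nat i' gchoose i') (b (Q - m' + of_nat i') (e (q - of_nat i - of_nat i') w)))))"
  proof -
    have "(\<Sum>j'<B. sc (m' gchoose j') (yp h b k e (Q - of_nat j') (q - m' + of_nat j' - of_nat i) w)) =
        (\<Sum>i'<B. sc (Q + of_nat i' gchoose i') (b (Q - m' + of_nat i') (e (q - of_nat i - of_nat i') w)))" for i
    proof -
      have "(\<Sum>j'<B. sc (m' gchoose j') (yp h b k e (Q - of_nat j') (q - m' + of_nat j' - of_nat i) w)) =
          Sum_any (\<lambda>j'. sc (m' gchoose j') (yp h b k e (Q - of_nat j') (q - of_nat i - m' + of_nat j') w))"
        by (subst Sum_any_bounded[of B]) (use vanish[of _ i] in \<open>auto simp: algebra_simps\<close>)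
      also have "\<dots> = Sum_any (\<lambda>i'. sc (Q + of_nat i' gchoose i') (b (Q - m' + of_nat i') (e (q - of_nat i - of_nat i') w)))"
        by (rule weak_associativity[OF b e be w m'])
      also have "\<dots> = (\<Sum>i'<B. sc (Q + of_nat i' gchoose i') (b (Q - m' + of_nat i') (e (q - of_nat i - of_nat i') w)))"
      proof (rule Sum_any_bounded)
        fix i' assume "B \<le> i'"
        then have "e (q - of_nat (i + i')) w = 0" using B by (intro L) simp
        then show "sc (Q + of_nat i' gchoose i') (b (Q - m' + of_nat i') (e (q - of_nat i - of_nat i') w)) = 0"
          by (simp add: zero diff_diff_eq)
      qed
      finally show ?thesis .
    qed
    then show ?thesis by simp
  qed
  also have "\<dots> = (\<Sum>i<B. \<Sum>i'<B. sc ((P + of_nat i gchoose i) * (Q + of_nat i' gchoose i'))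
      (a (P - m + of_nat i) (b (Q - m' + of_nat i') (e (q - of_nat (i + i')) w))))"
    unfolding gf_sum[OF a beC] by (simp add: scale_sum_right diff_diff_eq)
  also have "\<dots> = (\<Sum>l<B. \<Sum>i\<le>l. sc ((P + of_nat i gchoose i) * (Q + of_nat (l - i) gchoose (l - i)))
      (a (P - m + of_nat i) (b (Q - m' + of_nat (l - i)) (e (q - of_nat (i + (l - i))) w))))"
  proof (rule triangle_sum)
    fix i j :: nat assume "B \<le> i + j"
    then have "e (q - of_nat (i + j)) w = 0" using B by (intro L) simp
    then show "sc ((P + of_nat i gchoose i) * (Q + of_nat j gchoose j))
      (a (P - m + of_nat i) (b (Q - m' + of_nat j) (e (q - of_nat (i + j)) w))) = 0"
      by (simp only: zero scale_zero_right)
  qed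
  also have "\<dots> = (\<Sum>l<B. tdp l (\<lambda>P Q. a (P - m) (b (Q - m') (e (q - of_nat l) w))) P Q)"
    unfolding total_deriv_pow_def
    by (rule sum.cong[OF refl], rule sum.cong[OF refl]) (simp add: algebra_simps)
  also have "\<dots> = (\<Sum>l<L. tdp l (\<lambda>P Q. a (P - m) (b (Q - m') (e (q - of_nat l) w))) P Q)"
  proof (rule sum.mono_neutral_right)
    show "\<forall>l\<in>{..<B} - {..<L}. tdp l (\<lambda>P Q. a (P - m) (b (Q - m') (e (q - of_nat l) w))) P Q = 0"
      using L by (auto simp: total_deriv_pow_def zero)
  qed (use B in auto)
  finally show ?thesis .
qed

text \<open>The power of \<open>x - y\<close> passes through the total derivatives and reaches the
  composition of \<open>a\<close> and \<open>b\<close>, where their own weak commutativity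
  applies.\<close>

lemma binom_mult_shift_yp_yp:
  assumes w: "w \<in> W s"
    and m: "formS g s - m \<in> \<int>" "\<And>i::nat. a (- 1 - m - of_nat i) w = 0"
    and m': "formS h s - m' \<in> \<int>" "\<And>i::nat. b (- 1 - m' - of_nat i) w = 0"
    and L: "\<And>l. l \<ge> L \<Longrightarrow> e (q - of_nat l) w = 0"
  shows "bm (-1) \<alpha> (\<lambda>P Q. sm m m' (\<lambda>P Q q. yp g a (h + k) (yp h b k e Q) P q w) P Q q) P Q =
    (\<Sum>l<L. tdp l (\<lambda>P Q. bm (-1) \<alpha> (\<lambda>x y. a x (b y (e (q - of_nat l) w))) (P - m) (Q - m')) P Q)"
proof -
  let ?H = "\<lambda>l P Q. a (P - m) (b (Q - m') (e (q - of_nat l) w))"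
  have dt: "diag_truncated (?H l)" for l :: nat
    unfolding diag_truncated_def
  proof (intro allI)
    fix P Q
    obtain B :: nat where B: "\<And>i. i \<ge> B \<Longrightarrow> b (Q - m' - of_nat i) (e (q - of_nat l) w) = 0"
      using gf_bound[OF b gf_W[OF e w]] by blast
    have "a (P + of_nat i - m) (b (Q - of_nat i - m') (e (q - of_nat l) w)) = 0" if "i \<ge> B" for i
      using B[OF that] gf_0[OF a] by (simp add: algebra_simps)
    then show "\<exists>B::nat. \<forall>i\<ge>B. a (P + of_nat i - m) (b (Q - of_nat i - m') (e (q - of_nat l) w)) = 0" by blast
  qed
  have "bm (-1) \<alpha> (\<lambda>P Q. \<Sum>l<L. tdp l (?H l) P Q) P Q = (\<Sum>l<L. bm (-1) \<alpha> (tdp l (?H l)) P Q)" for L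
  proof (induction L)
    case 0 show ?case unfolding binom_mult_def by simp
  next
    case (Suc L)
    have dt_sum: "diag_truncated (\<lambda>P Q. \<Sum>l<L. tdp l (?H l) P Q)"
    proof (induction L)
      case 0 show ?case unfolding diag_truncated_def by simp
    next
      case (Suc L)
      show ?case unfolding diag_truncated_def
      proof (intro allI)
        fix P Q
        obtain B1 :: nat where "\<And>i. i \<ge> B1 \<Longrightarrow> (\<Sum>l<L. tdp l (?H l) (P + of_nat i) (Q - of_nat i)) = 0"
          using Suc unfolding diag_truncated_def by blast
        moreover obtain B2 :: nat where "\<And>i. i \<ge> B2 \<Longrightarrow> tdp L (?H L) (P + of_nat i) (Q - of_nat i) = 0"
          using diag_truncated_total_deriv_pow[OF dt] unfolding diag_truncated_def by blast
        ultimately show "\<exists>B::nat. \<forall>i\<ge>B. (\<Sum>l<Suc L. tdp l (?H l) (P + of_nat i) (Q - of_nat i)) = 0"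
          by (intro exI[of _ "max B1 B2"]) simp
      qed
    qed
    show ?case
      using binom_mult_linear[OF dt_sum diag_truncated_total_deriv_pow[OF dt], where k = 1] Suc by simp
  qed
  note lin = this
  have shift: "bm (-1) \<alpha> (?H l) = (\<lambda>P Q. bm (-1) \<alpha> (\<lambda>x y. a x (b y (e (q - of_nat l) w))) (P - m) (Q - m'))" for l
    unfolding binom_mult_def by (intro ext) (simp add: algebra_simps)
  have "sm m m' (\<lambda>P Q q. yp g a (h + k) (yp h b k e Q) P q w) P Q q = (\<Sum>l<L. tdp l (?H l) P Q)" for P Q
    by (rule shift_mult_yp_yp[OF w m m']) (rule L)
  then show ?thesis by (simp only: lin total_deriv_pow_binom_mult[OF dt] shift)
qed

end

text \<open>The exponents \<open>m\<close> and \<open>m'\<close> depend on \<open>a\<close>,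
  \<open>b\<close> and \<open>w\<close> alone, so both orders of the vertex operators pick up the
  same factor, and it can be cancelled. In between, the gap hypothesis is applied to the
  coefficients of \<open>e(z) w\<close>.\<close>

theorem vertex_operators_commute:
  assumes a: "gf g a" and b: "gf h b" and e: "gf k e"
    and ab: "weakly_commute g a h b" and ae: "weakly_commute g a k e" and be: "weakly_commute h b k e"
    and gap: "\<forall>s. \<forall>w\<in>W s. \<forall>p q. gc \<kappa> \<alpha> a b w p q = 0" and w: "w \<in> W s"
  shows "bm (-1) \<alpha> (\<lambda>P Q. yp g a (h + k) (yp h b k e Q) P q w) P Q =
    sc \<kappa> (bm (-1) \<alpha> (\<lambda>Q P. yp h b (g + k) (yp g a k e P) Q q w) Q P)"
proof -
  obtain m where m: "formS g s - m \<in> \<int>" "\<And>i::nat. a (- 1 - m - of_nat i) w = 0"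
    using large_exponent[OF a w] by blast
  obtain m' where m': "formS h s - m' \<in> \<int>" "\<And>i::nat. b (- 1 - m' - of_nat i) w = 0"
    using large_exponent[OF b w] by blast
  let ?E = "\<lambda>P Q q. yp g a (h + k) (yp h b k e Q) P q w"
  let ?E' = "\<lambda>Q P q. yp h b (g + k) (yp g a k e P) Q q w"
  let ?D = "\<lambda>P Q q. bm (-1) \<alpha> (\<lambda>P Q. ?E P Q q) P Q"
  let ?D' = "\<lambda>Q P q. bm (-1) \<alpha> (\<lambda>Q P. ?E' Q P q) Q P"
  have tE: "jointly_truncated ?E" by (rule yp_yp_truncated[OF a b e ab ae be w])
  have tE': "jointly_truncated ?E'" by (rule yp_yp_truncated[OF b a e wcf_sym[OF ab] be ae w])
  have tD: "doubly_truncated ?D" by (rule jointly_truncated_binom_mult[OF tE])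
  have tD': "doubly_truncated ?D'" by (rule jointly_truncated_binom_mult[OF tE'])
  have tD'': "doubly_truncated (\<lambda>P Q q. ?D' Q P q)"
    using tD' unfolding doubly_truncated_def by metis
  have main: "sm m m' ?D P Q q = sc \<kappa> (sm m m' (\<lambda>P Q q. ?D' Q P q) P Q q)" for P Q q
  proof -
    obtain L where L: "\<And>l. l \<ge> L \<Longrightarrow> e (q - of_nat l) w = 0" using gf_bound[OF e w] by blast
    have swap: "bm (-1) \<alpha> (\<lambda>x y. a x (b y (e x' w))) x y = sc \<kappa> (bm (-1) \<alpha> (\<lambda>y x. b y (a x (e x' w))) y x)" for x' x y
      using gap gf_W[OF e w] unfolding gap_coeff_def by (metis eq_iff_diff_eq_0)
    have "sm m m' ?D P Q q = bm (-1) \<alpha> (\<lambda>P Q. sm m m' ?E P Q q) P Q"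
      by (rule shift_mult_binom_mult[OF tE])
    also have "\<dots> = (\<Sum>l<L. tdp l (\<lambda>P Q. bm (-1) \<alpha> (\<lambda>x y. a x (b y (e (q - of_nat l) w))) (P - m) (Q - m')) P Q)"
      by (rule binom_mult_shift_yp_yp[OF a b e ab ae be w m m']) (rule L)
    also have "\<dots> = sc \<kappa> (\<Sum>l<L. tdp l (\<lambda>P Q. bm (-1) \<alpha> (\<lambda>y x. b y (a x (e (q - of_nat l) w))) (Q - m') (P - m)) P Q)"
      unfolding swap total_deriv_pow_def by (simp add: scale_sum_right mult.commute)
    also have "(\<Sum>l<L. tdp l (\<lambda>P Q. bm (-1) \<alpha> (\<lambda>y x. b y (a x (e (q - of_nat l) w))) (Q - m') (P - m)) P Q) =
        (\<Sum>l<L. tdp l (\<lambda>Q P. bm (-1) \<alpha> (\<lambda>y x. b y (a x (e (q - of_nat l) w))) (Q - m') (P - m)) Q P)"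
      by (rule sum.cong[OF refl], rule total_deriv_pow_flip)
    also have "\<dots> = bm (-1) \<alpha> (\<lambda>Q P. sm m' m ?E' Q P q) Q P"
      by (rule sym, rule binom_mult_shift_yp_yp[OF b a e wcf_sym[OF ab] be ae w m' m], rule L)
    also have "\<dots> = sm m' m ?D' Q P q"
      by (rule shift_mult_binom_mult[OF tE', symmetric])
    also have "\<dots> = sm m m' (\<lambda>P Q q. ?D' Q P q) P Q q"
      by (rule shift_mult_swap[OF tD'', where m = m and m' = m'])
    finally show ?thesis .
  qed
  have "?D P Q q - sc \<kappa> (?D' Q P q) = 0"
  proof (rule shift_mult_cancel[where D = "\<lambda>P Q q. ?D P Q q - sc \<kappa> (?D' Q P q)" and m = m and m' = m'])
    show "doubly_truncated (\<lambda>P Q q. ?D P Q q - sc \<kappa> (?D' Q P q))"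
      unfolding doubly_truncated_def
    proof (intro allI)
      fix P Q
      obtain B1 :: nat where B1: "\<And>j j' q. j \<ge> B1 \<or> j' \<ge> B1 \<Longrightarrow> ?D (P - of_nat j) (Q - of_nat j') q = 0"
        using tD unfolding doubly_truncated_def by blast
      obtain B2 :: nat where B2: "\<And>j j' q. j \<ge> B2 \<or> j' \<ge> B2 \<Longrightarrow> ?D' (Q - of_nat j') (P - of_nat j) q = 0"
        using tD'' unfolding doubly_truncated_def by blast
      show "\<exists>B::nat. \<forall>j j' q. B \<le> j \<or> B \<le> j' \<longrightarrow>
          ?D (P - of_nat j) (Q - of_nat j') q - sc \<kappa> (?D' (Q - of_nat j') (P - of_nat j) q) = 0"
        by (rule exI[of _ "max B1 B2"]) (use B1 B2 in auto)
    qed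
    fix P Q q
    show "sm m m' (\<lambda>P Q q. ?D P Q q - sc \<kappa> (?D' Q P q)) P Q q = 0"
      using shift_mult_diff[OF tD tD'', of m m' \<kappa> P Q q] main[of P Q q] by simp
  qed
  then show ?thesis by simp
qed

end

section \<open>Derivatives, the vacuum and Goddard's uniqueness theorem\<close>

context field_setting
begin

text \<open>Joins the coefficient identity with the vanishing off the cosets. The result is what
  \<open>jacobi_rhs_coeff\<close> yields once \<open>Y\<close> is known to be given by products, so
  it serves both the module and the algebra.\<close>

lemma jacobi_lhs_eq:
  assumes a: "gf g a" and b: "gf h b" and ab: "weakly_commute g a h b" and w: "w \<in> W s"
  shows "jacobi_lhs sc (form g h) (c g h) a b w (e0, e1, e2) =
    (if e1 + formS g s \<in> \<int> then Sum_any (\<lambda>i::nat. sc (- 1 - e1 gchoose i)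
      (yp g a h b (e0 - of_nat i) (e2 + 1 + e1 + of_nat i) w)) else 0)"
proof (cases "- 1 - e0 - form g h \<in> \<int>")
  case True
  obtain K where K: "wc_bound g a h b K" using ab unfolding weakly_commute_def by blast
  obtain N where N: "- 1 - e0 - form g h = of_int N" using True by (auto elim: Ints_cases)
  have e0: "e0 = - 1 - form g h - of_int N" unfolding N[symmetric] by simp
  have n: "- (e0 - of_nat i) - 1 = form g h + of_int (N + int i)" for i
    unfolding e0 by simp
  have lhs: "jacobi_lhs sc (form g h) (c g h) a b w (e0, e1, e2) = commutator g a h b N w e1 e2"
    unfolding e0 commutator_def by (rule jacobi_lhs_coeff)
  show ?thesis
  proof (cases "e1 + formS g s \<in> \<int>")
    case True
    then have "formS g s + e1 \<in> \<int>" by (simp add: add.commute)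
    from jacobi_identity[OF a b K w this] show ?thesis unfolding lhs n using True by simp
  next
    case False
    then have "formS g s + e1 \<notin> \<int>" by (simp add: add.commute)
    moreover have "form g h + of_int N - form g h \<in> \<int>" by simp
    ultimately show ?thesis unfolding lhs commutator_def using gap_coeff_eq_0_left[OF a b w] False by simp
  qed
next
  case False
  have ni: "- (e0 - of_nat i) - 1 - form g h \<notin> \<int>" for i
  proof
    assume "- (e0 - of_nat i) - 1 - form g h \<in> \<int>"
    then have "- (e0 - of_nat i) - 1 - form g h - of_nat i \<in> \<int>" by (rule Ints_diff[OF _ Ints_of_nat])
    moreover have "- (e0 - of_nat i) - 1 - form g h - of_nat i = - 1 - e0 - form g h" by simp
    ultimately show False using False by (simp only:)
  qed
  show ?thesis unfolding jacobi_lhs_eq_0[OF False] fprod_nonint[OF ni] by simp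
qed

section \<open>Derivatives of fields and products with the identity field\<close>

definition deriv_field :: "(complex \<Rightarrow> 'w \<Rightarrow> 'w) \<Rightarrow> complex \<Rightarrow> 'w \<Rightarrow> 'w" where
  "deriv_field b p w = sc (p + 1) (b (p + 1) w)"

lemma gf_deriv: assumes b: "gf h b" shows "gf h (deriv_field b)"
  unfolding graded_field_def
proof (intro conjI allI ballI impI)
  fix p show "linear_map_on sc C sc (deriv_field b p)"
    unfolding linear_map_on_def deriv_field_def
    by (auto simp: gf_add[OF b] gf_scale[OF b] scale_right_distrib mult.commute)
next
  fix s w p assume w: "w \<in> W s"
  show "deriv_field b p w \<in> W (act h s)"
    unfolding deriv_field_def by (rule subspace_scale[OF component_subspace gf_W[OF b w]])
  assume "deriv_field b p w \<noteq> 0"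
  then have "b (p + 1) w \<noteq> 0" unfolding deriv_field_def by auto
  then have "formS h s + (p + 1) - 1 \<in> \<int>" by (intro Ints_diff gf_Ints[OF b w]) auto
  then show "formS h s + p \<in> \<int>" by (simp add: add.assoc)
next
  fix s w assume w: "w \<in> W s"
  obtain R where R: "\<And>p. Re p < R \<Longrightarrow> b p w = 0" using gf_lower[OF b w] by blast
  show "\<exists>R. \<forall>p. Re p < R \<longrightarrow> deriv_field b p w = 0"
    by (rule exI[of _ "R - 1"]) (use R in \<open>auto simp: deriv_field_def\<close>)
qed

text \<open>Leibniz rule in the second variable. The derivatives of
  \<open>(z\<^sub>1 - z\<^sub>2)^n\<close> and \<open>(z\<^sub>2 - z\<^sub>1)^n\<close> with respect
  to \<open>z\<^sub>2\<close> have opposite signs, which turns \<open>\<kappa>\<close> into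
  \<open>- \<kappa>\<close>.\<close>

lemma gap_coeff_deriv:
  assumes a: "gf g a" and b: "gf h b" and w: "w \<in> W s"
  shows "gc \<kappa> n a (deriv_field b) w p q =
    sc (q + 1) (gc \<kappa> n a b w p (q + 1)) + sc n (gc (- \<kappa>) (n - 1) a b w p q)"
proof -
  note b' = gf_deriv[OF b]
  obtain L1 where L1: "\<And>l. l \<ge> L1 \<Longrightarrow> b (q + 1 - of_nat l) w = 0" using gf_bound[OF b w] by blast
  obtain L2 where L2: "\<And>l. l \<ge> L2 \<Longrightarrow> a (p - of_nat l) w = 0" using gf_bound[OF a w] by blast
  have aC: "b x w \<in> C" for x by (rule W_C[OF gf_W[OF b w]])
  have 1: "bm (-1) n (\<lambda>p q. a p (deriv_field b q w)) p q =
    sc (q + 1) (bm (-1) n (\<lambda>p q. a p (b q w)) p (q + 1)) + sc n (bm (-1) (n - 1) (\<lambda>p q. a p (b q w)) p q)"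
  proof -
    let ?u = "\<lambda>i. a (p - n + of_nat i) (b (q + 1 - of_nat i) w)"
    have "bm (-1) n (\<lambda>p q. a p (deriv_field b q w)) p q = (\<Sum>i<Suc L1. sc (sgb n i * (q + 1 - of_nat i)) (?u i))"
      unfolding binom_mult_def deriv_field_def gf_scale[OF a aC]
      by (subst Sum_any_bounded[of "Suc L1"])
        (use L1 in \<open>auto simp: gf_0[OF a] algebra_simps simp del: sum.lessThan_Suc\<close>)
    also have "\<dots> = (\<Sum>i<Suc L1. sc (q + 1) (sc (sgb n i) (?u i))) - (\<Sum>i<Suc L1. sc (sgb n i * of_nat i) (?u i))"
      unfolding sum_subtractf[symmetric]
    proof (rule sum.cong[OF refl])
      fix i
      have "sgb n i * (q + 1 - of_nat i) = (q + 1) * sgb n i - sgb n i * of_nat i"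
        by (simp add: algebra_simps)
      then show "sc (sgb n i * (q + 1 - of_nat i)) (?u i) =
          sc (q + 1) (sc (sgb n i) (?u i)) - sc (sgb n i * of_nat i) (?u i)"
        by (simp only: scale_left_diff_distrib scale_scale)
    qed
    also have "(\<Sum>i<Suc L1. sc (q + 1) (sc (sgb n i) (?u i))) = sc (q + 1) (bm (-1) n (\<lambda>p q. a p (b q w)) p (q + 1))"
      unfolding binom_mult_def scale_sum_right[symmetric]
      by (subst Sum_any_bounded[of "Suc L1"]) (use L1 in \<open>auto simp: gf_0[OF a]\<close>)
    also have "(\<Sum>i<Suc L1. sc (sgb n i * of_nat i) (?u i)) = (\<Sum>i<L1. sc (sgb n (Suc i) * of_nat (Suc i)) (?u (Suc i)))"
      unfolding sum.lessThan_Suc_shift by simp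
    also have "\<dots> = (\<Sum>i<L1. - sc n (sc (sgb (n - 1) i) (a (p - (n - 1) + of_nat i) (b (q - of_nat i) w))))"
    proof (rule sum.cong[OF refl])
      fix i
      have "sgb n (Suc i) * of_nat (Suc i) = - ((-1) ^ i) * (of_nat (Suc i) * (n gchoose Suc i))"
        by (simp del: of_nat_Suc)
      also have "\<dots> = - (n * sgb (n - 1) i)" unfolding gbinomial_absorption by simp
      finally have "sgb n (Suc i) * of_nat (Suc i) = - (n * sgb (n - 1) i)" .
      then have "sc (sgb n (Suc i) * of_nat (Suc i)) (?u (Suc i)) = - sc n (sc (sgb (n - 1) i) (?u (Suc i)))"
        by (simp only: scale_minus_left scale_scale)
      then show "sc (sgb n (Suc i) * of_nat (Suc i)) (?u (Suc i)) =
          - sc n (sc (sgb (n - 1) i) (a (p - (n - 1) + of_nat i) (b (q - of_nat i) w)))"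
        by (simp add: algebra_simps)
    qed
    also have "\<dots> = - sc n (bm (-1) (n - 1) (\<lambda>p q. a p (b q w)) p q)"
    proof -
      have "bm (-1) (n - 1) (\<lambda>p q. a p (b q w)) p q =
          (\<Sum>i<L1. sc (sgb (n - 1) i) (a (p - (n - 1) + of_nat i) (b (q - of_nat i) w)))"
        unfolding binom_mult_def
      proof (rule Sum_any_bounded)
        fix i assume "L1 \<le> i"
        then have "b (q - of_nat i) w = 0" using L1[of "Suc i"] by (simp add: algebra_simps)
        then show "sc (sgb (n - 1) i) (a (p - (n - 1) + of_nat i) (b (q - of_nat i) w)) = 0"
          by (simp add: gf_0[OF a])
      qed
      then show ?thesis by (simp add: scale_sum_right sum_negf)
    qed
    finally show ?thesis by simp
  qed
  have 2: "bm (-1) n (\<lambda>q p. deriv_field b q (a p w)) q p =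
    sc (q + 1) (bm (-1) n (\<lambda>q p. b q (a p w)) (q + 1) p) - sc n (bm (-1) (n - 1) (\<lambda>q p. b q (a p w)) q p)"
  proof -
    let ?u = "\<lambda>i. b (q - (n - 1) + of_nat i) (a (p - of_nat i) w)"
    have "bm (-1) n (\<lambda>q p. deriv_field b q (a p w)) q p = (\<Sum>i<L2. sc (sgb n i * (q + 1 - (n - of_nat i))) (?u i))"
      unfolding binom_mult_def deriv_field_def
      by (subst Sum_any_bounded[of L2]) (use L2 in \<open>auto simp: gf_0[OF b] algebra_simps\<close>)
    also have "\<dots> = (\<Sum>i<L2. sc (q + 1) (sc (sgb n i) (?u i))) - (\<Sum>i<L2. sc (sgb n i * (n - of_nat i)) (?u i))"
      unfolding sum_subtractf[symmetric]
    proof (rule sum.cong[OF refl])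
      fix i
      have "sgb n i * (q + 1 - (n - of_nat i)) = (q + 1) * sgb n i - sgb n i * (n - of_nat i)"
        by (simp add: algebra_simps)
      then show "sc (sgb n i * (q + 1 - (n - of_nat i))) (?u i) =
          sc (q + 1) (sc (sgb n i) (?u i)) - sc (sgb n i * (n - of_nat i)) (?u i)"
        by (simp only: scale_left_diff_distrib scale_scale)
    qed
    also have "(\<Sum>i<L2. sc (q + 1) (sc (sgb n i) (?u i))) = sc (q + 1) (bm (-1) n (\<lambda>q p. b q (a p w)) (q + 1) p)"
      unfolding binom_mult_def scale_sum_right[symmetric]
      by (subst Sum_any_bounded[of L2]) (use L2 in \<open>auto simp: gf_0[OF b] algebra_simps\<close>)
    also have "(\<Sum>i<L2. sc (sgb n i * (n - of_nat i)) (?u i)) = (\<Sum>i<L2. sc n (sc (sgb (n - 1) i) (?u i)))"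
    proof (rule sum.cong[OF refl])
      fix i
      have "sgb n i * (n - of_nat i) = (-1) ^ i * ((n - of_nat i) * (n gchoose i))" by simp
      also have "\<dots> = n * sgb (n - 1) i" unfolding gbinomial_absorb_comp by simp
      finally have "sgb n i * (n - of_nat i) = n * sgb (n - 1) i" .
      then show "sc (sgb n i * (n - of_nat i)) (?u i) = sc n (sc (sgb (n - 1) i) (?u i))"
        by (simp only: scale_scale)
    qed
    also have "\<dots> = sc n (bm (-1) (n - 1) (\<lambda>q p. b q (a p w)) q p)"
      unfolding binom_mult_def scale_sum_right[symmetric]
      by (subst Sum_any_bounded[of L2]) (use L2 in \<open>auto simp: gf_0[OF b]\<close>)
    finally show ?thesis .
  qed
  show ?thesis unfolding gap_coeff_def 1 2
    by (simp add: scale_right_distrib scale_right_diff_distrib mult.commute)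
qed

lemma X_deriv:
  assumes a: "gf g a" and b: "gf h b" and w: "w \<in> W s"
  shows "commutator g a h (deriv_field b) N w p q =
    sc (q + 1) (commutator g a h b N w p (q + 1)) + sc (form g h + of_int N) (commutator g a h b (N - 1) w p q)"
proof -
  have "c g h * (-1) powi (N - 1) = - (c g h * (-1) powi N)"
    by (simp add: power_int_diff)
  then show ?thesis unfolding commutator_def gap_coeff_deriv[OF assms] by (simp add: algebra_simps)
qed

lemma wc_bound_deriv:
  assumes a: "gf g a" and b: "gf h b" and K: "wc_bound g a h b K"
  shows "wc_bound g a h (deriv_field b) (K + 1)"
  using wc_zero[OF K] unfolding wc_bound_def by (auto simp: X_deriv[OF a b])

lemma wcf_deriv:
  assumes "gf g a" "gf h b" "weakly_commute g a h b" shows "weakly_commute g a h (deriv_field b)"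
  using wc_bound_deriv[OF assms(1,2)] assms(3) unfolding weakly_commute_def by blast

text \<open>Moving the derivative off \<open>b\<close> in the gap costs \<open>n\<close> times the
  product of index \<open>n - 1\<close>. The further terms are due to the residue factor of exponent
  \<open>- formS g s\<close> and cancel among themselves.\<close>

lemma fprod_deriv_homog:
  assumes a: "gf g a" and b: "gf h b" and ab: "weakly_commute g a h b" and w: "w \<in> W s"
  shows "fprod g a n h (deriv_field b) p w = deriv_field (fprod g a n h b) p w + sc n (fprod g a (n - 1) h b p w)"
proof (rule fprod_cases[of n g h])
  assume "n - form g h \<notin> \<int>"
  moreover have "n - 1 - form g h \<notin> \<int>"
  proof
    assume "n - 1 - form g h \<in> \<int>"
    then have "n - 1 - form g h + 1 \<in> \<int>" by (rule Ints_add[OF _ Ints_1])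
    then show False using \<open>n - form g h \<notin> \<int>\<close> by (simp add: algebra_simps)
  qed
  ultimately show ?thesis unfolding deriv_field_def by (simp add: fprod_nonint)
next
  fix N
  let ?\<sigma> = "formS g s"
  let ?n = "form g h + of_int N"
  have n1: "?n - 1 = form g h + of_int (N - 1)" by simp
  obtain K where K: "wc_bound g a h b K" using ab unfolding weakly_commute_def by blast
  \<comment> \<open>Leaves room for the derivative, which raises the commutativity bound by one, and
    for \<open>?Y\<close>, which starts one step lower.\<close>
  let ?B = "nat (K - N) + 1"
  let ?commutator = "\<lambda>i. commutator g a h b (N + int i) w (- 1 - ?\<sigma>) (p + 1 + ?\<sigma> + of_nat i)"
  let ?Y = "\<lambda>i. commutator g a h b (N - 1 + int i) w (- 1 - ?\<sigma>) (p + ?\<sigma> + of_nat i)"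
  have YX: "?Y (Suc i) = ?commutator i" for i by (simp add: algebra_simps)
  have XB: "?commutator ?B = 0" "?commutator i = 0" if "i \<ge> nat (K - N)" for i by (rule wc_zero[OF K _ w], use that in simp)+
  have 1: "iprod g a h (deriv_field b) N p w =
      (\<Sum>i<Suc ?B. sc (- ?\<sigma> gchoose i) (sc (p + 1 + ?\<sigma> + of_nat i) (?commutator i) + sc (?n + of_nat i) (?Y i)))"
    by (subst fprod_sum[where B = "Suc ?B", OF a gf_deriv[OF b] wc_bound_deriv[OF a b K] w])
      (auto simp: X_deriv[OF a b w] algebra_simps simp del: sum.lessThan_Suc)
  have 2: "iprod g a h b N (p + 1) w = (\<Sum>i<Suc ?B. sc (- ?\<sigma> gchoose i) (?commutator i))"
    by (subst fprod_sum[where B = "Suc ?B", OF a b K w]) auto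
  have 3: "iprod g a h b (N - 1) p w = (\<Sum>i<Suc ?B. sc (- ?\<sigma> gchoose i) (?Y i))"
    by (subst fprod_sum[where B = "Suc ?B", OF a b K w]) auto
  have "(\<Sum>i<Suc ?B. sc (- ?\<sigma> gchoose i) (sc (p + 1 + ?\<sigma> + of_nat i) (?commutator i) + sc (?n + of_nat i) (?Y i))) =
      (\<Sum>i<Suc ?B. sc (p + 1) (sc (- ?\<sigma> gchoose i) (?commutator i)) + sc ?n (sc (- ?\<sigma> gchoose i) (?Y i))) +
      ((\<Sum>i<Suc ?B. sc ((?\<sigma> + of_nat i) * (- ?\<sigma> gchoose i)) (?commutator i)) + (\<Sum>i<Suc ?B. sc (of_nat i * (- ?\<sigma> gchoose i)) (?Y i)))"
    unfolding sum.distrib[symmetric]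
  proof (rule sum.cong[OF refl])
    fix i
    have e1: "(- ?\<sigma> gchoose i) * (p + 1 + ?\<sigma> + of_nat i) = (p + 1) * (- ?\<sigma> gchoose i) + (?\<sigma> + of_nat i) * (- ?\<sigma> gchoose i)"
      and e2: "(- ?\<sigma> gchoose i) * (?n + of_nat i) = ?n * (- ?\<sigma> gchoose i) + of_nat i * (- ?\<sigma> gchoose i)"
      by (simp_all only: distrib_left distrib_right mult.commute mult_1 add_ac mult_1_right)
    show "sc (- ?\<sigma> gchoose i) (sc (p + 1 + ?\<sigma> + of_nat i) (?commutator i) + sc (?n + of_nat i) (?Y i)) =
      sc (p + 1) (sc (- ?\<sigma> gchoose i) (?commutator i)) + sc ?n (sc (- ?\<sigma> gchoose i) (?Y i)) +
      (sc ((?\<sigma> + of_nat i) * (- ?\<sigma> gchoose i)) (?commutator i) + sc (of_nat i * (- ?\<sigma> gchoose i)) (?Y i))"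
      unfolding scale_right_distrib[of "- ?\<sigma> gchoose i"] scale_scale e1 e2
      unfolding scale_left_distrib[of "(p + 1) * _"] scale_left_distrib[of "?n * _"] by simp
  qed
  also have "(\<Sum>i<Suc ?B. sc (of_nat i * (- ?\<sigma> gchoose i)) (?Y i)) =
      (\<Sum>i<?B. sc (of_nat (Suc i) * (- ?\<sigma> gchoose Suc i)) (?commutator i))"
    unfolding sum.lessThan_Suc_shift YX by simp
  \<comment> \<open>Absorption turns this shifted remainder into the negative of the other
    one.\<close>
  also have "\<dots> = (\<Sum>i<?B. - sc ((?\<sigma> + of_nat i) * (- ?\<sigma> gchoose i)) (?commutator i))"
  proof (rule sum.cong[OF refl])
    fix i
    have "of_nat (Suc i) * (- ?\<sigma> gchoose Suc i) = - ((?\<sigma> + of_nat i) * (- ?\<sigma> gchoose i))"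
      using gbinomial_mult_1[of "- ?\<sigma>" i] by (simp add: algebra_simps)
    then show "sc (of_nat (Suc i) * (- ?\<sigma> gchoose Suc i)) (?commutator i) = - sc ((?\<sigma> + of_nat i) * (- ?\<sigma> gchoose i)) (?commutator i)"
      by (simp only: scale_minus_left)
  qed
  also have "(\<Sum>i<Suc ?B. sc ((?\<sigma> + of_nat i) * (- ?\<sigma> gchoose i)) (?commutator i)) + \<dots> = 0"
    unfolding sum_negf sum.lessThan_Suc[of _ ?B] using XB(2)[of ?B] by simp
  finally show "fprod g a ?n h (deriv_field b) p w = deriv_field (iprod g a h b N) p w + sc ?n (fprod g a (?n - 1) h b p w)"
    unfolding 1 n1 deriv_field_def 2 3 by (simp only: sum.distrib scale_sum_right add_0_right)
qed

lemma fprod_deriv: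
  assumes a: "gf g a" and b: "gf h b" and ab: "weakly_commute g a h b" and w: "w \<in> C"
  shows "fprod g a n h (deriv_field b) p w = deriv_field (fprod g a n h b) p w + sc n (fprod g a (n - 1) h b p w)"
  using w
proof (induction w rule: C_induct)
  note G = fprod_gf[OF a gf_deriv[OF b] wcf_deriv[OF a b ab], of n] gf_deriv[OF fprod_gf[OF a b ab, of n]] fprod_gf[OF a b ab, of "n - 1"]
  case zero
  show ?case unfolding gf_0[OF G(1)] gf_0[OF G(2)] gf_0[OF G(3)] by simp
next
  note G = fprod_gf[OF a gf_deriv[OF b] wcf_deriv[OF a b ab], of n] gf_deriv[OF fprod_gf[OF a b ab, of n]] fprod_gf[OF a b ab, of "n - 1"]
  case (add s y z)
  note y = W_C[OF add(1)]
  show ?case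
    unfolding gf_add[OF G(1) y add(2)] gf_add[OF G(2) y add(2)] gf_add[OF G(3) y add(2)]
      fprod_deriv_homog[OF a b ab add(1)] add(3)
    by (simp add: scale_right_distrib)
qed

text \<open>Weak associativity with \<open>m = 0\<close>, which is admissible because the identity
  field has no negative exponents. Both binomial sums then reduce to one term.\<close>

lemma yp_id_left:
  assumes a: "gf g a" and w: "w \<in> W s"
  shows "yp 0 idf g a P q w = (if P = 0 then a q w else 0)"
proof -
  have "formS 0 s - 0 \<in> \<int>" by (rule cong2_Ints[OF formS_0])
  moreover have "(if - 1 - 0 - (of_nat i :: complex) = 0 then w else 0) = 0" for i
  proof -
    have "- 1 - 0 - (of_nat i :: complex) = - of_nat (Suc i)" by simp
    then show ?thesis by (simp del: of_nat_Suc)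
  qed
  ultimately have "Sum_any (\<lambda>j::nat. sc (0 gchoose j) (yp 0 idf g a (P - of_nat j) (q - 0 + of_nat j) w)) =
    Sum_any (\<lambda>i::nat. sc (P + of_nat i gchoose i) (if P - 0 + of_nat i = 0 then a (q - of_nat i) w else 0))"
    by (rule weak_associativity[OF gf_id a wcf_id_left[OF a] w])
  also have "Sum_any (\<lambda>j::nat. sc (0 gchoose j) (yp 0 idf g a (P - of_nat j) (q - 0 + of_nat j) w)) = yp 0 idf g a P q w"
    by (subst Sum_any_single[of 0]) (auto simp: gbinomial_0_left)
  also have "Sum_any (\<lambda>i::nat. sc (P + of_nat i gchoose i) (if P - 0 + of_nat i = 0 then a (q - of_nat i) w else 0)) =
      (if P = 0 then a q w else 0)"
  proof (subst Sum_any_single[of 0])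
    fix i :: nat assume "i \<noteq> 0"
    then show "sc (P + of_nat i gchoose i) (if P - 0 + of_nat i = 0 then a (q - of_nat i) w else 0) = 0"
      by (auto simp: gbinomial_0_left)
  qed simp
  finally show ?thesis .
qed

lemma wc_bound_id_right:
  assumes a: "gf g a" obtains K where "form g 0 + of_int K = 0" "wc_bound g a 0 idf K" "c g 0 * (-1) powi K = 1"
proof -
  obtain m :: int where m: "form g 0 - 0 = 2 * of_int m" using form_0_right unfolding cong2_def by blast
  let ?K = "- (2 * m)"
  have n: "form g 0 + of_int ?K = 0" using m by simp
  have k: "c g 0 * (-1) powi ?K = 1"
    unfolding minus_one_powi_minus by (simp add: c_0_right power_int_mult)
  have 0: "commutator g a 0 idf ?K w p q = 0" if "w \<in> W s" for s w p q
    unfolding commutator_def n k gap_coeff_def by (simp add: binom_mult_0 gf_0[OF a])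
  have "wc_bound g a 0 idf ?K" by (rule wc_boundI[OF a gf_id], rule 0)
  then show ?thesis using that n k by blast
qed

text \<open>For the product of index -1 the gap has exponent -1 and scalar -1, so the two expansions
  of the inverse of \<open>z\<^sub>1 - z\<^sub>2\<close> add up to a delta series multiplying
  \<open>a(z\<^sub>1)\<close>. Each coefficient is met by exactly one of them, according to the sign
  of \<open>m\<close>.\<close>

lemma yp_id_right_0:
  assumes a: "gf g a" and w: "w \<in> W s"
  shows "yp g a 0 idf 0 p w = a p w"
proof -
  obtain K where K: "form g 0 + of_int K = 0" "wc_bound g a 0 idf K" "c g 0 * (-1) powi K = 1"
    using wc_bound_id_right[OF a] by blast
  let ?\<sigma> = "formS g s"
  have n: "- 0 - 1 = form g 0 + of_int (K - 1)" using K(1) by (simp add: algebra_simps)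
  have \<kappa>: "c g 0 * (-1) powi (K - 1) = - 1"
    using K(3) by (simp add: power_int_diff)
  have sg: "sgb (- 1) i = 1" for i
    using gbinomial_minus[of "1 :: complex" i] binomial_gbinomial[of i i, where 'a = complex]
    by (simp flip: power_mult_distrib)
  have "yp g a 0 idf 0 p w = commutator g a 0 idf (K - 1) w (- 1 - ?\<sigma>) (p + ?\<sigma>)"
    unfolding n by (subst fprod_sum[where B = 1, OF a gf_id K(2) w]) auto
  also have "\<dots> = Sum_any (\<lambda>i::nat. a (- ?\<sigma> + of_nat i) (if p + ?\<sigma> - of_nat i = 0 then w else 0)) +
      Sum_any (\<lambda>i::nat. if p + ?\<sigma> + 1 + of_nat i = 0 then a (- 1 - ?\<sigma> - of_nat i) w else 0)"
    unfolding commutator_def \<kappa> n[symmetric] gap_coeff_def binom_mult_def by (simp add: sg)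
  also have "\<dots> = a p w"
  proof (cases "?\<sigma> + p \<in> \<int>")
    case False
    have "a (- ?\<sigma> + of_nat i) (if p + ?\<sigma> - of_nat i = 0 then w else 0) = 0" for i :: nat
      using False gf_0[OF a] by (auto simp: add.commute)
    moreover have "(if p + ?\<sigma> + 1 + of_nat i = 0 then a (- 1 - ?\<sigma> - of_nat i) w else 0) = 0" for i :: nat
    proof -
      have "?\<sigma> + p = - 1 - of_nat i" if "p + ?\<sigma> + 1 + of_nat i = 0"
        using that by (simp add: algebra_simps eq_neg_iff_add_eq_0)
      then show ?thesis using False by auto
    qed
    moreover have "a p w = 0" using gf_Ints[OF a w] False by blast
    ultimately show ?thesis by simp
  next
    case True
    then obtain m where "?\<sigma> + p = of_int m" by (auto elim: Ints_cases)
    then have m: "p + ?\<sigma> = of_int m" by (simp add: add.commute)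
    then have p: "p = of_int m - ?\<sigma>" by (simp add: eq_diff_eq)
    have e1: "of_int m - (of_nat i :: complex) = 0 \<longleftrightarrow> m = int i" for i
      by (metis eq_iff_diff_eq_0 of_int_eq_iff of_int_of_nat_eq)
    have e2: "of_int m + 1 + (of_nat i :: complex) = 0 \<longleftrightarrow> m + 1 + int i = 0" for i
      by (metis of_int_1 of_int_add of_int_eq_0_iff of_int_of_nat_eq)
    show ?thesis
    proof (cases "m \<ge> 0")
      case True
      have 1: "Sum_any (\<lambda>i::nat. a (- ?\<sigma> + of_nat i) (if p + ?\<sigma> - of_nat i = 0 then w else 0)) = a p w"
        unfolding m e1 by (subst Sum_any_single[of "nat m"]) (use True gf_0[OF a] in \<open>auto simp: p\<close>)
      have 2: "Sum_any (\<lambda>i::nat. if p + ?\<sigma> + 1 + of_nat i = 0 then a (- 1 - ?\<sigma> - of_nat i) w else 0) = 0"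
        unfolding m e2 using True by (auto intro!: Sum_any_eq_0)
      show ?thesis unfolding 1 2 by simp
    next
      case False
      have 1: "Sum_any (\<lambda>i::nat. a (- ?\<sigma> + of_nat i) (if p + ?\<sigma> - of_nat i = 0 then w else 0)) = 0"
        unfolding m e1 using False gf_0[OF a] by (auto intro!: Sum_any_eq_0)
      have 2: "Sum_any (\<lambda>i::nat. if p + ?\<sigma> + 1 + of_nat i = 0 then a (- 1 - ?\<sigma> - of_nat i) w else 0) = a p w"
        unfolding m e2 by (subst Sum_any_single[of "nat (- m - 1)"]) (use False in \<open>auto simp: p algebra_simps\<close>)
      show ?thesis unfolding 1 2 by simp
    qed
  qed
  finally show ?thesis .
qed

lemma yp_id_right_nonnat:
  assumes a: "gf g a" and w: "w \<in> W s" and P: "P \<notin> \<nat>"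
  shows "yp g a 0 idf P p w = 0"
proof -
  obtain K where K: "form g 0 + of_int K = 0" "wc_bound g a 0 idf K" "c g 0 * (-1) powi K = 1"
    using wc_bound_id_right[OF a] by blast
  show ?thesis
  proof (rule fprod_cases[of "- P - 1" g 0])
    fix N assume N: "- P - 1 = form g 0 + of_int N"
    have "P = - (- P - 1) - 1" by simp
    also have "\<dots> = of_int (K - N - 1) - (form g 0 + of_int K)" unfolding N by simp
    finally have P': "P = of_int (K - N - 1)" unfolding K(1) by simp
    have "K \<le> N"
    proof (rule ccontr)
      assume "\<not> K \<le> N"
      then have "P = of_nat (nat (K - N - 1))" unfolding P' by simp
      then show False using P by simp
    qed
    then show "iprod g a 0 idf N p w = 0" by (rule fprod_top[OF a gf_id K(2) _ w])
  qed (rule fprod_nonint)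
qed

text \<open>Since \<open>d\<close> kills \<open>v\<close>, only the term with \<open>d\<close> on
  the left survives in the gap. Since \<open>y(z\<^sub>2) v\<close> has no negative powers, the
  coefficient of this term at \<open>z\<^sub>2^0\<close> involves only the constant term
  \<open>y 0 v\<close>, and weak commutativity makes it vanish.\<close>

lemma uniqueness:
  assumes d: "gf g d" and y: "gf h y" and dy: "weakly_commute g d h y" and v: "v \<in> W s"
    and dv: "\<And>q. d q v = 0" and yv: "\<And>i::nat. i > 0 \<Longrightarrow> y (- of_nat i) v = 0"
  shows "d p (y 0 v) = 0"
proof -
  obtain K where K: "wc_bound g d h y K" using dy unfolding weakly_commute_def by blast
  let ?n = "form g h + of_int K"
  \<comment> \<open>The offset \<open>?n\<close> cancels the shift by the exponent of the binomial
    factor.\<close>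
  have "commutator g d h y K v (p + ?n) 0 = d p (y 0 v)"
    unfolding commutator_def gap_coeff_def binom_mult_def dv gf_0[OF y]
    by (subst Sum_any_single[of 0]) (auto simp: yv gf_0[OF d])
  then show ?thesis using wc_zero[OF K order_refl v] by simp
qed

end

section \<open>The algebra of fields generated by \<open>\<Gamma>\<close>\<close>

lemma sum_fun_apply: "(\<Sum>i\<in>I. f i) x = (\<Sum>i\<in>I. f i x)"
  for f :: "'i \<Rightarrow> 'a \<Rightarrow> 'b::comm_monoid_add"
  by (induction I rule: infinite_finite_induct) auto

lemma Sum_any_fun_apply:
  fixes f :: "'i \<Rightarrow> 'a \<Rightarrow> 'b::comm_monoid_add"
  assumes "finite {i. f i \<noteq> 0}"
  shows "Sum_any f x = Sum_any (\<lambda>i. f i x)"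
proof -
  have "Sum_any (\<lambda>i. f i x) = (\<Sum>i\<in>{i. f i \<noteq> 0}. f i x)"
    by (rule Sum_any.expand_superset[OF assms]) auto
  then show ?thesis unfolding Sum_any.expand_set[of f] by (simp add: sum_fun_apply)
qed

lemma vector_space_fun: "vector_space sc \<Longrightarrow> vector_space (\<lambda>k f x. sc k (f x))"
  unfolding vector_space_def by (auto simp: fun_eq_iff)

lemma homog_apply: "homog g a g = a" "h \<noteq> g \<Longrightarrow> homog g a h = 0"
  unfolding homog_def by auto

lemma homog_0: "homog g 0 = 0"
  unfolding homog_def by (auto simp: fun_eq_iff)

locale field_algebra = field_setting form c act formS sc UNIV W
  for form :: "'g::ab_group_add \<Rightarrow> 'g \<Rightarrow> complex" and c
    and act :: "'g \<Rightarrow> 's \<Rightarrow> 's" and formS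
    and sc :: "complex \<Rightarrow> 'w::ab_group_add \<Rightarrow> 'w" and W :: "'s \<Rightarrow> 'w set" +
  fixes \<Gamma> :: "('g \<times> (complex \<Rightarrow> 'w \<Rightarrow> 'w)) set"
  assumes \<Gamma>_gf: "(g, a) \<in> \<Gamma> \<Longrightarrow> gf g a"
    and \<Gamma>_wcf: "(g, a) \<in> \<Gamma> \<Longrightarrow> (h, b) \<in> \<Gamma> \<Longrightarrow> weakly_commute g a h b"
begin

text \<open>The premise \<open>weakly_commute\<close> in \<open>cl_prod_wcf\<close> keeps products
  meaningful during the induction that proves mutual commutativity; \<open>cl_prod\<close> then
  drops it.\<close>

inductive generated :: "'g \<Rightarrow> (complex \<Rightarrow> 'w \<Rightarrow> 'w) \<Rightarrow> bool" where
  cl_zero: "generated g 0"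
| cl_id: "generated 0 idf"
| cl_base: "(g, a) \<in> \<Gamma> \<Longrightarrow> generated g a"
| cl_linear: "generated g a \<Longrightarrow> generated g b \<Longrightarrow> generated g (\<lambda>p w. sc k (a p w) + b p w)"
| cl_prod_wcf: "generated g a \<Longrightarrow> generated h b \<Longrightarrow> weakly_commute g a h b \<Longrightarrow> generated (g + h) (fprod g a n h b)"

lemma zero_field: "(0 :: complex \<Rightarrow> 'w \<Rightarrow> 'w) = (\<lambda>p w. 0)"
  by (auto simp: fun_eq_iff)

text \<open>The fields that commute weakly with a fixed \<open>d\<close> are closed under linear
  combinations and, by Dong's lemma, under products. That they are fields is carried along because
  Dong's lemma asks for it.\<close>

lemma cl_commutes:
  assumes "gf k d" "\<And>g a. (g, a) \<in> \<Gamma> \<Longrightarrow> weakly_commute g a k d" "generated g a"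
  shows "gf g a \<and> weakly_commute g a k d"
  using assms(3)
proof induction
  case (cl_zero g)
  then show ?case unfolding zero_field using gf_zero wcf_zero_left[OF assms(1)] by simp
next
  case cl_id
  then show ?case using gf_id wcf_id_left[OF assms(1)] by simp
next
  case (cl_base g a)
  then show ?case using \<Gamma>_gf assms(2) by simp
next
  case (cl_linear g a b k)
  then show ?case using gf_linear wcf_linear_left[OF _ _ assms(1)] by simp
next
  case (cl_prod_wcf g a h b n)
  then show ?case using fprod_gf wcf_fprod[OF _ _ assms(1)] by simp
qed

lemma cl_gf: assumes "generated g a" shows "gf g a"
  using cl_commutes[OF gf_id wcf_sym[OF wcf_id_left[OF \<Gamma>_gf]] assms] by simp

text \<open>Two passes: generated fields commute with each generator, so a generated field can
  itself take the part of the fixed field in \<open>cl_commutes\<close>.\<close>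

lemma cl_wcf: assumes "generated g a" "generated h b" shows "weakly_commute g a h b"
proof -
  have "weakly_commute k d h b" if "(k, d) \<in> \<Gamma>" for k d
    using cl_commutes[OF \<Gamma>_gf[OF that] \<Gamma>_wcf[OF _ that] assms(2)] wcf_sym by simp
  then show ?thesis using cl_commutes[OF cl_gf[OF assms(2)] _ assms(1)] by simp
qed

lemma cl_prod: "generated g a \<Longrightarrow> generated h b \<Longrightarrow> generated (g + h) (fprod g a n h b)"
  using cl_prod_wcf cl_wcf by blast

lemma gf_eqI:
  assumes "gf g a" "gf h b" "\<And>s w p. w \<in> W s \<Longrightarrow> a p w = b p w"
  shows "a = b"
proof (intro ext)
  fix p :: complex and w :: 'w
  have "w \<in> UNIV" by simp
  then show "a p w = b p w"
    by (induction rule: C_induct) (use assms in \<open>auto simp: gf_0 gf_add\<close>)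
qed

lemma fprod_zero_left_field: assumes "gf h b" shows "fprod g 0 n h b = 0"
proof -
  have z: "comp12 0 b w = (\<lambda>_. 0)" "comp21 b 0 w = (\<lambda>_. 0)" for w
    unfolding comp12_def comp21_def using gf_0[OF assms] by auto
  show ?thesis by (intro ext) (simp add: field_prod_def field_prod_on_eq jacobi_lhs_def ser_mult_def z)
qed

lemma fprod_zero_right_field: assumes "gf g a" shows "fprod g a n h 0 = 0"
proof -
  have z: "comp12 a 0 w = (\<lambda>_. 0)" "comp21 0 a w = (\<lambda>_. 0)" for w
    unfolding comp12_def comp21_def using gf_0[OF assms] by auto
  show ?thesis by (intro ext) (simp add: field_prod_def field_prod_on_eq jacobi_lhs_def ser_mult_def z)
qed

section \<open>Families of generated fields\<close>

abbreviation fs where "fs \<equiv> field_scale sc"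
abbreviation fam_prod where "fam_prod \<equiv> field_family_prod form c formS sc W"
abbreviation Yv where "Yv \<equiv> field_Y form c formS sc W"

definition gen_fields :: "('g, 'w) field_family set" where
  "gen_fields = {A. finite {g. A g \<noteq> 0} \<and> (\<forall>g. generated g (A g))}"

abbreviation deg where "deg \<equiv> degree_part gen_fields"

lemma field_scale_eq: "fs = (\<lambda>k A g p w. sc k (A g p w))"
  unfolding field_scale_def by (simp add: fun_eq_iff)

lemma vs_fs: "vector_space fs"
  unfolding field_scale_eq by (intro vector_space_fun vs)

sublocale fam: complex_vector_space fs
  unfolding complex_vector_space_def by (rule vs_fs)

sublocale ser: vector_space "\<lambda>k a p w. sc k (a p w)"
  by (intro vector_space_fun vs)

lemma Vc_cl: "A \<in> gen_fields \<Longrightarrow> generated g (A g)" and Vc_finite: "A \<in> gen_fields \<Longrightarrow> finite {g. A g \<noteq> 0}"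
  unfolding gen_fields_def by auto

lemma Vc_linear: assumes "A \<in> gen_fields" "B \<in> gen_fields" shows "fs k A + B \<in> gen_fields"
proof -
  have "(fs k A + B) g = 0" if "A g = 0" "B g = 0" for g
    using that by (simp add: field_scale_def fun_eq_iff)
  then have "{g. (fs k A + B) g \<noteq> 0} \<subseteq> {g. A g \<noteq> 0} \<union> {g. B g \<noteq> 0}" by blast
  then have "finite {g. (fs k A + B) g \<noteq> 0}"
    by (rule finite_subset) (simp add: Vc_finite assms)
  moreover have "generated g ((fs k A + B) g)" for g
    using cl_linear[OF Vc_cl[OF assms(1)] Vc_cl[OF assms(2)], of g k] by (simp add: field_scale_def plus_fun_def)
  ultimately show ?thesis unfolding gen_fields_def by blast
qed

lemma zero_Vc: "0 \<in> gen_fields"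
  unfolding gen_fields_def using cl_zero by simp

lemma subspace_linearI:
  assumes "0 \<in> S" "\<And>k A B. A \<in> S \<Longrightarrow> B \<in> S \<Longrightarrow> fs k A + B \<in> S"
  shows "fam.subspace S"
proof (rule fam.subspaceI)
  show "A + B \<in> S" if "A \<in> S" "B \<in> S" for A B using assms(2)[OF that, of 1] by simp
  show "fs k A \<in> S" if "A \<in> S" for k A using assms(2)[OF that assms(1), of k] by simp
qed (rule assms(1))

lemma subspace_Vc: "fam.subspace gen_fields"
  by (rule subspace_linearI[OF zero_Vc Vc_linear])

lemma degD: "A \<in> deg g \<Longrightarrow> A \<in> gen_fields" "A \<in> deg g \<Longrightarrow> h \<noteq> g \<Longrightarrow> A h = 0"
  unfolding degree_part_def by auto

lemma deg_homog: assumes "A \<in> deg g" shows "A = homog g (A g)"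
  using degD(2)[OF assms] unfolding homog_def by (auto simp: fun_eq_iff)

lemma deg_cl: "A \<in> deg g \<Longrightarrow> generated g (A g)"
  using Vc_cl degD(1) by blast

lemma homog_deg: assumes "generated g a" shows "homog g a \<in> deg g"
proof -
  have "{h. homog g a h \<noteq> 0} \<subseteq> {g}" unfolding homog_def by auto
  then have "finite {h. homog g a h \<noteq> 0}" by (rule finite_subset) simp
  moreover have "generated h (homog g a h)" for h unfolding homog_def using assms cl_zero by simp
  ultimately show ?thesis unfolding degree_part_def gen_fields_def homog_def by auto
qed

lemma decomposes_homog:
  assumes "finite {g. A g \<noteq> 0}" "\<And>g. homog g (A g) \<in> S g"
  shows "decomposes S (\<lambda>g. homog g (A g)) A"
proof -
  have fin: "finite {g. homog g (A g) \<noteq> 0}"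
    by (rule finite_subset[OF _ assms(1)]) (auto simp: homog_0)
  have "A = Sum_any (\<lambda>g. homog g (A g))"
  proof
    fix h
    have "Sum_any (\<lambda>g. homog g (A g)) h = Sum_any (\<lambda>g. homog g (A g) h)"
      by (rule Sum_any_fun_apply[OF fin])
    also have "\<dots> = A h" by (subst Sum_any_single[of h]) (auto simp: homog_apply)
    finally show "A h = Sum_any (\<lambda>g. homog g (A g)) h" by simp
  qed
  then show ?thesis unfolding decomposes_def using fin assms(2) by blast
qed

lemma decomposes_degree_unique:
  assumes "decomposes (degree_part S) f A"
  shows "f = (\<lambda>g. homog g (A g))"
proof
  fix g
  have f: "f h \<in> degree_part S h" "finite {h. f h \<noteq> 0}" "A = Sum_any f" for h
    using assms unfolding decomposes_def by auto
  have "A g = Sum_any (\<lambda>h. f h g)" unfolding f(3) by (rule Sum_any_fun_apply[OF f(2)])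
  also have "\<dots> = f g g"
  proof (rule Sum_any_single)
    fix h assume "h \<noteq> g"
    then show "f h g = 0" using f(1)[of h] unfolding degree_part_def by auto
  qed
  finally show "f g = homog g (A g)"
    using f(1)[of g] unfolding degree_part_def homog_def by (auto simp: fun_eq_iff)
qed

lemma graded_subspace_degree_part:
  assumes "fam.subspace S" "S \<subseteq> gen_fields" "\<And>A g. A \<in> S \<Longrightarrow> homog g (A g) \<in> S"
  shows "graded_subspace fs S (degree_part S)"
proof (unfold_locales)
  show "fam.subspace S" by (rule assms(1))
  show "fam.subspace (degree_part S g)" for g
  proof (rule subspace_linearI)
    show "0 \<in> degree_part S g" unfolding degree_part_def using fam.subspace_0[OF assms(1)] by simp
    fix k A B assume "A \<in> degree_part S g" "B \<in> degree_part S g"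
    then show "fs k A + B \<in> degree_part S g"
      unfolding degree_part_def using fam.subspace_add[OF assms(1) fam.subspace_scale[OF assms(1)]]
      by (auto simp: field_scale_def fun_eq_iff)
  qed
  show "degree_part S g \<subseteq> S" for g unfolding degree_part_def by auto
  fix A assume A: "A \<in> S"
  have "homog g (A g) \<in> degree_part S g" for g
    unfolding degree_part_def using assms(3)[OF A] by (simp add: homog_apply)
  moreover have "finite {g. A g \<noteq> 0}" using A assms(2) Vc_finite by blast
  ultimately have "decomposes (degree_part S) (\<lambda>g. homog g (A g)) A" by (intro decomposes_homog)
  then show "\<exists>!f. decomposes (degree_part S) f A" using decomposes_degree_unique by blast
qed

lemma homog_Vc: "A \<in> gen_fields \<Longrightarrow> homog g (A g) \<in> gen_fields"
  using homog_deg[OF Vc_cl] degD(1) by blast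

text \<open>Generated fields now become vectors: \<open>'g\<close> acts on itself by translation,
  with \<open>form\<close> in the role of \<open>formS\<close>. This makes the theory of fields,
  products and the Jacobi identity available for the operators \<open>Yv A\<close>.\<close>

sublocale V: field_setting form c "(+)" form fs gen_fields deg
proof -
  have "gset_data form c (+) form"
  proof (unfold_locales)
    fix g1 g2 g3 s
    have "cong2 (form (g1 + g2) (g3 + s)) (form (g1 + g2) g3 + form (g1 + g2) s)" by (rule form_add_right)
    moreover have "cong2 (form (g1 + g2) g3 + form (g1 + g2) s) ((form g1 g3 + form g2 g3) + (form g1 s + form g2 s))"
      by (intro cong2_add form_add_left)
    ultimately show "cong2 (form (g1 + g2) (g3 + s)) (form g1 g3 + form g2 g3 + form g1 s + form g2 s)"
      using cong2_trans by (simp add: add.assoc)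
  qed (simp_all add: add.assoc)
  moreover have "graded_subspace fs gen_fields deg"
    by (rule graded_subspace_degree_part[OF subspace_Vc order_refl]) (rule homog_Vc)
  ultimately show "field_setting form c (+) form fs gen_fields deg"
    unfolding field_setting_def by simp
qed

lemma fam_prod_homog:
  assumes "A \<in> deg g" "B \<in> deg h"
  shows "fam_prod A n B = homog (g + h) (fprod g (A g) n h (B h))"
proof
  fix k
  have "fprod g' (A g') n (k - g') (B (k - g')) = 0" if "g' \<noteq> g" for g'
    using degD(2)[OF assms(1) that] fprod_zero_left_field[OF cl_gf[OF Vc_cl[OF degD(1)[OF assms(2)]]]] by simp
  then have eq: "fam_prod A n B k = fprod g (A g) n (k - g) (B (k - g))"
    unfolding field_family_prod_def by (rule Sum_any_single)
  show "fam_prod A n B k = homog (g + h) (fprod g (A g) n h (B h)) k"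
  proof (cases "k = g + h")
    case False
    then have "k - g \<noteq> h" by (auto simp: diff_eq_eq add.commute)
    then have "B (k - g) = 0" by (rule degD(2)[OF assms(2)])
    then show ?thesis unfolding eq using False fprod_zero_right_field[OF cl_gf[OF deg_cl[OF assms(1)]]]
      by (simp add: homog_apply)
  next
    case True
    then have "k - g = h" by simp
    then show ?thesis unfolding eq using True by (simp only: homog_apply)
  qed
qed

lemma fam_prod_deg: "A \<in> deg g \<Longrightarrow> B \<in> deg h \<Longrightarrow> fam_prod A n B \<in> deg (g + h)"
  unfolding fam_prod_homog by (intro homog_deg cl_prod deg_cl)

lemma fam_prod_finite:
  assumes "A \<in> gen_fields" "B \<in> gen_fields"
  shows "finite {g. fprod g (A g) n (k - g) (B (k - g)) \<noteq> 0}"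
  by (rule finite_subset[OF _ Vc_finite[OF assms(1)]])
    (auto simp: fprod_zero_left_field[OF cl_gf[OF Vc_cl[OF assms(2)]]])

lemma fam_prod_linear_left:
  assumes "A \<in> gen_fields" "A' \<in> gen_fields" "B \<in> gen_fields"
  shows "fam_prod (fs k A + A') n B = fs k (fam_prod A n B) + fam_prod A' n B"
proof
  fix l
  have "fprod g ((fs k A + A') g) n (l - g) (B (l - g)) =
      (\<lambda>p w. sc k (fprod g (A g) n (l - g) (B (l - g)) p w)) + fprod g (A' g) n (l - g) (B (l - g))" for g
  proof -
    note cls = Vc_cl[OF assms(1), of g] Vc_cl[OF assms(2), of g] Vc_cl[OF assms(3), of "l - g"]
    have eq: "(fs k A + A') g = (\<lambda>p w. sc k (A g p w) + A' g p w)" by (simp add: field_scale_def plus_fun_def)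
    show ?thesis
      unfolding eq using fprod_linear_left[OF cl_gf[OF cls(1)] cl_gf[OF cls(2)] cl_gf[OF cls(3)]
          cl_wcf[OF cls(1,3)] cl_wcf[OF cls(2,3)]] by (simp add: fun_eq_iff)
  qed
  moreover have "finite {g. (\<lambda>p w. sc k (fprod g (A g) n (l - g) (B (l - g)) p w)) \<noteq> 0}"
    by (rule finite_subset[OF _ fam_prod_finite[OF assms(1,3)]]) (auto simp: fun_eq_iff)
  ultimately show "fam_prod (fs k A + A') n B l = (fs k (fam_prod A n B) + fam_prod A' n B) l"
    unfolding field_family_prod_def
    by (simp add: Sum_any.distrib fam_prod_finite[OF assms(2,3)] ser.scale_Sum_any[symmetric] field_scale_def)
qed

lemma fam_prod_linear_right:
  assumes "A \<in> gen_fields" "B \<in> gen_fields" "B' \<in> gen_fields"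
  shows "fam_prod A n (fs k B + B') = fs k (fam_prod A n B) + fam_prod A n B'"
proof
  fix l
  have "fprod g (A g) n (l - g) ((fs k B + B') (l - g)) =
      (\<lambda>p w. sc k (fprod g (A g) n (l - g) (B (l - g)) p w)) + fprod g (A g) n (l - g) (B' (l - g))" for g
  proof -
    note cls = Vc_cl[OF assms(1), of g] Vc_cl[OF assms(2), of "l - g"] Vc_cl[OF assms(3), of "l - g"]
    have eq: "(fs k B + B') (l - g) = (\<lambda>p w. sc k (B (l - g) p w) + B' (l - g) p w)" by (simp add: field_scale_def plus_fun_def)
    show ?thesis
      unfolding eq using fprod_linear_right[OF cl_gf[OF cls(1)] cl_gf[OF cls(2)] cl_gf[OF cls(3)]
          cl_wcf[OF cls(1,2)] cl_wcf[OF cls(1,3)]] by (simp add: fun_eq_iff)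
  qed
  moreover have "finite {g. (\<lambda>p w. sc k (fprod g (A g) n (l - g) (B (l - g)) p w)) \<noteq> 0}"
    by (rule finite_subset[OF _ fam_prod_finite[OF assms(1,2)]]) (auto simp: fun_eq_iff)
  ultimately show "fam_prod A n (fs k B + B') l = (fs k (fam_prod A n B) + fam_prod A n B') l"
    unfolding field_family_prod_def
    by (simp add: Sum_any.distrib fam_prod_finite[OF assms(1,3)] ser.scale_Sum_any[symmetric] field_scale_def)
qed

lemma fam_prod_zero: "A \<in> gen_fields \<Longrightarrow> fam_prod A n 0 = 0" "B \<in> gen_fields \<Longrightarrow> fam_prod 0 n B = 0"
  using fam_prod_linear_right[OF _ zero_Vc zero_Vc, where k = "-1" and n = n and A = A]
    fam_prod_linear_left[OF zero_Vc zero_Vc, where k = "-1" and n = n and B = B] by simp_all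

lemma linear_map_onI:
  assumes "\<And>k A B. A \<in> S \<Longrightarrow> B \<in> S \<Longrightarrow> f (fs k A + B) = sc2 k (f A) + f B"
    and "vector_space sc2" "fam.subspace S"
  shows "linear_map_on fs S sc2 f"
proof -
  interpret t: vector_space sc2 by fact
  have 0: "f 0 = 0" using assms(1)[of 0 0 "-1"] fam.subspace_0[OF assms(3)] by simp
  have "f (A + B) = f A + f B" if "A \<in> S" "B \<in> S" for A B using assms(1)[OF that, of 1] by simp
  moreover have "f (fs k A) = sc2 k (f A)" if "A \<in> S" for k A
    using assms(1)[OF that fam.subspace_0[OF assms(3)], of k] 0 by simp
  ultimately show ?thesis unfolding linear_map_on_def by blast
qed

lemma Y_linear_right: "A \<in> gen_fields \<Longrightarrow> linear_map_on fs gen_fields fs (Yv A p)"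
  unfolding field_Y_def by (rule linear_map_onI[OF fam_prod_linear_right vs_fs subspace_Vc])

lemma Y_linear_left: "B \<in> gen_fields \<Longrightarrow> linear_map_on fs gen_fields fs (\<lambda>A. Yv A p B)"
  unfolding field_Y_def by (rule linear_map_onI[OF fam_prod_linear_left vs_fs subspace_Vc])

section \<open>Vertex operators as fields on the algebra\<close>

lemma Y_homog: "A \<in> deg g \<Longrightarrow> B \<in> deg h \<Longrightarrow> Yv A p B = homog (g + h) (yp g (A g) h (B h) p)"
  unfolding field_Y_def by (rule fam_prod_homog)

lemma Y_deg: "A \<in> deg g \<Longrightarrow> B \<in> deg h \<Longrightarrow> Yv A p B \<in> deg (g + h)"
  unfolding field_Y_def by (rule fam_prod_deg)

lemma Y_gf:
  assumes A: "A \<in> deg g" shows "V.gf g (Yv A)"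
  unfolding graded_field_def
proof (intro conjI allI ballI impI)
  show "linear_map_on fs gen_fields fs (Yv A p)" for p by (rule Y_linear_right[OF degD(1)[OF A]])
  show "Yv A p B \<in> deg (g + h)" if "B \<in> deg h" for h B p by (rule Y_deg[OF A that])
  show "form g h + p \<in> \<int>" if B: "B \<in> deg h" and nz: "Yv A p B \<noteq> 0" for h B p
  proof (rule ccontr)
    assume ni: "form g h + p \<notin> \<int>"
    have "- p - 1 - form g h \<notin> \<int>"
    proof
      assume i: "- p - 1 - form g h \<in> \<int>"
      have "- (- p - 1 - form g h) - 1 \<in> \<int>" by (rule Ints_diff[OF Ints_minus[OF i] Ints_1])
      moreover have "- (- p - 1 - form g h) - 1 = form g h + p" by simp
      ultimately show False using ni by (simp only:)
    qed
    then have "fprod g (A g) (- p - 1) h (B h) = 0" by (intro ext) (simp add: fprod_nonint)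
    then show False using nz unfolding Y_homog[OF A B] by (simp add: homog_0)
  qed
  fix h B assume B: "B \<in> deg h"
  note cls = deg_cl[OF A] deg_cl[OF B]
  obtain K where K: "wc_bound g (A g) h (B h) K" using cl_wcf[OF cls] unfolding weakly_commute_def by blast
  show "\<exists>R. \<forall>p. Re p < R \<longrightarrow> Yv A p B = 0"
  proof (intro exI allI impI)
    \<comment> \<open>If the index \<open>- p - 1\<close> equals \<open>form g h + of_int N\<close>,
      then below this real part \<open>N\<close> is at least \<open>K\<close>.\<close>
    fix p assume p: "Re p < - 1 - Re (form g h) - of_int K"
    have "fprod g (A g) (- p - 1) h (B h) = 0"
    proof (rule gf_eqI)
      show "gf (g + h) (fprod g (A g) (- p - 1) h (B h))" by (rule cl_gf[OF cl_prod[OF cls]])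
      show "gf (g + h) 0" by (rule cl_gf[OF cl_zero])
      fix s w q assume w: "w \<in> W s"
      show "fprod g (A g) (- p - 1) h (B h) q w = 0 q w"
      proof (rule fprod_cases[of "- p - 1" g h])
        fix N assume N: "- p - 1 = form g h + of_int N"
        have "- Re p - 1 = Re (form g h) + of_int N" using arg_cong[OF N, of Re] by simp
        then have "K \<le> N" using p by linarith
        then show "iprod g (A g) h (B h) N q w = 0 q w"
          using fprod_top[OF cl_gf[OF cls(1)] cl_gf[OF cls(2)] K _ w] by simp
      qed (simp add: fprod_nonint)
    qed
    then show "Yv A p B = 0" unfolding Y_homog[OF A B] by (simp add: homog_0)
  qed
qed

text \<open>Evaluation at \<open>g\<close>, \<open>p\<close> and \<open>w\<close> may be taken
  inside because the sum of families is itself finite, not merely each of its values.\<close>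

lemma binom_mult_fs_apply:
  assumes "diag_truncated F"
  shows "binom_mult fs \<epsilon> \<alpha> F P Q g p w = bm \<epsilon> \<alpha> (\<lambda>P Q. F P Q g p w) P Q"
proof -
  obtain B where B: "\<And>i. i \<ge> B \<Longrightarrow> F (P - \<alpha> + of_nat i) (Q - of_nat i) = 0"
    using assms unfolding diag_truncated_def by blast
  have "binom_mult fs \<epsilon> \<alpha> F P Q = (\<Sum>i<B. fs ((\<alpha> gchoose i) * \<epsilon> ^ i) (F (P - \<alpha> + of_nat i) (Q - of_nat i)))"
    unfolding binom_mult_def by (rule Sum_any_bounded) (simp add: B)
  moreover have "bm \<epsilon> \<alpha> (\<lambda>P Q. F P Q g p w) P Q =
      (\<Sum>i<B. sc ((\<alpha> gchoose i) * \<epsilon> ^ i) (F (P - \<alpha> + of_nat i) (Q - of_nat i) g p w))"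
    unfolding binom_mult_def by (rule Sum_any_bounded) (simp add: B)
  ultimately show ?thesis by (simp add: sum_fun_apply field_scale_def)
qed

text \<open>The bound \<open>K\<close> for the two fields on \<open>W\<close> is also one for their
  vertex operators. Vanishing is tested in the single degree where the gap can be nonzero, one
  coefficient and one homogeneous vector of \<open>W\<close> at a time.\<close>

lemma Y_wcf:
  assumes A: "A \<in> deg g" and B: "B \<in> deg h"
  shows "V.weakly_commute g (Yv A) h (Yv B)"
proof -
  note cls = deg_cl[OF A] deg_cl[OF B]
  note YA = Y_gf[OF A] and YB = Y_gf[OF B]
  obtain K where K: "wc_bound g (A g) h (B h) K" using cl_wcf[OF cls] unfolding weakly_commute_def by blast
  let ?\<kappa> = "c g h * (-1) powi K"
  let ?n = "form g h + of_int K"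
  have gap: "\<forall>s. \<forall>w\<in>W s. \<forall>p q. gc ?\<kappa> ?n (A g) (B h) w p q = 0"
    using wc_zero[OF K order_refl] unfolding commutator_def by blast
  show ?thesis
  proof (rule V.wcfI[OF YA YB, where K = K])
    fix s E P Q assume E: "E \<in> deg s"
    let ?Z = "V.commutator g (Yv A) h (Yv B) K E P Q"
    let ?m = "g + (h + s)"
    have Z: "?Z \<in> deg ?m"
      using V.gap_coeff_W[OF YA YB E] unfolding V.commutator_def by (simp add: add.assoc)
    have ZE: "?Z ?m q w = bm (-1) ?n (\<lambda>P Q. Yv A P (Yv B Q E) ?m q w) P Q -
        sc ?\<kappa> (bm (-1) ?n (\<lambda>Q P. Yv B Q (Yv A P E) ?m q w) Q P)" for q w
      unfolding V.commutator_def gap_coeff_def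
      by (simp add: binom_mult_fs_apply[OF V.diag_truncated_comp[OF YA YB E]]
          binom_mult_fs_apply[OF V.diag_truncated_comp[OF YB YA E]] field_scale_def[of sc ?\<kappa>])
    have "?Z ?m = 0"
    proof (rule gf_eqI[OF cl_gf[OF deg_cl[OF Z]] cl_gf[OF cl_zero]])
      fix t w q assume w: "w \<in> W t"
      have m: "?m = h + (g + s)" by (simp add: add_ac)
      have 1: "Yv A P (Yv B Q E) ?m q w = yp g (A g) (h + s) (yp h (B h) s (E s) Q) P q w" for P Q
        by (simp only: Y_homog[OF A Y_deg[OF B E]] homog_apply) (simp only: Y_homog[OF B E] homog_apply)
      have 2: "Yv B Q (Yv A P E) ?m q w = yp h (B h) (g + s) (yp g (A g) s (E s) P) Q q w" for P Q
        unfolding m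
        by (simp only: Y_homog[OF B Y_deg[OF A E]] homog_apply) (simp only: Y_homog[OF A E] homog_apply)
      note e = deg_cl[OF E]
      show "?Z ?m q w = 0 q w"
        unfolding ZE 1 2
        using vertex_operators_commute[OF cl_gf[OF cls(1)] cl_gf[OF cls(2)] cl_gf[OF e]
            cl_wcf[OF cls] cl_wcf[OF cls(1) e] cl_wcf[OF cls(2) e] gap w, where P = P and q = q and Q = Q] by simp
    qed
    then show "?Z = 0" using deg_homog[OF Z] by (simp add: homog_0)
  qed
qed

text \<open>The coefficient of \<open>x^j\<close> in \<open>Y(e, x)\<close> applied to the vacuum,
  which \<open>deriv_taylor\<close> shows to be the \<open>j\<close>-th divided derivative of
  \<open>e\<close>. In this form it is visibly a generated field.\<close>

definition taylor :: "'g \<Rightarrow> (complex \<Rightarrow> 'w \<Rightarrow> 'w) \<Rightarrow> nat \<Rightarrow> complex \<Rightarrow> 'w \<Rightarrow> 'w" where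
  "taylor g e j = yp g e 0 idf (of_nat j)"

lemma taylor_cl: "generated g e \<Longrightarrow> generated g (taylor g e j)"
  unfolding taylor_def using cl_prod[OF _ cl_id, of g e "- of_nat j - 1"] by simp

lemma taylor_0: assumes "generated g e" shows "taylor g e 0 = e"
  by (rule gf_eqI[OF cl_gf[OF taylor_cl[OF assms]] cl_gf[OF assms]])
    (unfold taylor_def of_nat_0, rule yp_id_right_0[OF cl_gf[OF assms]])

text \<open>This is \<open>fprod_deriv\<close> with the identity field on the right, whose
  derivative is zero.\<close>

lemma deriv_taylor:
  assumes e: "generated g e"
  shows "deriv_field (taylor g e j) p w = sc (of_nat (Suc j)) (taylor g e (Suc j) p w)"
proof -
  have "deriv_field idf = 0" unfolding deriv_field_def by (auto simp: fun_eq_iff add_eq_0_iff)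
  then have "0 = deriv_field (taylor g e j) p w + sc (- of_nat j - 1) (fprod g e (- of_nat j - 1 - 1) 0 idf p w)"
    using fprod_deriv[OF cl_gf[OF e] gf_id cl_wcf[OF e cl_id], of w "- of_nat j - 1" p]
      fprod_zero_right_field[OF cl_gf[OF e]]
    unfolding taylor_def by simp
  moreover have "- of_nat j - 1 - 1 = - of_nat (Suc j) - (1 :: complex)" by simp
  moreover have "- of_nat j - 1 = - (of_nat (Suc j) :: complex)" by simp
  ultimately have "0 = deriv_field (taylor g e j) p w + sc (- of_nat (Suc j)) (taylor g e (Suc j) p w)"
    unfolding taylor_def by (simp only:)
  then show ?thesis by (simp del: of_nat_Suc)
qed

text \<open>Divided Leibniz rule: by \<open>fprod_deriv\<close> each derivative either falls on
  \<open>b\<close> or lowers the index of the product by one.\<close>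

lemma taylor_fprod:
  assumes a: "generated g a" and b: "generated h b"
  shows "taylor (g + h) (fprod g a n h b) l p w =
    (\<Sum>i\<le>l. sc (sgb n i) (fprod g a (n - of_nat i) h (taylor h b (l - i)) p w))"
proof (induction l arbitrary: p w)
  case 0
  show ?case by (simp add: taylor_0 b cl_prod[OF a b])
next
  case (Suc l)
  let ?G = "\<lambda>i. fprod g a (n - of_nat i) h (taylor h b (Suc l - i)) p w"
  have "sc (of_nat (Suc l)) (taylor (g + h) (fprod g a n h b) (Suc l) p w) =
      deriv_field (taylor (g + h) (fprod g a n h b) l) p w"
    by (simp only: deriv_taylor[OF cl_prod[OF a b]])
  also have "\<dots> = (\<Sum>i\<le>l. sc (sgb n i) (deriv_field (fprod g a (n - of_nat i) h (taylor h b (l - i))) p w))"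
    unfolding deriv_field_def Suc by (simp add: scale_sum_right mult.commute)
  also have "\<dots> = (\<Sum>i\<le>l. sc (of_nat (Suc l - i) * sgb n i) (?G i) + sc (of_nat (Suc i) * sgb n (Suc i)) (?G (Suc i)))"
  proof (rule sum.cong[OF refl])
    fix i assume i: "i \<in> {..l}"
    note t = taylor_cl[OF b, of "l - i"]
    have Suc_i: "Suc (l - i) = Suc l - i" using i by auto
    have "deriv_field (taylor h b (l - i)) = (\<lambda>p w. sc (of_nat (Suc l - i)) (taylor h b (Suc l - i) p w) + 0 p w)"
      by (intro ext) (simp only: deriv_taylor[OF b] Suc_i zero_fun_def add_0_right)
    then have "fprod g a (n - of_nat i) h (deriv_field (taylor h b (l - i))) p w = sc (of_nat (Suc l - i)) (?G i)"
      using fprod_linear_right[OF cl_gf[OF a] cl_gf[OF taylor_cl[OF b]] cl_gf[OF cl_zero]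
          cl_wcf[OF a taylor_cl[OF b]] cl_wcf[OF a cl_zero], of w]
        fprod_zero_right_field[OF cl_gf[OF a]] by simp
    moreover have "fprod g a (n - of_nat i) h (deriv_field (taylor h b (l - i))) p w =
        deriv_field (fprod g a (n - of_nat i) h (taylor h b (l - i))) p w + sc (n - of_nat i) (?G (Suc i))"
      using fprod_deriv[OF cl_gf[OF a] cl_gf[OF t] cl_wcf[OF a t], of w "n - of_nat i" p]
      by (simp add: diff_diff_eq add.commute)
    ultimately have "deriv_field (fprod g a (n - of_nat i) h (taylor h b (l - i))) p w =
        sc (of_nat (Suc l - i)) (?G i) - sc (n - of_nat i) (?G (Suc i))"
      by (simp add: eq_diff_eq)
    moreover have "of_nat (Suc i) * sgb n (Suc i) = - (sgb n i * (n - of_nat i))"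
    proof -
      have "of_nat (Suc i) * sgb n (Suc i) = - ((-1) ^ i) * (of_nat (Suc i) * (n gchoose Suc i))"
        by (simp del: of_nat_Suc)
      also have "of_nat (Suc i) * (n gchoose Suc i) = (n - of_nat i) * (n gchoose i)"
        unfolding gbinomial_absorption gbinomial_absorb_comp ..
      finally show ?thesis by simp
    qed
    ultimately show "sc (sgb n i) (deriv_field (fprod g a (n - of_nat i) h (taylor h b (l - i))) p w) =
        sc (of_nat (Suc l - i) * sgb n i) (?G i) + sc (of_nat (Suc i) * sgb n (Suc i)) (?G (Suc i))"
      by (simp only: scale_right_distrib scale_minus_right scale_scale scale_minus_left mult.commute diff_conv_add_uminus)
  qed
  also have "\<dots> = (\<Sum>i\<le>Suc l. sc (of_nat (Suc l - i) * sgb n i) (?G i)) + (\<Sum>i\<le>Suc l. sc (of_nat i * sgb n i) (?G i))"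
    unfolding sum.distrib sum.atMost_Suc_shift[of "\<lambda>i. sc (of_nat i * sgb n i) (?G i)"] by simp
  also have "\<dots> = (\<Sum>i\<le>Suc l. sc (of_nat (Suc l)) (sc (sgb n i) (?G i)))"
    unfolding sum.distrib[symmetric]
  proof (rule sum.cong[OF refl])
    fix i assume "i \<in> {..Suc l}"
    then have "of_nat (Suc l - i) * sgb n i + of_nat i * sgb n i = of_nat (Suc l) * sgb n i"
      unfolding distrib_right[symmetric] of_nat_add[symmetric] by simp
    then show "sc (of_nat (Suc l - i) * sgb n i) (?G i) + sc (of_nat i * sgb n i) (?G i) = sc (of_nat (Suc l)) (sc (sgb n i) (?G i))"
      by (simp only: scale_scale scale_left_distrib[symmetric])
  qed
  finally show ?case unfolding scale_sum_right[symmetric]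
    by (simp only: scale_cancel_left of_nat_eq_0_iff nat.distinct simp_thms)
qed

section \<open>The vacuum and the action on it\<close>

lemma vac_deg: "id_field \<in> deg 0"
  unfolding id_field_def by (rule homog_deg[OF cl_id])

lemma Y_vac_right: "A \<in> deg g \<Longrightarrow> Yv A P id_field = homog g (yp g (A g) 0 idf P)"
  using Y_homog[OF _ vac_deg, of A g P] by (simp add: id_field_def homog_apply)

lemma Y_vac_right_nat: "A \<in> deg g \<Longrightarrow> Yv A (of_nat j) id_field = homog g (taylor g (A g) j)"
  unfolding taylor_def by (rule Y_vac_right)

lemma Y_vac_right_0: "A \<in> deg g \<Longrightarrow> Yv A 0 id_field = A"
  using Y_vac_right_nat[of A g 0] deg_homog[of A g] by (simp add: taylor_0 deg_cl)

lemma Y_vac_right_nonnat: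
  assumes A: "A \<in> deg g" and P: "P \<notin> \<nat>" shows "Yv A P id_field = 0"
proof -
  note a = deg_cl[OF A]
  have "yp g (A g) 0 idf P = 0"
  proof (rule gf_eqI[OF fprod_gf[OF cl_gf[OF a] gf_id cl_wcf[OF a cl_id]] cl_gf[OF cl_zero]])
    show "yp g (A g) 0 idf P p w = 0 p w" if "w \<in> W s" for s w p
      using yp_id_right_nonnat[OF cl_gf[OF a] that P] by simp
  qed
  then show ?thesis unfolding Y_vac_right[OF A] by (simp add: homog_0)
qed

lemma not_Nats_diff: "P \<notin> \<nat> \<Longrightarrow> P - of_nat i \<notin> \<nat>" for P :: complex
  using Nats_add[of "P - of_nat i" "of_nat i"] by auto

lemma not_Nats_minus: "i > 0 \<Longrightarrow> - of_nat i \<notin> (\<nat> :: complex set)"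
proof
  assume i: "i > 0" and "- of_nat i \<in> (\<nat> :: complex set)"
  then obtain j where "- of_nat i = (of_nat j :: complex)" by (auto elim: Nats_cases)
  then have "(of_nat (i + j) :: complex) = 0" by (simp add: neg_eq_iff_add_eq_0)
  then show False using i unfolding of_nat_eq_0_iff by simp
qed

text \<open>On the vacuum the first exponent -1 is admissible and makes the Jacobi sum collapse to
  one product. There \<open>Y(A)\<close> has no negative exponents, so one term of the gap
  disappears, and \<open>taylor_fprod\<close> evaluates the other.\<close>

lemma fprod_vac:
  assumes A: "A \<in> deg g" and B: "B \<in> deg h"
  shows "V.iprod g (Yv A) h (Yv B) N Q id_field = Yv (fam_prod A (form g h + of_int N) B) Q id_field"
proof -
  let ?n = "form g h + of_int N"
  note a = deg_cl[OF A] and b = deg_cl[OF B]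
  note YA = Y_gf[OF A] and YB = Y_gf[OF B]
  note AB = fam_prod_deg[OF A B, of ?n]
  obtain K where K: "V.wc_bound g (Yv A) h (Yv B) K" using Y_wcf[OF A B] unfolding V.weakly_commute_def by blast
  have "form g 0 - 0 - 1 \<in> \<int>" by (intro Ints_diff[OF cong2_Ints[OF form_0_right]] Ints_1)
  then have p: "form g 0 + (- 1) \<in> \<int>" by simp
  have "V.commutator g (Yv A) h (Yv B) N id_field (- 1) Q =
      Sum_any (\<lambda>j::nat. fs (- 1 - (- 1) gchoose j) (V.iprod g (Yv A) h (Yv B) (N + int j) (Q + 1 + (- 1) + of_nat j) id_field))"
    by (rule V.jacobi_identity[OF YA YB K vac_deg p])
  also have "\<dots> = V.iprod g (Yv A) h (Yv B) N Q id_field"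
    by (subst Sum_any_single[of 0]) (auto simp: gbinomial_0_left)
  finally have "V.iprod g (Yv A) h (Yv B) N Q id_field = V.commutator g (Yv A) h (Yv B) N id_field (- 1) Q" by simp
  also have "\<dots> = Sum_any (\<lambda>i::nat. fs (sgb ?n i) (Yv A (- 1 - ?n + of_nat i) (Yv B (Q - of_nat i) id_field)))"
  proof -
    have "Yv A (- 1 - of_nat i) id_field = 0" for i
    proof (rule Y_vac_right_nonnat[OF A])
      have "- 1 - of_nat i = - (of_nat (Suc i) :: complex)" by simp
      then show "- 1 - of_nat i \<notin> (\<nat> :: complex set)" using not_Nats_minus[of "Suc i"] by (simp only: zero_less_Suc simp_thms)
    qed
    then show ?thesis unfolding V.commutator_def gap_coeff_def binom_mult_def by (simp add: V.gf_0[OF YB])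
  qed
  also have "\<dots> = Yv (fam_prod A ?n B) Q id_field"
  proof (cases "Q \<in> \<nat>")
    case False
    then show ?thesis
      by (simp add: Y_vac_right_nonnat[OF AB] Y_vac_right_nonnat[OF B not_Nats_diff] V.gf_0[OF YA])
  next
    case True
    then obtain q where q: "Q = of_nat q" by (auto elim: Nats_cases)
    have "Sum_any (\<lambda>i::nat. fs (sgb ?n i) (Yv A (- 1 - ?n + of_nat i) (Yv B (Q - of_nat i) id_field))) =
        (\<Sum>i<Suc q. fs (sgb ?n i) (Yv A (- 1 - ?n + of_nat i) (Yv B (Q - of_nat i) id_field)))"
    proof (rule Sum_any_bounded)
      fix i assume "Suc q \<le> i"
      then have "Q - of_nat i = - (of_nat (i - q) :: complex)" "i - q > 0" unfolding q by (simp_all add: of_nat_diff)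
      then have "Yv B (Q - of_nat i) id_field = 0"
        using Y_vac_right_nonnat[OF B not_Nats_minus[of "i - q"]] by (simp only:)
      then show "fs (sgb ?n i) (Yv A (- 1 - ?n + of_nat i) (Yv B (Q - of_nat i) id_field)) = 0"
        by (simp only: V.gf_0[OF YA] fam.scale_zero_right)
    qed
    also have "\<dots> = (\<Sum>i\<le>q. fs (sgb ?n i) (homog (g + h) (fprod g (A g) (?n - of_nat i) h (taylor h (B h) (q - i)))))"
      unfolding lessThan_Suc_atMost
    proof (rule sum.cong[OF refl])
      fix i assume "i \<in> {..q}"
      then have "Q - of_nat i = of_nat (q - i)" unfolding q by (simp add: of_nat_diff)
      moreover have "- (- 1 - ?n + of_nat i) - 1 = ?n - of_nat i" by simp
      ultimately show "fs (sgb ?n i) (Yv A (- 1 - ?n + of_nat i) (Yv B (Q - of_nat i) id_field)) =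
          fs (sgb ?n i) (homog (g + h) (fprod g (A g) (?n - of_nat i) h (taylor h (B h) (q - i))))"
        using Y_homog[OF A homog_deg[OF taylor_cl[OF b]], of "- 1 - ?n + of_nat i" "q - i"]
        by (simp only: Y_vac_right_nat[OF B] homog_apply)
    qed
    also have "\<dots> = homog (g + h) (taylor (g + h) (fprod g (A g) ?n h (B h)) q)"
      by (intro ext) (simp add: sum_fun_apply field_scale_def homog_def taylor_fprod[OF a b])
    also have "\<dots> = Yv (fam_prod A ?n B) Q id_field"
      unfolding q Y_vac_right_nat[OF AB] by (simp add: fam_prod_homog[OF A B] homog_apply)
    finally show ?thesis .
  qed
  finally show ?thesis .
qed

lemma Y_prod:
  assumes A: "A \<in> deg g" and B: "B \<in> deg h" and E: "E \<in> deg s"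
  shows "V.fprod g (Yv A) n h (Yv B) P E = Yv (fam_prod A n B) P E"
proof (rule V.fprod_cases[of n g h])
  assume ni: "n - form g h \<notin> \<int>"
  have "fprod g (A g) n h (B h) = 0" by (intro ext) (simp add: fprod_nonint[OF ni])
  then have "fam_prod A n B = 0" unfolding fam_prod_homog[OF A B] by (simp add: homog_0)
  then show ?thesis using V.fprod_nonint[OF ni] fam_prod_zero(2)[OF degD(1)[OF E]] by (simp add: field_Y_def)
next
  fix N
  let ?n = "form g h + of_int N"
  note YA = Y_gf[OF A] and YB = Y_gf[OF B] and YE = Y_gf[OF E]
  note AB = fam_prod_deg[OF A B, of ?n]
  note P = V.fprod_gf[OF YA YB Y_wcf[OF A B], of ?n]
  let ?d = "\<lambda>p E. fs (- 1) (Yv (fam_prod A ?n B) p E) + V.iprod g (Yv A) h (Yv B) N p E"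
  \<comment> \<open>Every homogeneous \<open>E\<close> is the constant term of \<open>Yv E\<close>
    on the vacuum, so the difference \<open>?d\<close>, which kills the vacuum, kills
    \<open>E\<close>.\<close>
  have "?d P (Yv E 0 id_field) = 0"
  proof (rule V.uniqueness[of "g + h" ?d s "Yv E" id_field 0])
    show "V.gf (g + h) ?d" by (rule V.gf_linear[OF Y_gf[OF AB] P])
    show "V.weakly_commute (g + h) ?d s (Yv E)"
      by (rule V.wcf_linear_left[OF Y_gf[OF AB] P YE Y_wcf[OF AB E]
            V.wcf_fprod[OF YA YB YE Y_wcf[OF A B] Y_wcf[OF A E] Y_wcf[OF B E]]])
    show "?d q id_field = 0" for q unfolding fprod_vac[OF A B] by simp
    show "Yv E (- of_nat i) id_field = 0" if "i > 0" for i
      by (rule Y_vac_right_nonnat[OF E not_Nats_minus[OF that]])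
  qed (use YE vac_deg in auto)
  then show "V.iprod g (Yv A) h (Yv B) N P E = Yv (fam_prod A ?n B) P E"
    unfolding Y_vac_right_0[OF E] by simp
qed

lemma Y_jacobi:
  assumes A: "A \<in> deg g" and B: "B \<in> deg h" and E: "E \<in> deg s"
  shows "jacobi_lhs fs (form g h) (c g h) (Yv A) (Yv B) E = jacobi_rhs fs (form g s) Yv Yv A B E"
proof
  fix e :: exps
  obtain e0 e1 e2 where e: "e = (e0, e1, e2)" by (cases e)
  have "V.yp g (Yv A) h (Yv B) (e0 - of_nat i) q E = Yv (Yv A (e0 - of_nat i) B) q E" for i :: nat and q
    unfolding Y_prod[OF A B E] field_Y_def[of _ _ _ _ _ A] ..
  then show "jacobi_lhs fs (form g h) (c g h) (Yv A) (Yv B) E e = jacobi_rhs fs (form g s) Yv Yv A B E e"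
    unfolding e V.jacobi_lhs_eq[OF Y_gf[OF A] Y_gf[OF B] Y_wcf[OF A B] E]
    by (simp add: fam.jacobi_rhs_coeff fam.jacobi_rhs_eq_0)
qed

end

section \<open>The generated generalized vertex algebra\<close>

context field_setting
begin

lemma gf_lower_C:
  assumes "gf g a" "w \<in> C"
  shows "\<exists>R. \<forall>p. Re p < R \<longrightarrow> a p w = 0"
  using assms(2)
proof (induction rule: C_induct)
  case zero
  show ?case using gf_0[OF assms(1)] by blast
next
  case (add s y z)
  obtain R where R: "\<And>p. Re p < R \<Longrightarrow> a p y = 0" using gf_lower[OF assms(1) add(1)] by blast
  obtain R' where R': "\<And>p. Re p < R' \<Longrightarrow> a p z = 0" using add(3) by blast
  show ?case
    by (rule exI[of _ "min R R'"]) (simp add: gf_add[OF assms(1) W_C[OF add(1)] add(2)] R R')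
qed

lemma gf_lower_truncated:
  assumes a: "gf g a" and w: "w \<in> C"
  shows "\<exists>A. finite A \<and> (\<forall>p. a p w \<noteq> 0 \<longrightarrow> (\<exists>\<alpha>\<in>A. \<exists>m::nat. p = \<alpha> + of_nat m))"
  using w
proof (induction rule: C_induct)
  case zero
  show ?case using gf_0[OF a] by (intro exI[of _ "{}"]) simp
next
  case (add s y z)
  obtain R where R: "\<And>p. Re p < R \<Longrightarrow> a p y = 0" using gf_lower[OF a add(1)] by blast
  obtain A where A: "finite A" "\<And>p. a p z \<noteq> 0 \<Longrightarrow> \<exists>\<alpha>\<in>A. \<exists>m::nat. p = \<alpha> + of_nat m" using add(3) by blast
  \<comment> \<open>The smallest integer for which \<open>of_int ?k - formS g s\<close> has real
    part at least \<open>R\<close>.\<close>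
  let ?k = "\<lceil>R + Re (formS g s)\<rceil>"
  let ?\<alpha> = "of_int ?k - formS g s"
  have "\<exists>m::nat. p = ?\<alpha> + of_nat m" if p: "a p y \<noteq> 0" for p
  proof -
    obtain m where m: "formS g s + p = of_int m" using gf_Ints[OF a add(1) p] by (auto elim: Ints_cases)
    have "Re p \<ge> R" using R p by force
    moreover have "Re (formS g s) + Re p = of_int m" using arg_cong[OF m, of Re] by simp
    ultimately have "?k \<le> m" by linarith
    then have "of_int m = of_int ?k + (of_nat (nat (m - ?k)) :: complex)" by simp
    then have "p = ?\<alpha> + of_nat (nat (m - ?k))" using m by (simp add: algebra_simps)
    then show ?thesis ..
  qed
  then have "\<exists>\<alpha>\<in>insert ?\<alpha> A. \<exists>m::nat. p = \<alpha> + of_nat m" if "a p (y + z) \<noteq> 0" for p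
    using that A(2)[of p] gf_add[OF a W_C[OF add(1)] add(2), of p] by fastforce
  then show ?case using A(1) by (intro exI[of _ "insert ?\<alpha> A"]) blast
qed

lemma field_comp_iff:
  assumes "C = UNIV"
  shows "a \<in> field_comp act formS sc W g \<longleftrightarrow> gf g a"
proof
  have lin: "Vector_Spaces.linear sc sc f \<longleftrightarrow> linear_map_on sc C sc f" for f
    unfolding linear_map_on_def assms Vector_Spaces.linear_iff using vs by auto
  {
    assume a: "a \<in> field_comp act formS sc W g"
    have "\<exists>R. \<forall>p. Re p < R \<longrightarrow> a p w = 0" for w
    proof -
      obtain A where A: "finite A" "\<And>p. a p w \<noteq> 0 \<Longrightarrow> \<exists>\<alpha>\<in>A. \<exists>m::nat. p = \<alpha> + of_nat m"
        using a unfolding field_comp_def lower_truncated_def by blast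
      have "a p w = 0" if p: "Re p < Min (insert 0 (Re ` A))" for p
      proof (rule ccontr)
        assume "a p w \<noteq> 0"
        then obtain \<alpha> m where \<alpha>: "\<alpha> \<in> A" "p = \<alpha> + of_nat m" using A(2) by blast
        have "Min (insert 0 (Re ` A)) \<le> Re \<alpha>" by (rule Min_le) (use A(1) \<alpha>(1) in auto)
        then show False using p \<alpha>(2) by simp
      qed
      then show ?thesis by blast
    qed
    then show "gf g a" using a unfolding field_comp_def graded_field_def lin by blast
  next
    assume a: "gf g a"
    then have "lower_truncated a"
      unfolding lower_truncated_def using gf_lower_truncated[OF a] assms by blast
    then show "a \<in> field_comp act formS sc W g"
      using a unfolding field_comp_def graded_field_def lin by blast
  }
qed

lemma diag_truncated_comp_C:
  assumes "gf g a" "gf h b" "w \<in> C"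
  shows "diag_truncated (\<lambda>p q. a p (b q w))"
  unfolding diag_truncated_def
proof (intro allI)
  fix p q
  obtain R where R: "\<And>q. Re q < R \<Longrightarrow> b q w = 0" using gf_lower_C[OF assms(2,3)] by blast
  obtain L where "\<And>l. l \<ge> L \<Longrightarrow> Re q - real l < R" using nat_bound[of "Re q" R] by blast
  then have "b (q - of_nat l) w = 0" if "l \<ge> L" for l using that by (intro R) simp
  then show "\<exists>B::nat. \<forall>i\<ge>B. a (p + of_nat i) (b (q - of_nat i) w) = 0"
    using gf_0[OF assms(1)] by metis
qed

lemma gf_C: assumes "gf g a" "w \<in> C" shows "a p w \<in> C"
  using assms(2)
  by (induction rule: C_induct)
    (use gf_0[OF assms(1)] zero_C gf_add[OF assms(1) W_C] W_C[OF gf_W[OF assms(1)]]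
      subspace_add[OF carrier_subspace] in auto)

lemma gap_coeff_eq_0_C:
  assumes a: "gf g a" and b: "gf h b" and w: "w \<in> C"
    and 0: "\<And>s w. w \<in> W s \<Longrightarrow> gc \<kappa> n a b w p q = 0"
  shows "gc \<kappa> n a b w p q = 0"
  using w
proof (induction rule: C_induct)
  case zero
  show ?case using 0[OF zero_W] .
next
  case (add s y z)
  note y = W_C[OF add(1)]
  have lin: "a p (b q (y + z)) = a p (b q y) + a p (b q z)" if "gf g a" "gf h b" for a b p q g h
    using gf_add[OF that(2) y add(2)] gf_add[OF that(1) gf_C[OF that(2) y] gf_C[OF that(2) add(2)]] by simp
  have "gc \<kappa> n a b (y + z) p q = gc \<kappa> n a b y p q + gc \<kappa> n a b z p q"
    unfolding gap_coeff_def lin[OF a b] lin[OF b a]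
    using binom_mult_linear[OF diag_truncated_comp_C[OF a b y] diag_truncated_comp_C[OF a b add(2)], where k = 1]
      binom_mult_linear[OF diag_truncated_comp_C[OF b a y] diag_truncated_comp_C[OF b a add(2)], where k = 1]
    by (simp add: scale_right_distrib)
  then show ?case using 0[OF add(1)] add(3) by simp
qed

lemma wcf_weakly_commutative:
  assumes "C = UNIV" "gf g a" "gf h b" "weakly_commute g a h b"
  shows "weakly_commutative form c sc g a h b"
proof -
  obtain K where K: "wc_bound g a h b K" using assms(4) unfolding weakly_commute_def by blast
  \<comment> \<open>A natural exponent is asked for; \<open>K\<close> may be negative, but the gap
    vanishes from \<open>K\<close> upwards.\<close>
  have "gc (c g h * (-1) powi int (nat K)) (form g h + of_int (int (nat K))) a b w p q = 0" for w p q
    by (rule gap_coeff_eq_0_C[OF assms(2,3)])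
      (use wc_zero[OF K, of "int (nat K)"] assms(1) in \<open>auto simp: commutator_def\<close>)
  then show ?thesis unfolding weakly_commutative_iff by blast
qed

end

section \<open>The span of right-nested products\<close>

context field_algebra
begin

definition gens :: "('g, 'w) field_family set" where
  "gens = {foldr (\<lambda>((g, a), n) B. fam_prod (homog g a) n B) ps id_field | ps. \<forall>(x, n)\<in>set ps. x \<in> \<Gamma>}"

definition alg where "alg = generated_space form c formS sc W \<Gamma>"

lemma alg_span: "alg = fam.span gens"
  unfolding alg_def generated_space_def gens_def ..

lemma gens_induct [consumes 1, case_names vac prod]:
  assumes "A \<in> gens" "P id_field"
    "\<And>g a n B. (g, a) \<in> \<Gamma> \<Longrightarrow> B \<in> gens \<Longrightarrow> P B \<Longrightarrow> P (fam_prod (homog g a) n B)"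
  shows "P A"
proof -
  obtain ps where A: "A = foldr (\<lambda>((g, a), n) B. fam_prod (homog g a) n B) ps id_field"
    and ps: "\<forall>(x, n)\<in>set ps. x \<in> \<Gamma>"
    using assms(1) unfolding gens_def by blast
  show ?thesis unfolding A using ps
  proof (induction ps)
    case (Cons x ps)
    obtain g a n where x: "x = ((g, a), n)" by (metis prod.collapse)
    have "foldr (\<lambda>((g, a), n) B. fam_prod (homog g a) n B) ps id_field \<in> gens"
      using Cons.prems unfolding gens_def by auto
    then show ?case using Cons x assms(3) by simp
  qed (simp add: assms(2))
qed

lemma gens_vac: "id_field \<in> gens"
  unfolding gens_def by (rule CollectI, rule exI[of _ "[]"]) simp

lemma gens_prod:
  assumes "(g, a) \<in> \<Gamma>" "B \<in> gens" shows "fam_prod (homog g a) n B \<in> gens"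
proof -
  obtain ps where B: "B = foldr (\<lambda>((g, a), n) B. fam_prod (homog g a) n B) ps id_field"
    and ps: "\<forall>(x, n)\<in>set ps. x \<in> \<Gamma>"
    using assms(2) unfolding gens_def by blast
  show ?thesis unfolding gens_def
    by (rule CollectI, rule exI[of _ "((g, a), n) # ps"]) (use B ps assms(1) in simp)
qed

lemma \<Gamma>_deg: "(g, a) \<in> \<Gamma> \<Longrightarrow> homog g a \<in> deg g"
  by (rule homog_deg[OF cl_base])

lemma gens_deg: assumes "A \<in> gens" obtains g where "A \<in> deg g"
proof -
  have "\<exists>g. A \<in> deg g" using assms
    by (induction rule: gens_induct) (use vac_deg fam_prod_deg[OF \<Gamma>_deg] in blast)+
  then show ?thesis using that by blast
qed

lemma subspace_alg: "fam.subspace alg"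
  unfolding alg_span by (rule fam.subspace_span)

lemma gens_alg: "A \<in> gens \<Longrightarrow> A \<in> alg"
  unfolding alg_span by (rule fam.span_base)

lemma alg_minimal: "gens \<subseteq> T \<Longrightarrow> fam.subspace T \<Longrightarrow> alg \<subseteq> T"
  unfolding alg_span by (rule fam.span_minimal)

lemma alg_Vc: "alg \<subseteq> gen_fields"
  by (rule alg_minimal[OF _ subspace_Vc]) (use gens_deg degD(1) in blast)

text \<open>Each spanning element is homogeneous, and taking a homogeneous part is linear.\<close>

lemma alg_homog: assumes "A \<in> alg" shows "homog g (A g) \<in> alg"
proof -
  have "alg \<subseteq> {A. \<forall>g. homog g (A g) \<in> alg}"
  proof (rule alg_minimal)
    show "gens \<subseteq> {A. \<forall>g. homog g (A g) \<in> alg}"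
    proof (intro subsetI CollectI allI)
      fix A g assume A: "A \<in> gens"
      obtain h where h: "A \<in> deg h" using gens_deg[OF A] by blast
      show "homog g (A g) \<in> alg"
      proof (cases "g = h")
        case True
        then show ?thesis using deg_homog[OF h] gens_alg[OF A] by simp
      next
        case False
        then show ?thesis using degD(2)[OF h] fam.subspace_0[OF subspace_alg] by (simp add: homog_0)
      qed
    qed
    show "fam.subspace {A. \<forall>g. homog g (A g) \<in> alg}"
    proof (rule subspace_linearI)
      show "0 \<in> {A. \<forall>g. homog g (A g) \<in> alg}"
        using fam.subspace_0[OF subspace_alg] by (simp add: homog_0)
      fix k A B assume "A \<in> {A. \<forall>g. homog g (A g) \<in> alg}" "B \<in> {A. \<forall>g. homog g (A g) \<in> alg}"
      moreover have "homog g ((fs k A + B) g) = fs k (homog g (A g)) + homog g (B g)" for g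
        by (auto simp: fun_eq_iff homog_def field_scale_def)
      ultimately show "fs k A + B \<in> {A. \<forall>g. homog g (A g) \<in> alg}"
        using fam.subspace_add[OF subspace_alg fam.subspace_scale[OF subspace_alg]] by auto
    qed
  qed
  then show ?thesis using assms by blast
qed

lemma Y_vac_left: assumes "B \<in> gen_fields" shows "Yv id_field p B = (if p = 0 then B else 0)"
  using assms
proof (induction rule: V.C_induct)
  case zero
  show ?case by (simp only: V.gf_0[OF Y_gf[OF vac_deg]] if_cancel)
next
  case (add h B E)
  note b = deg_cl[OF add(1)]
  have "yp 0 idf h (B h) p = (if p = 0 then B h else 0)"
  proof (rule gf_eqI[OF fprod_gf[OF gf_id cl_gf[OF b] cl_wcf[OF cl_id b]]])
    show "gf h (if p = 0 then B h else 0)" using cl_gf[OF b] cl_gf[OF cl_zero] by simp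
    show "yp 0 idf h (B h) p q w = (if p = 0 then B h else 0) q w" if "w \<in> W s" for s w q
      by (simp add: yp_id_left[OF cl_gf[OF b] that])
  qed
  then have eq: "Yv id_field p B = (if p = 0 then B else 0)"
    using Y_homog[OF vac_deg add(1), of p] deg_homog[OF add(1)] by (simp add: id_field_def homog_apply homog_0)
  show ?case
    unfolding V.gf_add[OF Y_gf[OF vac_deg] degD(1)[OF add(1)] add(2)] eq add(3)
    by (cases "p = 0") (simp_all only: if_True if_False add_0_right simp_thms)
qed

text \<open>Coefficients of a product of vertex operators are linear combinations of compositions of
  the two, so stability of \<open>alg\<close> passes from the factors to the product.\<close>

lemma fprod_S:
  assumes A: "A \<in> deg g" and B: "B \<in> deg h" and E: "E \<in> deg s" "E \<in> alg"
    and AS: "\<And>p E. E \<in> alg \<Longrightarrow> Yv A p E \<in> alg" and BS: "\<And>p E. E \<in> alg \<Longrightarrow> Yv B p E \<in> alg"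
  shows "V.fprod g (Yv A) n h (Yv B) P E \<in> alg"
proof (rule V.fprod_cases[of n g h])
  fix N
  have "V.commutator g (Yv A) h (Yv B) N' E p q \<in> alg" for N' p q
    unfolding V.commutator_def gap_coeff_def binom_mult_def
    by (intro fam.subspace_diff[OF subspace_alg] fam.subspace_scale[OF subspace_alg]
        fam.subspace_Sum_any[OF subspace_alg] AS BS E(2))
  then show "V.iprod g (Yv A) h (Yv B) N P E \<in> alg"
    unfolding V.fprod_int[OF Y_gf[OF A] Y_gf[OF B] E(1)]
    by (intro fam.subspace_Sum_any[OF subspace_alg] fam.subspace_scale[OF subspace_alg])
next
  assume ni: "n - form g h \<notin> \<int>"
  show "V.fprod g (Yv A) n h (Yv B) P E \<in> alg"
    unfolding V.fprod_nonint[OF ni] by (rule fam.subspace_0[OF subspace_alg])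
qed

lemma alg_left:
  assumes A: "A \<in> gen_fields" and "\<And>n B. B \<in> gens \<Longrightarrow> fam_prod A n B \<in> alg" and B: "B \<in> alg"
  shows "fam_prod A n B \<in> alg"
proof -
  have "alg \<subseteq> {B \<in> gen_fields. \<forall>n. fam_prod A n B \<in> alg}"
  proof (rule alg_minimal)
    show "gens \<subseteq> {B \<in> gen_fields. \<forall>n. fam_prod A n B \<in> alg}" using assms(2) gens_alg alg_Vc by blast
    show "fam.subspace {B \<in> gen_fields. \<forall>n. fam_prod A n B \<in> alg}"
    proof (rule subspace_linearI)
      show "0 \<in> {B \<in> gen_fields. \<forall>n. fam_prod A n B \<in> alg}"
        using fam_prod_zero(1)[OF A] zero_Vc fam.subspace_0[OF subspace_alg] by simp
      fix k B B' assume "B \<in> {B \<in> gen_fields. \<forall>n. fam_prod A n B \<in> alg}" "B' \<in> {B \<in> gen_fields. \<forall>n. fam_prod A n B \<in> alg}"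
      then show "fs k B + B' \<in> {B \<in> gen_fields. \<forall>n. fam_prod A n B \<in> alg}"
        using fam_prod_linear_right[OF A] Vc_linear
          fam.subspace_add[OF subspace_alg fam.subspace_scale[OF subspace_alg]] by simp
    qed
  qed
  then show ?thesis using B by blast
qed

text \<open>Induction on the left factor. By \<open>Y_prod\<close> the operator of
  \<open>fam_prod (homog g a) m A\<close> is a product of the operators of a generator and of
  \<open>A\<close>; the first preserves \<open>alg\<close> by construction, the second by the
  induction hypothesis.\<close>

lemma gens_closed: assumes "A \<in> gens" "B \<in> alg" shows "fam_prod A n B \<in> alg"
  using assms
proof (induction arbitrary: n B rule: gens_induct)
  case vac
  have "fam_prod id_field n B = Yv id_field (- n - 1) B" unfolding field_Y_def by simp
  then show ?case using Y_vac_left[of B "- n - 1"] alg_Vc vac fam.subspace_0[OF subspace_alg] by auto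
next
  case (prod g a m A)
  note g = \<Gamma>_deg[OF prod(1)]
  obtain h where h: "A \<in> deg h" using gens_deg[OF prod(2)] by blast
  have gS: "fam_prod (homog g a) n E \<in> alg" if "E \<in> alg" for n E
    by (rule alg_left[OF degD(1)[OF g] _ that]) (rule gens_alg[OF gens_prod[OF prod(1)]])
  show ?case
  proof (rule alg_left[OF degD(1)[OF fam_prod_deg[OF g h]] _ prod(4)])
    fix n E assume E: "E \<in> gens"
    obtain s where s: "E \<in> deg s" using gens_deg[OF E] by blast
    have "fam_prod (fam_prod (homog g a) m A) n E = V.fprod g (Yv (homog g a)) m h (Yv A) (- n - 1) E"
      unfolding Y_prod[OF g h s] field_Y_def by simp
    also have "\<dots> \<in> alg"
      by (rule fprod_S[OF g h s gens_alg[OF E]]) (simp_all add: field_Y_def gS prod(3))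
    finally show "fam_prod (fam_prod (homog g a) m A) n E \<in> alg" .
  qed
qed

lemma alg_closed: assumes "A \<in> alg" "B \<in> alg" shows "fam_prod A n B \<in> alg"
proof -
  have B: "B \<in> gen_fields" using assms(2) alg_Vc by blast
  have "alg \<subseteq> {A \<in> gen_fields. fam_prod A n B \<in> alg}"
  proof (rule alg_minimal)
    show "gens \<subseteq> {A \<in> gen_fields. fam_prod A n B \<in> alg}" using gens_closed[OF _ assms(2)] gens_alg alg_Vc by blast
    show "fam.subspace {A \<in> gen_fields. fam_prod A n B \<in> alg}"
    proof (rule subspace_linearI)
      show "0 \<in> {A \<in> gen_fields. fam_prod A n B \<in> alg}"
        using fam_prod_zero(2)[OF B] zero_Vc fam.subspace_0[OF subspace_alg] by simp
      fix k A A' assume "A \<in> {A \<in> gen_fields. fam_prod A n B \<in> alg}" "A' \<in> {A \<in> gen_fields. fam_prod A n B \<in> alg}"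
      then show "fs k A + A' \<in> {A \<in> gen_fields. fam_prod A n B \<in> alg}"
        using fam_prod_linear_left[OF _ _ B] Vc_linear
          fam.subspace_add[OF subspace_alg fam.subspace_scale[OF subspace_alg]] by simp
    qed
  qed
  then show ?thesis using assms(1) by blast
qed

lemma Y_alg: "A \<in> alg \<Longrightarrow> B \<in> alg \<Longrightarrow> Yv A p B \<in> alg"
  unfolding field_Y_def by (rule alg_closed)

abbreviation deg_alg where "deg_alg \<equiv> degree_part alg"

lemma deg_alg: "A \<in> deg_alg g \<longleftrightarrow> A \<in> deg g \<and> A \<in> alg"
  unfolding degree_part_def using alg_Vc by blast

lemma Y_creation: assumes "A \<in> gen_fields" shows "Yv A 0 id_field = A" "P \<notin> \<nat> \<Longrightarrow> Yv A P id_field = 0"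
proof -
  note id = degD(1)[OF vac_deg]
  have lin: "Yv (A + B) p id_field = Yv A p id_field + Yv B p id_field" if "A \<in> gen_fields" "B \<in> gen_fields" for A B p
    using Y_linear_left[OF id] that unfolding linear_map_on_def by blast
  have z: "Yv 0 p id_field = 0" for p unfolding field_Y_def by (rule fam_prod_zero(2)[OF id])
  show "Yv A 0 id_field = A" using assms
    by (induction rule: V.C_induct) (simp_all only: z lin[OF degD(1)] Y_vac_right_0)
  show "Yv A P id_field = 0" if "P \<notin> \<nat>" using assms
    by (induction rule: V.C_induct) (simp_all only: z lin[OF degD(1)] Y_vac_right_nonnat[OF _ that] add_0_right)
qed

lemma Ints_neg_minus_1: "form g h + (- n - 1) \<in> \<int> \<Longrightarrow> n - form g h \<in> \<int>" for n :: complex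
proof -
  assume i: "form g h + (- n - 1) \<in> \<int>"
  have "- (form g h + (- n - 1)) - 1 \<in> \<int>" by (rule Ints_diff[OF Ints_minus[OF i] Ints_1])
  then show ?thesis by simp
qed

lemma linear_map_on_subset: "linear_map_on sc1 T sc2 f \<Longrightarrow> T' \<subseteq> T \<Longrightarrow> linear_map_on sc1 T' sc2 f"
  unfolding linear_map_on_def by blast

theorem generated_algebra: "generalized_vertex_algebra form c fs alg deg_alg Yv id_field"
proof -
  have graded: "graded_subspace fs alg deg_alg"
    by (rule graded_subspace_degree_part[OF subspace_alg alg_Vc]) (rule alg_homog)
  have "generalized_vertex_algebra_axioms form c fs alg deg_alg Yv id_field"
  proof
    show "Yv u p v \<in> alg" if "u \<in> alg" "v \<in> alg" for u v p using Y_alg that .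
    show "linear_map_on fs alg fs (Yv u p)" if "u \<in> alg" for u p
      using linear_map_on_subset[OF Y_linear_right alg_Vc] that alg_Vc by blast
    show "linear_map_on fs alg fs (\<lambda>u. Yv u p v)" if "v \<in> alg" for v p
      using linear_map_on_subset[OF Y_linear_left alg_Vc] that alg_Vc by blast
    show "id_field \<in> deg_alg 0" unfolding deg_alg using vac_deg gens_alg[OF gens_vac] by blast
    show "mode (Yv u) l v \<in> deg_alg (g + h)" if "u \<in> deg_alg g" "v \<in> deg_alg h" for u v g h l
      using that Y_deg Y_alg unfolding deg_alg mode_def by blast
    show "\<exists>N. \<forall>l. Re l > N \<longrightarrow> mode (Yv u) l v = 0" if uv: "u \<in> deg_alg g" "v \<in> deg_alg h" for u v g h
    proof -
      obtain R where R: "\<And>p. Re p < R \<Longrightarrow> Yv u p v = 0"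
        using V.gf_lower[OF Y_gf, of u g v h] uv unfolding deg_alg by blast
      \<comment> \<open>Mode \<open>l\<close> is the coefficient at exponent \<open>- l - 1\<close>,
        so \<open>Re l > - R - 1\<close> means an exponent with real part below
        \<open>R\<close>.\<close>
      show ?thesis unfolding mode_def by (rule exI[of _ "- R - 1"]) (auto intro!: R)
    qed
    show "Yv id_field p v = (if p = 0 then v else 0)" if "v \<in> alg" for v p
      using Y_vac_left that alg_Vc by blast
    show "p \<in> \<nat>" if "v \<in> alg" "Yv v p id_field \<noteq> 0" for v p
      using Y_creation(2) that alg_Vc by blast
    show "Yv v 0 id_field = v" if "v \<in> alg" for v
      using Y_creation(1) that alg_Vc by blast
    show "n - form g h \<in> \<int>" if "u \<in> deg_alg g" "v \<in> deg_alg h" "mode (Yv u) n v \<noteq> 0" for u v g h n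
      using V.gf_Ints[OF Y_gf, of u g v h "- n - 1"] that Ints_neg_minus_1 unfolding deg_alg mode_def by blast
    show "jacobi_lhs fs (form g h) (c g h) (Yv u) (Yv v) w = jacobi_rhs fs (form g g') Yv Yv u v w"
      if "u \<in> deg_alg g" "v \<in> deg_alg h" "w \<in> deg_alg g'" for u v w g h g'
      using Y_jacobi that unfolding deg_alg by blast
  qed
  then show ?thesis
    using graded group_data_axioms unfolding generalized_vertex_algebra_def by blast
qed

lemma YW_deg: assumes "A \<in> deg g" shows "field_YW A = A g"
  unfolding field_YW_def by (rule Sum_any_single) (use degD(2)[OF assms] in blast)

lemma YW_apply: assumes "A \<in> gen_fields" "finite F" "{g. A g \<noteq> 0} \<subseteq> F"
  shows "field_YW A p w = (\<Sum>g\<in>F. A g p w)"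
  unfolding field_YW_def Sum_any.expand_superset[OF assms(2,3)] by (simp add: sum_fun_apply)

lemma YW_linear_left: "linear_map_on fs gen_fields sc (\<lambda>A. field_YW A p w)"
proof (rule linear_map_onI[OF _ vs subspace_Vc])
  fix k A B assume A: "A \<in> gen_fields" and B: "B \<in> gen_fields"
  let ?F = "{g. A g \<noteq> 0} \<union> {g. B g \<noteq> 0}"
  have F: "finite ?F" using Vc_finite[OF A] Vc_finite[OF B] by simp
  have "(fs k A + B) g = 0" if "A g = 0" "B g = 0" for g
    using that by (simp add: field_scale_def fun_eq_iff)
  then have "{g. (fs k A + B) g \<noteq> 0} \<subseteq> ?F" by blast
  then have "field_YW (fs k A + B) p w = (\<Sum>g\<in>?F. (fs k A + B) g p w)"
    by (rule YW_apply[OF Vc_linear[OF A B] F])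
  also have "\<dots> = (\<Sum>g\<in>?F. sc k (A g p w) + B g p w)" by (simp add: field_scale_def)
  also have "\<dots> = sc k (field_YW A p w) + field_YW B p w"
    by (simp add: YW_apply[OF A F] YW_apply[OF B F] sum.distrib scale_sum_right)
  finally show "field_YW (fs k A + B) p w = sc k (field_YW A p w) + field_YW B p w" .
qed

lemma YW_endo: assumes A: "A \<in> gen_fields" shows "Vector_Spaces.linear sc sc (field_YW A p)"
  unfolding Vector_Spaces.linear_iff YW_apply[OF A Vc_finite[OF A] order_refl]
  using vs by (simp add: gf_add[OF cl_gf[OF Vc_cl[OF A]]] gf_scale[OF cl_gf[OF Vc_cl[OF A]]]
      sum.distrib scale_sum_right)

theorem generated_module:
  "generalized_vertex_algebra_module form c fs alg deg_alg Yv id_field act formS sc W field_YW"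
proof -
  interpret G: generalized_vertex_algebra form c fs alg deg_alg Yv id_field by (rule generated_algebra)
  show ?thesis
  proof (unfold_locales)
    have lin: "Vector_Spaces.linear sc sc (field_YW u p)" if "u \<in> alg" for u p
      using YW_endo that alg_Vc by blast
    show "field_YW u p (x + y) = field_YW u p x + field_YW u p y" if "u \<in> alg" for u p x y
      using lin[OF that] unfolding Vector_Spaces.linear_iff by blast
    show "field_YW u p (sc k x) = sc k (field_YW u p x)" if "u \<in> alg" for u p k x
      using lin[OF that] unfolding Vector_Spaces.linear_iff by blast
    show "linear_map_on fs alg sc (\<lambda>u. field_YW u p w)" for p w
      by (rule linear_map_on_subset[OF YW_linear_left alg_Vc])
    show "mode (field_YW u) l w \<in> W (act g s)" if "u \<in> deg_alg g" "w \<in> W s" for u w g s l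
      using that gf_W[OF cl_gf[OF deg_cl]] unfolding deg_alg mode_def by (auto simp: YW_deg)
    show "\<exists>N. \<forall>l. Re l > N \<longrightarrow> mode (field_YW u) l w = 0" if u: "u \<in> deg_alg g" for u g w
    proof -
      have u: "u \<in> deg g" using u unfolding deg_alg by blast
      obtain R where R: "\<And>p. Re p < R \<Longrightarrow> u g p w = 0"
        using gf_lower_C[OF cl_gf[OF deg_cl[OF u]], of w] by blast
      show ?thesis unfolding mode_def YW_deg[OF u] by (rule exI[of _ "- R - 1"]) (auto intro!: R)
    qed
    show "field_YW (id_field :: ('g, 'w) field_family) p w = (if p = 0 then w else 0)" for p w
      unfolding YW_deg[OF vac_deg] by (simp add: id_field_def homog_apply)
    show "n - formS g s \<in> \<int>" if u: "u \<in> deg_alg g" and w: "w \<in> W s" and nz: "mode (field_YW u) n w \<noteq> 0" for u w g s n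
    proof -
      have u: "u \<in> deg g" using u unfolding deg_alg by blast
      have "formS g s + (- n - 1) \<in> \<int>"
        using gf_Ints[OF cl_gf[OF deg_cl[OF u]] w] nz unfolding mode_def YW_deg[OF u] by blast
      then have "- (formS g s + (- n - 1)) - 1 \<in> \<int>" by (rule Ints_diff[OF Ints_minus Ints_1])
      then show ?thesis by simp
    qed
    show "jacobi_lhs sc (form g h) (c g h) (field_YW u) (field_YW v) w = jacobi_rhs sc (formS g s) field_YW Yv u v w"
      if uv: "u \<in> deg_alg g" "v \<in> deg_alg h" and w: "w \<in> W s" for u v w g h s
    proof
      fix e :: exps
      obtain e0 e1 e2 where e: "e = (e0, e1, e2)" by (cases e)
      have u: "u \<in> deg g" and v: "v \<in> deg h" using uv unfolding deg_alg by blast+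
      note cu = deg_cl[OF u] and cv = deg_cl[OF v]
      \<comment> \<open>The vector \<open>Yv u p v\<close> is itself given by a product of fields on
        \<open>W\<close>, so the module identity is the Jacobi identity already known for
        \<open>u g\<close> and \<open>v h\<close>.\<close>
      have "field_YW (Yv u p v) q w = yp g (u g) h (v h) p q w" for p q
        by (simp only: YW_deg[OF Y_deg[OF u v]]) (simp only: Y_homog[OF u v] homog_apply)
      then show "jacobi_lhs sc (form g h) (c g h) (field_YW u) (field_YW v) w e = jacobi_rhs sc (formS g s) field_YW Yv u v w e"
        unfolding e YW_deg[OF u] YW_deg[OF v] jacobi_lhs_eq[OF cl_gf[OF cu] cl_gf[OF cv] cl_wcf[OF cu cv] w]
        by (simp add: jacobi_rhs_coeff jacobi_rhs_eq_0)
    qed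
  qed
qed

lemma alg_field_space: "alg \<subseteq> field_space act formS sc W"
  using alg_Vc Vc_finite cl_gf[OF Vc_cl] field_comp_iff unfolding field_space_def by blast

lemma alg_weakly_commutative:
  assumes "A \<in> alg" "B \<in> alg" shows "weakly_commutative form c sc g (A g) h (B h)"
proof -
  have "generated g (A g)" "generated h (B h)" using assms alg_Vc Vc_cl by blast+
  then show ?thesis by (intro wcf_weakly_commutative cl_gf cl_wcf) auto
qed

end

theorem theorem3p15:
  fixes form c :: "'g::ab_group_add \<Rightarrow> 'g \<Rightarrow> complex"
    and act :: "'g \<Rightarrow> 's \<Rightarrow> 's"
    and formS :: "'g \<Rightarrow> 's \<Rightarrow> complex"
    and sc :: "complex \<Rightarrow> 'w::ab_group_add \<Rightarrow> 'w"
    and W :: "'s \<Rightarrow> 'w set"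
    and \<Gamma> :: "('g \<times> (complex \<Rightarrow> 'w \<Rightarrow> 'w)) set"
  assumes data: "gset_data form c act formS"
    and W: "graded_subspace sc UNIV W"
    and parafermion: "\<And>g a. (g, a) \<in> \<Gamma> \<Longrightarrow> parafermion_field form c act formS sc W g a"
    and pairwise: "\<And>g a h b. (g, a) \<in> \<Gamma> \<Longrightarrow> (h, b) \<in> \<Gamma> \<Longrightarrow> weakly_commutative form c sc g a h b"
  shows "let V = generated_space form c formS sc W \<Gamma>; Y = field_Y form c formS sc W in
      V \<subseteq> field_space act formS sc W \<and>
      (\<forall>A\<in>V. \<forall>B\<in>V. \<forall>g h. weakly_commutative form c sc g (A g) h (B h)) \<and>
      generalized_vertex_algebra form c (field_scale sc) V (degree_part V) Y id_field \<and>
      generalized_vertex_algebra_module form c (field_scale sc) V (degree_part V) Y id_field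
        act formS sc W field_YW"
proof -
  have F: "field_setting form c act formS sc UNIV W"
    unfolding field_setting_def using data W by simp
  interpret F: field_setting form c act formS sc UNIV W by (rule F)
  have gf: "F.gf g a" if "(g, a) \<in> \<Gamma>" for g a
    using parafermion[OF that] F.field_comp_iff unfolding parafermion_field_def by blast
  have "field_algebra form c act formS sc W \<Gamma>"
    unfolding field_algebra_def field_algebra_axioms_def
    using F gf F.weakly_commutative_wcf[OF gf gf pairwise] by blast
  then interpret A: field_algebra form c act formS sc W \<Gamma> .
  show ?thesis
    unfolding Let_def A.alg_def[symmetric]
    using A.alg_field_space A.alg_weakly_commutative A.generated_algebra A.generated_module by blast
qed

end
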